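(* Let $\alpha\in(1,2]$, let $X$, $S_t$, $c_\alpha$, $B_p$ be as in the context, let $\alpha'$ satisfy $1/\alpha+1/\alpha'=1$, and let $B\subset\mathbb{R}^d$ be a convex body with non-empty interior. Then $$\lim_{t\to0} t^{-1/\alpha}\big(\mathbb{E}\,V_d(S_t+B)-V_d(B)\big)=d\,c_\alpha\, V(B,\ldots,B,B_{\alpha'}),$$ where in $V(B,\ldots,B,B_{\alpha'})$ the body $B$ appears $d-1$ times.
   Context: Fix $\alpha\in(1,2]$ and an integer $d\ge1$. $X=(X_1,\ldots,X_d)$ is an $\mathbb{R}^d$-valued process with right-continuous paths having left limits, whose components are independent symmetric $\alpha$-stable Lévy processes with scale parameter $1$ started at $0$, i.e. $\mathbb{E}\exp[isX_j(t)]=\exp[-t|s|^\alpha]$. For $t\ge0$, $S_t$ is the closure of $\{X(s):0\le s\le t\}$. $c_\alpha:=\frac{\alpha}{2}\mathbb{E}|X_1(1)|$. $V_d$ is Lebesgue measure on $\mathbb{R}^d$, $A+C=\{x+y:x\in A,y\in C\}$ is Minkowski addition, $V(\cdot,\ldots,\cdot)$ is the mixed volume of $d$ convex bodies, and $B_p:=\{u\in\mathbb{R}^d:(\sum_i|u_i|^p)^{1/p}\le1\}$. *)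

theory Defs
  imports "HOL-Probability.Probability"
begin

definition minkowski :: "'a::ab_group_add set \<Rightarrow> 'a set \<Rightarrow> 'a set" where
  "minkowski A C = {x + y | x y. x \<in> A \<and> y \<in> C}"

fun msum :: "'a::ab_group_add set list \<Rightarrow> 'a set" where
  "msum [] = {0}"
| "msum (K # Ks) = minkowski K (msum Ks)"

text \<open>Mixed volume V(K_1,...,K_n) of n convex bodies in an n-dimensional space,
  defined by the standard polarization (inclusion-exclusion) formula:
  V(K_1..K_n) = 1/n! * sum over nonempty J of (-1)^(n-|J|) * V_n(sum_{j in J} K_j).\<close>
definition mixed_volume :: "'a::euclidean_space set list \<Rightarrow> real" where
  "mixed_volume Ks =
     (let n = length Ks in
      (1 / fact n) * (\<Sum>J\<in>Pow {..<n} - {{}}.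
          (-1) ^ (n - card J) * measure lborel (msum (map (\<lambda>j. Ks ! j) (sorted_list_of_set J)))))"

definition convex_body :: "'a::euclidean_space set \<Rightarrow> bool" where
  "convex_body B \<longleftrightarrow> compact B \<and> convex B \<and> B \<noteq> {}"

definition lp_ball :: "real \<Rightarrow> (real^'d) set" where
  "lp_ball p = {u. (\<Sum>i\<in>UNIV. \<bar>u $ i\<bar> powr p) powr (1 / p) \<le> 1}"

definition sas_levy :: "'w measure \<Rightarrow> real \<Rightarrow> (real \<Rightarrow> 'w \<Rightarrow> real) \<Rightarrow> bool" where
  "sas_levy M \<alpha> Y \<longleftrightarrow>
     (\<forall>t\<ge>0. Y t \<in> borel_measurable M) \<and>
     (\<forall>\<omega>\<in>space M. Y 0 \<omega> = 0) \<and>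
     (\<forall>\<omega>\<in>space M. \<forall>t\<ge>0. continuous (at_right t) (\<lambda>s. Y s \<omega>)) \<and>
     (\<forall>\<omega>\<in>space M. \<forall>t>0. \<exists>l. ((\<lambda>s. Y s \<omega>) \<longlongrightarrow> l) (at_left t)) \<and>
     (\<forall>ts::real list. sorted ts \<and> (\<forall>t\<in>set ts. 0 \<le> t) \<longrightarrow>
        prob_space.indep_vars M (\<lambda>_. borel) (\<lambda>i \<omega>. Y (ts ! Suc i) \<omega> - Y (ts ! i) \<omega>)
          {..<length ts - 1}) \<and>
     (\<forall>s t. 0 \<le> s \<and> s \<le> t \<longrightarrow>
        distr M borel (\<lambda>\<omega>. Y t \<omega> - Y s \<omega>) = distr M borel (Y (t - s))) \<and>
     (\<forall>t\<ge>0. \<forall>\<xi>::real. char (distr M borel (Y t)) \<xi> = complex_of_real (exp (- t * \<bar>\<xi>\<bar> powr \<alpha>)))"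

definition range_set :: "(real \<Rightarrow> 'w \<Rightarrow> 'a::topological_space) \<Rightarrow> real \<Rightarrow> 'w \<Rightarrow> 'a set" where
  "range_set X t \<omega> = closure ((\<lambda>s. X s \<omega>) ` {0..t})"

end

theory Submission
  imports Defs
begin

text \<open>Let \<open>p\<close> be the gauge of \<open>B\<close> (translated so that \<open>0\<close> is an interior point). Then
  \<open>S + B\<close> is a sublevel set of the inf-convolution of \<open>p\<close> with \<open>S\<close>, and convexity of \<open>p\<close> gives the
  derivative of this inf-convolution under scaling of \<open>S\<close>: at almost every point it is the support
  function of \<open>S\<close> at the gradient of \<open>p\<close>. Integrating over a thin shell of levels avoids surface
  area measures and shows that the expected volume increases at the rate given by the mean support
  function of the range of \<open>X\<close>, and in the same way for a deterministic convex body instead of the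
  range. Self-similarity of \<open>X\<close> makes the expected volume a monotone function whose averages over
  levels determine its slope. By Spitzer's identity the mean support function of the range at time
  \<open>1\<close> is \<open>c\<^sub>\<alpha>\<close> times the \<open>\<alpha>\<close>-norm, i.e. \<open>c\<^sub>\<alpha>\<close> times the support function of the dual ball. For this
  ball the slope is a mixed volume, because volumes of Minkowski combinations are polynomials.\<close>

section \<open>Volumes of Minkowski combinations\<close>

text \<open>Three obstacles shape the argument. At a single level the difference quotient of the
  volumes is the scaled measure of a set that shrinks to the boundary of \<open>B\<close>, out of
  reach of dominated convergence; averaging over levels replaces it by the integral of a difference
  quotient of functions. Returning to one level needs monotonicity in the scale \<open>e\<close>,
  but \<open>e S\<close> does not grow with \<open>e\<close> when \<open>S\<close> is the range of a
  path, since such a set is not star-shaped. Only the law helps: the volume for \<open>e S\<close>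
  has the same mean as that for the path run up to time \<open>e powr \<alpha>\<close>, and ranges
  do grow with time. Finally, domination needs an integrable bound, while only first moments of the
  coordinates are at hand. Enclosing the range in a coordinate box yields a bound with one factor
  per coordinate, and independence makes the mean of the product finite. The dual ball enters only
  by comparison: a window integral for the range is a constant multiple of the one for the ball, and
  the latter is squeezed by a slope known from the mixed volume, so it is never evaluated.\<close>

definition lse_weight :: "'a::euclidean_space set \<Rightarrow> 'a \<Rightarrow> 'a \<Rightarrow> real" where
  "lse_weight P z p = exp (z \<bullet> p) / (\<Sum>q\<in>P. exp (z \<bullet> q))"

text \<open>The gradient of \<open>z \<mapsto> ln (\<Sum>q\<in>P. exp (z \<bullet> q))\<close>, that
  is, the mean of \<open>P\<close> under the softmax weights.\<close>

definition lse_grad :: "'a::euclidean_space set \<Rightarrow> 'a \<Rightarrow> 'a" where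
  "lse_grad P z = (\<Sum>p\<in>P. lse_weight P z p *\<^sub>R p)"

text \<open>The Hessian of log-sum-exp: the covariance operator of the softmax weights. Centring one
  of the two factors is enough, because the deviations have weighted sum zero.\<close>

definition lse_hess :: "'a::euclidean_space set \<Rightarrow> 'a \<Rightarrow> 'a \<Rightarrow> 'a" where
  "lse_hess P z h = (\<Sum>p\<in>P. (lse_weight P z p * (h \<bullet> p - h \<bullet> lse_grad P z)) *\<^sub>R p)"

lemma sum_exp_pos: "finite P \<Longrightarrow> P \<noteq> {} \<Longrightarrow> 0 < (\<Sum>q\<in>P. exp (z \<bullet> q))"
  for z :: "'a::euclidean_space"
  by (intro sum_pos) auto

lemma lse_weight_pos: "finite P \<Longrightarrow> P \<noteq> {} \<Longrightarrow> 0 < lse_weight P z p"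
  unfolding lse_weight_def using sum_exp_pos[of P z] by simp

lemma sum_lse_weight: "finite P \<Longrightarrow> P \<noteq> {} \<Longrightarrow> (\<Sum>p\<in>P. lse_weight P z p) = 1"
  unfolding lse_weight_def using sum_exp_pos[of P z]
  by (simp flip: sum_divide_distrib)

lemma lse_grad_in_hull:
  assumes "finite P" "P \<noteq> {}"
  shows "lse_grad P z \<in> convex hull P"
  unfolding lse_grad_def
  by (rule convex_sum) (use assms lse_weight_pos[OF assms] sum_lse_weight[OF assms]
      in \<open>auto intro: hull_inc less_imp_le\<close>)

lemma inner_lse_grad: "h \<bullet> lse_grad P z = (\<Sum>p\<in>P. lse_weight P z p * (h \<bullet> p))"
  unfolding lse_grad_def by (simp add: inner_sum_right)

lemma has_derivative_sum_exp:
  fixes z :: "'a::euclidean_space"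
  assumes "finite P" "P \<noteq> {}"
  shows "((\<lambda>z. \<Sum>q\<in>P. exp (z \<bullet> q)) has_derivative
           (\<lambda>h. (\<Sum>q\<in>P. exp (z \<bullet> q)) * (h \<bullet> lse_grad P z))) (at z)"
proof -
  have "((\<lambda>z. \<Sum>q\<in>P. exp (z \<bullet> q)) has_derivative (\<lambda>h. \<Sum>q\<in>P. (h \<bullet> q) * exp (z \<bullet> q))) (at z)"
    by (intro has_derivative_sum) (auto intro!: derivative_eq_intros)
  moreover have "(\<Sum>q\<in>P. (h \<bullet> q) * exp (z \<bullet> q)) = (\<Sum>q\<in>P. exp (z \<bullet> q)) * (h \<bullet> lse_grad P z)" for h
    unfolding inner_lse_grad lse_weight_def sum_distrib_left
    using sum_exp_pos[OF assms, of z] by (intro sum.cong) auto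
  ultimately show ?thesis by simp
qed

lemma has_derivative_ln_sum_exp:
  fixes z :: "'a::euclidean_space"
  assumes "finite P" "P \<noteq> {}"
  shows "((\<lambda>z. ln (\<Sum>q\<in>P. exp (z \<bullet> q))) has_derivative (\<lambda>h. h \<bullet> lse_grad P z)) (at z)"
proof -
  define Z where "Z = (\<lambda>z::'a. \<Sum>q\<in>P. exp (z \<bullet> q))"
  have Z: "0 < Z z" unfolding Z_def by (rule sum_exp_pos[OF assms])
  have dZ: "(Z has_derivative (\<lambda>h. Z z * (h \<bullet> lse_grad P z))) (at z)"
    unfolding Z_def by (rule has_derivative_sum_exp[OF assms])
  have "((\<lambda>z. ln (Z z)) has_derivative (\<lambda>h. h \<bullet> lse_grad P z)) (at z)"
    using Z by (auto intro!: derivative_eq_intros dZ simp: field_simps)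
  then show ?thesis unfolding Z_def .
qed

lemma has_derivative_lse_weight:
  fixes z :: "'a::euclidean_space"
  assumes "finite P" "P \<noteq> {}"
  shows "((\<lambda>z. lse_weight P z p) has_derivative
           (\<lambda>h. lse_weight P z p * (h \<bullet> p - h \<bullet> lse_grad P z))) (at z)"
proof -
  define Z where "Z = (\<lambda>z::'a. \<Sum>q\<in>P. exp (z \<bullet> q))"
  have Z: "0 < Z z" unfolding Z_def by (rule sum_exp_pos[OF assms])
  have dZ: "(Z has_derivative (\<lambda>h. Z z * (h \<bullet> lse_grad P z))) (at z)"
    unfolding Z_def by (rule has_derivative_sum_exp[OF assms])
  have "((\<lambda>z. exp (z \<bullet> p) / Z z) has_derivative
       (\<lambda>h. exp (z \<bullet> p) / Z z * (h \<bullet> p - h \<bullet> lse_grad P z))) (at z)"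
    using Z by (auto intro!: derivative_eq_intros dZ simp: field_simps)
  then show ?thesis unfolding lse_weight_def Z_def .
qed

lemma has_derivative_lse_grad:
  fixes z :: "'a::euclidean_space"
  assumes "finite P" "P \<noteq> {}"
  shows "(lse_grad P has_derivative lse_hess P z) (at z)"
  unfolding lse_grad_def[abs_def] lse_hess_def[abs_def]
  using has_derivative_lse_weight[OF assms, of _ z, unfolded lse_grad_def]
  by (intro has_derivative_sum) (auto intro!: derivative_eq_intros)

text \<open>The quadratic form of a covariance is a variance. The cross term with the mean vanishes,
  which allows \<open>h \<bullet> p\<close> to be centred in the second factor as well.\<close>

lemma inner_lse_hess:
  assumes "finite P" "P \<noteq> {}"
  shows "h \<bullet> lse_hess P z h = (\<Sum>p\<in>P. lse_weight P z p * (h \<bullet> p - h \<bullet> lse_grad P z)\<^sup>2)"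
proof -
  let ?m = "h \<bullet> lse_grad P z"
  have "(\<Sum>p\<in>P. lse_weight P z p * (h \<bullet> p - ?m) * ?m)
      = ?m * ((\<Sum>p\<in>P. lse_weight P z p * (h \<bullet> p)) - ?m * (\<Sum>p\<in>P. lse_weight P z p))"
    by (simp add: sum_distrib_left sum_distrib_right sum_subtractf algebra_simps)
  then have z: "(\<Sum>p\<in>P. lse_weight P z p * (h \<bullet> p - ?m) * ?m) = 0"
    by (simp add: sum_lse_weight[OF assms] flip: inner_lse_grad)
  have "h \<bullet> lse_hess P z h = (\<Sum>p\<in>P. lse_weight P z p * (h \<bullet> p - ?m) * (h \<bullet> p))"
    unfolding lse_hess_def by (simp add: inner_sum_right)
  also have "\<dots> = (\<Sum>p\<in>P. lse_weight P z p * (h \<bullet> p - ?m)\<^sup>2)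
                  + (\<Sum>p\<in>P. lse_weight P z p * (h \<bullet> p - ?m) * ?m)"
    unfolding sum.distrib[symmetric] by (intro sum.cong) (auto simp: power2_eq_square algebra_simps)
  finally show ?thesis using z by simp
qed

lemma inner_lse_hess_nonneg:
  assumes "finite P" "P \<noteq> {}"
  shows "0 \<le> h \<bullet> lse_hess P z h"
  unfolding inner_lse_hess[OF assms]
  by (intro sum_nonneg mult_nonneg_nonneg less_imp_le[OF lse_weight_pos[OF assms]] zero_le_power2)

text \<open>A vanishing variance would put \<open>P\<close>, and with it the hull, on a hyperplane
  orthogonal to \<open>h\<close>, whose interior is empty.\<close>

lemma inner_lse_hess_pos:
  fixes h :: "'a::euclidean_space"
  assumes "finite P" "interior (convex hull P) \<noteq> {}" "h \<noteq> 0"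
  shows "0 < h \<bullet> lse_hess P z h"
proof (rule ccontr)
  have ne: "P \<noteq> {}" using assms(2) by auto
  note w = lse_weight_pos[OF assms(1) ne]
  assume "\<not> ?thesis"
  then have "(\<Sum>p\<in>P. lse_weight P z p * (h \<bullet> p - h \<bullet> lse_grad P z)\<^sup>2) = 0"
    using inner_lse_hess_nonneg[OF assms(1) ne, of h z] inner_lse_hess[OF assms(1) ne, of h z] by simp
  then have "\<forall>p\<in>P. lse_weight P z p * (h \<bullet> p - h \<bullet> lse_grad P z)\<^sup>2 = 0"
    using assms(1) less_imp_le[OF w] by (subst (asm) sum_nonneg_eq_0_iff) auto
  then have "P \<subseteq> {v. h \<bullet> v = h \<bullet> lse_grad P z}" using w by (force simp: less_le)
  then have "convex hull P \<subseteq> {v. h \<bullet> v = h \<bullet> lse_grad P z}"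
    by (rule hull_minimal) (rule convex_hyperplane)
  then have "interior (convex hull P) \<subseteq> interior {v. h \<bullet> v = h \<bullet> lse_grad P z}"
    by (rule interior_mono)
  then show False using assms(2,3) interior_hyperplane[of h] by auto
qed

lemma linear_lse_hess: "linear (lse_hess P z)"
  unfolding lse_hess_def
  by (intro linearI) (simp_all add: inner_add_left algebra_simps sum.distrib[symmetric] scaleR_sum_right)

text \<open>Follow the determinant along the segment from the identity, where it is 1, to
  \<open>A\<close>. A zero strictly before \<open>A\<close> would give a kernel vector on which the
  quadratic form is positive, so the sign cannot change. Symmetry of \<open>A\<close>, and hence
  diagonalisation, plays no part in this route.\<close>

lemma det_nonneg_of_nonneg_form:
  fixes A :: "real^'n^'n"
  assumes "\<And>h. 0 \<le> h \<bullet> (A *v h)"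
  shows "0 \<le> det A"
proof (rule ccontr)
  assume neg: "\<not> 0 \<le> det A"
  define f where "f = (\<lambda>t::real. det ((1 - t) *\<^sub>R mat 1 + t *\<^sub>R A :: real^'n^'n))"
  have "continuous_on {0..1} f"
    unfolding f_def det_def by (intro continuous_intros)
  moreover have "f 0 = 1" "f 1 = det A" unfolding f_def by auto
  ultimately obtain t where t: "0 \<le> t" "t \<le> 1" "f t = 0"
    using IVT2'[of f 1 0 0] neg by (auto simp: continuous_on_def)
  then have "t < 1" using \<open>f 1 = det A\<close> neg by (cases "t = 1") auto
  let ?B = "(1 - t) *\<^sub>R mat 1 + t *\<^sub>R A :: real^'n^'n"
  from t have "\<not> invertible ?B" by (simp add: f_def invertible_det_nz)
  then obtain h where h: "?B *v h = 0" "h \<noteq> 0"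
    using matrix_left_invertible_ker[of ?B] invertible_left_inverse[of ?B] by auto
  have "0 = h \<bullet> (?B *v h)" using h by simp
  also have "\<dots> = (1 - t) * (h \<bullet> h) + t * (h \<bullet> (A *v h))"
    by (simp add: matrix_vector_mult_add_rdistrib scaleR_matrix_vector_assoc[symmetric] inner_add_right)
  also have "\<dots> > 0"
    using \<open>t < 1\<close> t h assms[of h] by (intro add_pos_nonneg mult_pos_pos mult_nonneg_nonneg) auto
  finally show False by simp
qed

lemma det_affine_eq_poly:
  fixes A B :: "real^'n^'n"
  obtains p where "degree p \<le> CARD('n)" "\<And>x. det (x *\<^sub>R A + B) = poly p x"
proof
  let ?p = "\<Sum>\<pi>\<in>{\<pi>. \<pi> permutes (UNIV::'n set)}. Polynomial.smult (of_int (sign \<pi>)) (\<Prod>i\<in>UNIV. [:B $ i $ \<pi> i, A $ i $ \<pi> i:])"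
  show "degree ?p \<le> CARD('n)"
  proof (rule degree_sum_le)
    fix \<pi> :: "'n \<Rightarrow> 'n"
    have "degree (\<Prod>i\<in>UNIV. [:B $ i $ \<pi> i, A $ i $ \<pi> i:]) \<le> (\<Sum>i\<in>(UNIV::'n set). degree [:B $ i $ \<pi> i, A $ i $ \<pi> i:])"
      by (rule order_trans[OF degree_prod_sum_le]) auto
    also have "\<dots> \<le> (\<Sum>i\<in>(UNIV::'n set). 1)" by (intro sum_mono) simp
    finally show "degree (Polynomial.smult (of_int (sign \<pi>)) (\<Prod>i\<in>UNIV. [:B $ i $ \<pi> i, A $ i $ \<pi> i:])) \<le> CARD('n)"
      using degree_smult_le order_trans by fastforce
  qed (simp add: finite_permutations)
  show "det (x *\<^sub>R A + B) = poly ?p x" for x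
    by (simp add: det_def poly_sum poly_prod algebra_simps)
qed

section \<open>Minkowski sums of polytopes as gradient images\<close>

lemma compact_minkowski:
  fixes A C :: "'a::euclidean_space set"
  shows "compact A \<Longrightarrow> compact C \<Longrightarrow> compact (minkowski A C)"
  unfolding minkowski_def by (rule compact_sums)

lemma convex_minkowski:
  fixes A C :: "'a::euclidean_space set"
  assumes "convex A" "convex C" shows "convex (minkowski A C)"
proof -
  have "minkowski A C = (\<Union>x\<in>A. \<Union>y\<in>C. {x + y})" by (auto simp: minkowski_def)
  then show ?thesis using convex_sums[OF assms] by simp
qed

text \<open>Log-sum-exp dominates each linear functional \<open>z \<bullet> p\<close>, hence the
  support function of the hull. This bound makes the convex function in the surjectivity argument
  coercive.\<close>

lemma ln_sum_exp_ge:
  fixes z :: "'a::euclidean_space"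
  assumes "finite P" "a \<in> convex hull P"
  shows "z \<bullet> a \<le> ln (\<Sum>q\<in>P. exp (z \<bullet> q))"
proof -
  let ?L = "ln (\<Sum>q\<in>P. exp (z \<bullet> q))"
  have "P \<noteq> {}" using assms(2) by auto
  have "P \<subseteq> {v. z \<bullet> v \<le> ?L}"
  proof
    fix p assume "p \<in> P"
    then have "exp (z \<bullet> p) \<le> (\<Sum>q\<in>P. exp (z \<bullet> q))" using assms(1) by (intro member_le_sum) auto
    then have "ln (exp (z \<bullet> p)) \<le> ?L" using sum_exp_pos[OF assms(1) \<open>P \<noteq> {}\<close>, of z]
      by (subst ln_le_cancel_iff) auto
    then show "p \<in> {v. z \<bullet> v \<le> ?L}" by simp
  qed
  then have "convex hull P \<subseteq> {v. z \<bullet> v \<le> ?L}"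
    by (rule hull_minimal) (rule convex_halfspace_le)
  then show ?thesis using assms(2) by auto
qed

text \<open>The map is the gradient of a strictly convex function. Paired with \<open>b - a\<close>
  along the segment from \<open>a\<close> to \<open>b\<close> it has positive derivative, so it
  cannot take equal values at the two ends.\<close>

lemma inj_lse_grad_combination:
  fixes P Q :: "'a::euclidean_space set"
  assumes P: "finite P" "interior (convex hull P) \<noteq> {}" and Q: "finite Q" "Q \<noteq> {}" and x: "0 < x"
  shows "inj (\<lambda>z. x *\<^sub>R lse_grad P z + lse_grad Q z)"
proof (rule injI, rule ccontr)
  fix a b assume eq: "x *\<^sub>R lse_grad P a + lse_grad Q a = x *\<^sub>R lse_grad P b + lse_grad Q b" and "a \<noteq> b"
  have ne: "P \<noteq> {}" using P by auto
  define h where "h = b - a"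
  have h: "h \<noteq> 0" using \<open>a \<noteq> b\<close> by (simp add: h_def)
  define \<phi> where "\<phi> = (\<lambda>t::real. h \<bullet> (x *\<^sub>R lse_grad P (a + t *\<^sub>R h) + lse_grad Q (a + t *\<^sub>R h)))"
  have line: "((\<lambda>t. a + t *\<^sub>R h) has_derivative (\<lambda>s. s *\<^sub>R h)) (at t)" for t
    by (auto intro!: derivative_eq_intros)
  have d: "(\<phi> has_derivative (\<lambda>s. s * (h \<bullet> (x *\<^sub>R lse_hess P (a + t *\<^sub>R h) h + lse_hess Q (a + t *\<^sub>R h) h)))) (at t)" for t
  proof -
    note dP = has_derivative_compose[OF line has_derivative_lse_grad[OF P(1) ne], of t]
    note dQ = has_derivative_compose[OF line has_derivative_lse_grad[OF Q], of t]
    have "(\<phi> has_derivative (\<lambda>s. h \<bullet> (x *\<^sub>R lse_hess P (a + t *\<^sub>R h) (s *\<^sub>R h) + lse_hess Q (a + t *\<^sub>R h) (s *\<^sub>R h)))) (at t)"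
      unfolding \<phi>_def by (auto intro!: derivative_eq_intros dP dQ simp: o_def)
    then show ?thesis
      by (simp add: linear_cmul[OF linear_lse_hess] inner_add_right algebra_simps)
  qed
  have d': "(\<phi> has_real_derivative (h \<bullet> (x *\<^sub>R lse_hess P (a + t *\<^sub>R h) h + lse_hess Q (a + t *\<^sub>R h) h))) (at t)" for t
    unfolding has_field_derivative_def by (rule has_derivative_eq_rhs[OF d]) (simp add: fun_eq_iff mult.commute)
  have "\<exists>t::real. 0 < t \<and> t < 1 \<and> \<phi> 1 - \<phi> 0 = (1 - 0) * (h \<bullet> (x *\<^sub>R lse_hess P (a + t *\<^sub>R h) h + lse_hess Q (a + t *\<^sub>R h) h))"
    by (rule MVT2) (simp, rule d')
  then obtain t where "\<phi> 1 - \<phi> 0 = (1 - 0) * (h \<bullet> (x *\<^sub>R lse_hess P (a + t *\<^sub>R h) h + lse_hess Q (a + t *\<^sub>R h) h))"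
    by blast
  moreover have "\<phi> 1 = \<phi> 0" unfolding \<phi>_def h_def using eq by simp
  moreover have "0 < h \<bullet> (x *\<^sub>R lse_hess P (a + t *\<^sub>R h) h + lse_hess Q (a + t *\<^sub>R h) h)"
    using inner_lse_hess_pos[OF P h] inner_lse_hess_nonneg[OF Q] x
    by (simp add: inner_add_right add_pos_nonneg)
  ultimately show False by simp
qed

text \<open>A point \<open>y\<close> is hit where the convex function \<open>g\<close>, the
  potential minus \<open>z \<bullet> y\<close>, has a minimum. A ball of radius \<open>e\<close>
  around \<open>y\<close> inside the Minkowski sum forces \<open>g z\<close> to be at least
  \<open>e * norm z\<close>, so the minimum is attained.\<close>

lemma interior_subset_range_lse_grad:
  fixes P Q :: "'a::euclidean_space set"
  assumes P: "finite P" "P \<noteq> {}" and Q: "finite Q" "Q \<noteq> {}" and x: "0 < x"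
  assumes y: "y \<in> interior (minkowski ((\<lambda>v. x *\<^sub>R v) ` (convex hull P)) (convex hull Q))"
  shows "y \<in> range (\<lambda>z. x *\<^sub>R lse_grad P z + lse_grad Q z)"
proof -
  define g where "g = (\<lambda>z. x * ln (\<Sum>p\<in>P. exp (z \<bullet> p)) + ln (\<Sum>q\<in>Q. exp (z \<bullet> q)) - z \<bullet> y)"
  have dg: "(g has_derivative (\<lambda>h. h \<bullet> (x *\<^sub>R lse_grad P z + lse_grad Q z - y))) (at z)" for z
    unfolding g_def
    by (rule derivative_eq_intros has_derivative_ln_sum_exp P Q refl)+
       (auto simp: inner_add_right inner_diff_right)
  then have "continuous_on UNIV g"
    by (intro continuous_at_imp_continuous_on ballI has_derivative_continuous)
  obtain e where e: "0 < e" "cball y e \<subseteq> minkowski ((\<lambda>v. x *\<^sub>R v) ` (convex hull P)) (convex hull Q)"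
    using y by (auto simp: mem_interior_cball)
  have grow: "e * norm z \<le> g z" for z
  proof -
    \<comment> \<open>For \<open>z = 0\<close> the quotient is 0 by convention and the point is
      \<open>y\<close> itself, so no case distinction arises.\<close>
    have "y + (e / norm z) *\<^sub>R z \<in> cball y e" using e(1) by (auto simp: dist_norm)
    then obtain a b where ab: "a \<in> convex hull P" "b \<in> convex hull Q" "y + (e / norm z) *\<^sub>R z = x *\<^sub>R a + b"
      using e(2) unfolding minkowski_def by blast
    have "z \<bullet> y + e * norm z = z \<bullet> (y + (e / norm z) *\<^sub>R z)"
      by (auto simp: inner_add_right dot_square_norm power2_eq_square)
    also have "\<dots> = x * (z \<bullet> a) + z \<bullet> b" by (simp add: ab(3) inner_add_right)
    also have "\<dots> \<le> x * ln (\<Sum>p\<in>P. exp (z \<bullet> p)) + ln (\<Sum>q\<in>Q. exp (z \<bullet> q))"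
      using ln_sum_exp_ge[OF P(1) ab(1), of z] ln_sum_exp_ge[OF Q(1) ab(2), of z] x
      by (intro add_mono mult_left_mono) auto
    finally show ?thesis by (simp add: g_def)
  qed
  \<comment> \<open>Outside this radius the growth bound exceeds \<open>\<bar>g 0\<bar>\<close>, so
    a minimum over the ball is a global one.\<close>
  define \<rho> where "\<rho> = (\<bar>g 0\<bar> + 1) / e"
  have \<rho>: "0 < \<rho>" using e(1) by (simp add: \<rho>_def add_nonneg_pos)
  have "\<exists>z\<in>cball 0 \<rho>. \<forall>w\<in>cball 0 \<rho>. g z \<le> g w"
    using \<rho> \<open>continuous_on UNIV g\<close>
    by (intro continuous_attains_inf) (auto intro: continuous_on_subset)
  then obtain z where z: "z \<in> cball 0 \<rho>" "\<And>w. w \<in> cball 0 \<rho> \<Longrightarrow> g z \<le> g w"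
    by blast
  have min: "g z \<le> g w" for w
  proof (cases "w \<in> cball 0 \<rho>")
    case False
    have "g z \<le> \<bar>g 0\<bar>" using z(2)[of 0] \<rho> by simp
    also have "\<dots> \<le> e * \<rho>" using e(1) by (simp add: \<rho>_def)
    also have "\<dots> \<le> e * norm w" using False e(1) by simp
    finally show ?thesis using grow[of w] by simp
  qed (use z in auto)
  have "(\<lambda>h. h \<bullet> (x *\<^sub>R lse_grad P z + lse_grad Q z - y)) = (\<lambda>h. 0)"
    by (rule differential_zero_maxmin[of z UNIV g]) (use dg min in auto)
  from fun_cong[OF this]
  have "(x *\<^sub>R lse_grad P z + lse_grad Q z - y) \<bullet> (x *\<^sub>R lse_grad P z + lse_grad Q z - y) = 0" .
  then have "y = x *\<^sub>R lse_grad P z + lse_grad Q z" by simp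
  then show ?thesis by blast
qed

text \<open>Gromov's observation: the gradient of a sum of log-sum-exp functions maps the whole space
  onto the Minkowski sum of the polytopes, up to a null set, so that its volume is the integral of
  the Hessian determinant, which depends polynomially on the scaling factor.\<close>

lemma has_integral_det_lse_hess:
  fixes P Q :: "(real^'n::{finite,wellorder}) set"
  assumes P: "finite P" "interior (convex hull P) \<noteq> {}" and Q: "finite Q" "Q \<noteq> {}" and x: "0 < x"
  shows "((\<lambda>z. det (x *\<^sub>R matrix (lse_hess P z) + matrix (lse_hess Q z))) has_integral
           measure lebesgue (minkowski ((\<lambda>v. x *\<^sub>R v) ` (convex hull P)) (convex hull Q))) UNIV"
proof -
  have ne: "P \<noteq> {}" using P by auto
  define G where "G = (\<lambda>z. x *\<^sub>R lse_grad P z + lse_grad Q z)"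
  define G' where "G' = (\<lambda>z h. x *\<^sub>R lse_hess P z h + lse_hess Q z h)"
  define S where "S = minkowski ((\<lambda>v. x *\<^sub>R v) ` (convex hull P)) (convex hull Q)"
  have dG: "(G has_derivative G' z) (at z within UNIV)" for z
    unfolding G_def G'_def
    by (intro derivative_intros has_derivative_lse_grad P Q ne)
  have linG: "linear (G' z)" for z
    using dG has_derivative_linear by blast
  have mat: "matrix (G' z) = x *\<^sub>R matrix (lse_hess P z) + matrix (lse_hess Q z)" for z
    by (simp add: G'_def matrix_def vec_eq_iff)
  have "0 \<le> h \<bullet> G' z h" for z h
    unfolding G'_def using inner_lse_hess_nonneg[OF P(1) ne] inner_lse_hess_nonneg[OF Q] x
    by (simp add: inner_add_right)
  then have det: "0 \<le> det (matrix (G' z))" for z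
    by (intro det_nonneg_of_nonneg_form) (simp only: fun_cong[OF matrix_vector_mul(2)[OF linG]])
  have "convex S"
    unfolding S_def by (intro convex_minkowski convex_scaling convex_convex_hull)
  have "compact S"
    unfolding S_def by (intro compact_minkowski compact_scaling finite_imp_compact_convex_hull P Q)
  have sub: "range G \<subseteq> S"
    unfolding G_def S_def minkowski_def using lse_grad_in_hull[OF P(1) ne] lse_grad_in_hull[OF Q] by blast
  have "interior S \<subseteq> range G"
    unfolding G_def S_def using interior_subset_range_lse_grad[OF P(1) ne Q x] by blast
  \<comment> \<open>The image lies between the interior of \<open>S\<close> and \<open>S\<close>,
    and the frontier of a convex set is negligible.\<close>
  then have "sym_diff (range G) S \<subseteq> frontier S"
    using sub closure_subset[of S] by (auto simp: frontier_def)
  then have neg: "negligible (sym_diff (range G) S)"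
    using negligible_convex_frontier[OF \<open>convex S\<close>] negligible_subset by blast
  have S: "S \<in> lmeasurable" using \<open>compact S\<close> by (rule lmeasurable_compact)
  have "range G \<in> lmeasurable" "measure lebesgue (range G) = measure lebesgue S"
    using lmeasurable_negligible_symdiff[of S "range G"] S neg measure_negligible_symdiff[of S "range G"]
    by (auto simp: Un_commute)
  then have "((\<lambda>z. \<bar>det (matrix (G' z))\<bar>) has_integral measure lebesgue S) UNIV"
    using has_measure_differentiable_image[of UNIV G G' "measure lebesgue S"] dG
      inj_lse_grad_combination[OF P Q x, folded G_def] by auto
  then show ?thesis using det by (simp add: mat S_def)
qed

section \<open>Polynomial dependence of volumes, phrased as interpolation\<close>

text \<open>Interpolation expresses polynomiality as a linear identity between finitely many values,
  a form that survives integration over \<open>z\<close> and approximation of bodies by polytopes.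
  The nodes are \<open>1, ..., n + 1\<close>: the volume formula is available for positive scaling
  factors only, so 0 cannot be one of them.\<close>

lemma lagrange_basis_nat_nodes:
  fixes n :: nat
  obtains l :: "nat \<Rightarrow> real poly" where "\<And>i. i \<le> n \<Longrightarrow> degree (l i) \<le> n"
    "\<And>p x. degree p \<le> n \<Longrightarrow> poly p x = (\<Sum>i\<le>n. poly p (real (Suc i)) * poly (l i) x)"
proof
  define c where "c = (\<lambda>i. \<Prod>j\<in>{..n} - {i}. real (Suc i) - real (Suc j))"
  define l where "l = (\<lambda>i. Polynomial.smult (1 / c i) (\<Prod>j\<in>{..n} - {i}. [:- real (Suc j), 1:]))"
  show deg: "degree (l i) \<le> n" if "i \<le> n" for i
  proof -
    have "degree (\<Prod>j\<in>{..n} - {i}. [:- real (Suc j), 1:]) \<le> (\<Sum>j\<in>{..n} - {i}. degree [:- real (Suc j), 1:])"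
      by (rule order_trans[OF degree_prod_sum_le]) auto
    also have "\<dots> = n" using that by simp
    finally show ?thesis unfolding l_def by (intro order_trans[OF degree_smult_le])
  qed
  have val: "poly (l i) (real (Suc k)) = (if i = k then 1 else 0)" if "i \<le> n" "k \<le> n" for i k
  proof (cases "i = k")
    case True
    have "c k \<noteq> 0" unfolding c_def by (auto simp: prod_zero_iff)
    then show ?thesis using True by (simp add: l_def poly_prod c_def)
  next
    case False
    then have "(\<Prod>j\<in>{..n} - {i}. poly [:- real (Suc j), 1:] (real (Suc k))) = 0"
      using that by (intro prod_zero) (auto intro!: bexI[of _ k])
    then show ?thesis using False by (simp add: l_def poly_prod)
  qed
  fix p :: "real poly" and x assume p: "degree p \<le> n"
  let ?q = "\<Sum>i\<le>n. Polynomial.smult (poly p (real (Suc i))) (l i)"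
  have "p = ?q"
  proof (rule poly_eqI_degree)
    fix y assume "y \<in> (\<lambda>k. real (Suc k)) ` {..n}"
    then obtain k where k: "k \<le> n" "y = real (Suc k)" by auto
    have "poly ?q y = (\<Sum>i\<le>n. if i = k then poly p (real (Suc i)) else 0)"
      unfolding poly_sum k(2) by (intro sum.cong) (auto simp: val k simp del: of_nat_Suc)
    then show "poly p y = poly ?q y" using k by simp
  next
    have card: "card ((\<lambda>k. real (Suc k)) ` {..n}) = Suc n"
      by (subst card_image) (auto simp: inj_on_def)
    then show "degree p < card ((\<lambda>k. real (Suc k)) ` {..n})" using p by simp
    have "degree ?q \<le> n"
      by (intro degree_sum_le order_trans[OF degree_smult_le]) (auto intro: deg)
    then show "degree ?q < card ((\<lambda>k. real (Suc k)) ` {..n})" using card by simp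
  qed
  then have "poly p x = poly ?q x" by simp
  then show "poly p x = (\<Sum>i\<le>n. poly p (real (Suc i)) * poly (l i) x)"
    by (simp add: poly_sum)
qed

text \<open>For each \<open>z\<close> the Hessian determinant is a polynomial in \<open>x\<close>
  and satisfies the interpolation identity; integrating over \<open>z\<close> passes the identity on
  to the volumes.\<close>

lemma polytope_sum_volume_interpolation_wellorder:
  fixes P Q :: "(real^'n::{finite,wellorder}) set"
  assumes P: "finite P" "interior (convex hull P) \<noteq> {}" and Q: "finite Q" "Q \<noteq> {}" and x: "0 < x"
    and l: "\<And>p x. degree p \<le> CARD('n) \<Longrightarrow> poly p x = (\<Sum>i\<le>CARD('n). poly p (real (Suc i)) * poly (l i) x)"
  defines "v \<equiv> \<lambda>x. measure lebesgue (minkowski ((\<lambda>v. x *\<^sub>R v) ` (convex hull P)) (convex hull Q))"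
  shows "v x = (\<Sum>i\<le>CARD('n). v (real (Suc i)) * poly (l i) x)"
proof -
  let ?d = "\<lambda>x z. det (x *\<^sub>R matrix (lse_hess P z) + matrix (lse_hess Q z))"
  have v: "(?d x has_integral v x) UNIV" if "0 < x" for x
    unfolding v_def by (rule has_integral_det_lse_hess[OF P Q that])
  have "((\<lambda>z. \<Sum>i\<le>CARD('n). ?d (real (Suc i)) z * poly (l i) x) has_integral
          (\<Sum>i\<le>CARD('n). v (real (Suc i)) * poly (l i) x)) UNIV"
    by (intro has_integral_sum has_integral_mult_left v) auto
  moreover have "(\<lambda>z. \<Sum>i\<le>CARD('n). ?d (real (Suc i)) z * poly (l i) x) = ?d x"
  proof
    fix z
    obtain p where "degree p \<le> CARD('n)" "\<And>x. ?d x z = poly p x"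
      using det_affine_eq_poly by blast
    then show "(\<Sum>i\<le>CARD('n). ?d (real (Suc i)) z * poly (l i) x) = ?d x z"
      by (simp only: l[symmetric])
  qed
  ultimately have "(?d x has_integral (\<Sum>i\<le>CARD('n). v (real (Suc i)) * poly (l i) x)) UNIV" by (simp only:)
  then show ?thesis by (rule has_integral_unique[OF v[OF x]])
qed

text \<open>The change of variables theorem of the library needs a well-ordered index type; this type
  provides one for every finite type.\<close>

typedef (overloaded) 'a index = "{..<CARD('a::finite)}" by (auto intro!: exI[of _ 0])

instantiation index :: (finite) linorder
begin
definition less_eq_index :: "'a index \<Rightarrow> 'a index \<Rightarrow> bool" where "a \<le> b \<longleftrightarrow> Rep_index a \<le> Rep_index b"
definition less_index :: "'a index \<Rightarrow> 'a index \<Rightarrow> bool" where "a < b \<longleftrightarrow> Rep_index a < Rep_index b"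
instance by standard (auto simp: less_eq_index_def less_index_def Rep_index_inject)
end

instance index :: (finite) finite
  by standard (metis finite_imageI finite_lessThan type_definition.univ type_definition_index)

instance index :: (finite) wellorder
proof
  fix P :: "'a index \<Rightarrow> bool" and a
  assume *: "\<And>x. (\<And>y. y < x \<Longrightarrow> P y) \<Longrightarrow> P x"
  show "P a"
  proof (induction "Rep_index a" arbitrary: a rule: less_induct)
    case less
    show ?case by (rule *) (use less in \<open>auto simp: less_index_def\<close>)
  qed
qed

lemma card_index: "CARD('a index) = CARD('a::finite)"
  using type_definition.card[OF type_definition_index] by simp

definition reindex :: "('m::finite \<Rightarrow> 'n::finite) \<Rightarrow> real^'n \<Rightarrow> real^'m" where
  "reindex e v = (\<chi> i. v $ e i)"

lemma linear_reindex: "linear (reindex e)"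
  by (intro linearI) (simp_all add: reindex_def vec_eq_iff)

lemma reindex_reindex: "reindex e (reindex f v) = reindex (f \<circ> e) v"
  by (simp add: reindex_def vec_eq_iff)

lemma reindex_id: "reindex id v = v"
  by (simp add: reindex_def vec_eq_iff)

lemma distr_lborel_reindex:
  fixes e :: "'m::finite \<Rightarrow> 'n::finite"
  assumes "bij e"
  shows "distr lborel borel (reindex e) = lborel"
proof (rule lborel_eqI[symmetric])
  fix l u :: "real^'m" assume lu: "\<And>b. b \<in> Basis \<Longrightarrow> l \<bullet> b \<le> u \<bullet> b"
  have m: "reindex e \<in> borel_measurable borel"
    by (intro borel_measurable_continuous_onI linear_continuous_on linear_conv_bounded_linear[THEN iffD1] linear_reindex)
  have pre: "reindex e -` box l u = box (reindex (inv e) l) (reindex (inv e) u)"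
  proof -
    have "(\<forall>i. l $ i < v $ e i \<and> v $ e i < u $ i) \<longleftrightarrow> (\<forall>j. l $ inv e j < v $ j \<and> v $ j < u $ inv e j)" for v :: "real^'n"
      using assms by (metis bij_inv_eq_iff)
    then show ?thesis by (auto simp: mem_box_cart reindex_def)
  qed
  have le: "l $ i \<le> u $ i" for i using lu[of "axis i 1"] by (auto simp: inner_axis)
  have "emeasure (distr lborel borel (reindex e)) (box l u) = emeasure lborel (box (reindex (inv e) l) (reindex (inv e) u))"
    using m by (subst emeasure_distr) (auto simp: pre)
  also have "\<dots> = (\<Prod>b\<in>Basis. (reindex (inv e) u - reindex (inv e) l) \<bullet> b)"
    using le by (intro emeasure_lborel_box) (auto simp: Basis_vec_def inner_axis reindex_def)
  also have "(\<Prod>b\<in>Basis. (reindex (inv e) u - reindex (inv e) l) \<bullet> b) = (\<Prod>j\<in>UNIV. u $ inv e j - l $ inv e j)"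
    by (simp add: Basis_vec_def UNION_singleton_eq_range prod.reindex inj_on_def axis_eq_axis inner_axis reindex_def)
  also have "\<dots> = (\<Prod>i\<in>UNIV. u $ i - l $ i)"
    using assms by (intro prod.reindex_bij_betw[of "inv e" UNIV UNIV "\<lambda>i. u $ i - l $ i"]) (simp add: bij_imp_bij_inv)
  also have "\<dots> = (\<Prod>b\<in>Basis. (u - l) \<bullet> b)"
    by (simp add: Basis_vec_def UNION_singleton_eq_range prod.reindex inj_on_def axis_eq_axis inner_axis)
  finally show "emeasure (distr lborel borel (reindex e)) (box l u) = (\<Prod>b\<in>Basis. (u - l) \<bullet> b)" .
qed simp

lemma minkowski_linear_image:
  assumes "linear f"
  shows "f ` minkowski A C = minkowski (f ` A) (f ` C)"
  unfolding minkowski_def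
proof (intro equalityI subsetI)
  fix z assume "z \<in> {x + y |x y. x \<in> f ` A \<and> y \<in> f ` C}"
  then obtain a c where "a \<in> A" "c \<in> C" "z = f (a + c)" by (auto simp: linear_add[OF assms])
  then show "z \<in> f ` {x + y |x y. x \<in> A \<and> y \<in> C}" by blast
qed (auto simp: linear_add[OF assms], blast)

lemma measure_lebesgue_compact: "compact S \<Longrightarrow> measure lebesgue S = measure lborel S"
  by (intro measure_completion) (simp add: borel_compact)

text \<open>Renaming coordinates is a volume-preserving linear bijection that commutes with hulls,
  scalings and sums, so the result for the well-ordered index type carries over to every finite
  one.\<close>

lemma polytope_sum_volume_interpolation:
  fixes P Q :: "(real^'n) set"
  assumes P: "finite P" "interior (convex hull P) \<noteq> {}" and Q: "finite Q" "Q \<noteq> {}" and x: "0 < x"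
    and l: "\<And>p x. degree p \<le> CARD('n) \<Longrightarrow> poly p x = (\<Sum>i\<le>CARD('n). poly p (real (Suc i)) * poly (l i) x)"
  defines "v \<equiv> \<lambda>x. measure lborel (minkowski ((\<lambda>v. x *\<^sub>R v) ` (convex hull P)) (convex hull Q))"
  shows "v x = (\<Sum>i\<le>CARD('n). v (real (Suc i)) * poly (l i) x)"
proof -
  obtain e :: "'n index \<Rightarrow> 'n" where e: "bij e"
    using finite_same_card_bij[of "UNIV :: 'n index set" "UNIV :: 'n set"] by (auto simp: card_index)
  define T where "T = reindex e"
  define R where "R = reindex (inv e)"
  have inv: "inv e \<circ> e = id" "e \<circ> inv e = id"
    by (rule inv_o_cancel[OF bij_is_inj[OF e]], rule surj_iff[THEN iffD1, OF bij_is_surj[OF e]])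
  have TR: "T (R y) = y" for y
    by (simp add: T_def R_def reindex_reindex inv reindex_id)
  have RT: "R (T z) = z" for z
    by (simp add: T_def R_def reindex_reindex inv reindex_id)
  have lin: "linear T" "linear R" unfolding T_def R_def by (rule linear_reindex)+
  have cR: "continuous_on UNIV R"
    by (intro linear_continuous_on linear_conv_bounded_linear[THEN iffD1] lin)
  have img: "T ` S = R -` S" for S
  proof
    show "R -` S \<subseteq> T ` S" by (metis TR imageI subsetI vimageE)
  qed (use RT in auto)
  have meas: "measure lborel (T ` S) = measure lborel S" if "compact S" for S
  proof -
    have "measure lborel S = measure (distr lborel borel R) S"
      using e by (simp add: R_def distr_lborel_reindex bij_imp_bij_inv)
    also have "\<dots> = measure lborel (R -` S)"
      using that cR by (subst measure_distr) (auto simp: borel_compact intro: borel_measurable_continuous_onI)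
    finally show ?thesis by (simp add: img)
  qed
  have v: "v x = measure lebesgue (minkowski ((\<lambda>v. x *\<^sub>R v) ` (convex hull (T ` P))) (convex hull (T ` Q)))" for x
  proof -
    have cpt: "compact (minkowski ((\<lambda>v. x *\<^sub>R v) ` (convex hull P)) (convex hull Q))"
      by (intro compact_minkowski compact_scaling finite_imp_compact_convex_hull P Q)
    have "T ` minkowski ((\<lambda>v. x *\<^sub>R v) ` (convex hull P)) (convex hull Q)
        = minkowski ((\<lambda>v. x *\<^sub>R v) ` (convex hull (T ` P))) (convex hull (T ` Q))"
      by (simp add: minkowski_linear_image lin convex_hull_linear_image image_image linear_cmul)
    moreover have "compact (T ` minkowski ((\<lambda>v. x *\<^sub>R v) ` (convex hull P)) (convex hull Q))"
      using lin cpt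
      by (intro compact_continuous_image linear_continuous_on linear_conv_bounded_linear[THEN iffD1])
    ultimately show ?thesis
      unfolding v_def by (simp only: meas[OF cpt, symmetric] measure_lebesgue_compact)
  qed
  have "interior (convex hull (T ` P)) \<noteq> {}"
  proof -
    have "T ` interior (convex hull P) \<subseteq> convex hull (T ` P)"
      unfolding convex_hull_linear_image[OF lin(1), symmetric] by (intro image_mono interior_subset)
    moreover have "open (T ` interior (convex hull P))"
      unfolding img using cR by (intro open_vimage) auto
    ultimately have "T ` interior (convex hull P) \<subseteq> interior (convex hull (T ` P))"
      by (rule interior_maximal)
    then show ?thesis using P(2) by blast
  qed
  then show ?thesis
    unfolding v
    by (intro polytope_sum_volume_interpolation_wellorder[where 'n = "'n index", unfolded card_index] l x)
       (use P Q in auto)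
qed

section \<open>Scaling, translation and monotonicity of volumes\<close>

lemma emeasure_lborel_scaleR_image:
  fixes S :: "'a::euclidean_space set"
  assumes "0 < c" "S \<in> sets borel"
  shows "emeasure lborel ((\<lambda>x. c *\<^sub>R x) ` S) = ennreal (c ^ DIM('a)) * emeasure lborel S"
proof -
  have img: "(\<lambda>x. c *\<^sub>R x) ` S = (\<lambda>x. (1 / c) *\<^sub>R x) -` S"
  proof
    show "(\<lambda>x. (1 / c) *\<^sub>R x) -` S \<subseteq> (\<lambda>x. c *\<^sub>R x) ` S"
      using assms(1) by (auto intro!: image_eqI[of _ _ "(1 / c) *\<^sub>R x" for x])
  qed (use assms(1) in auto)
  have m: "(\<lambda>x. c *\<^sub>R x) ` S \<in> sets borel"
    unfolding img using assms(2) measurable_sets_borel[of "\<lambda>x. (1 / c) *\<^sub>R x" borel S] by simp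
  have "emeasure lborel ((\<lambda>x. c *\<^sub>R x) ` S)
      = emeasure (density (distr lborel borel (\<lambda>x. 0 + c *\<^sub>R x)) (\<lambda>_. \<bar>c\<bar> ^ DIM('a))) ((\<lambda>x. c *\<^sub>R x) ` S)"
    using assms(1) lborel_affine[of c "0::'a"] by simp
  also have "\<dots> = ennreal (c ^ DIM('a)) * emeasure (distr lborel borel (\<lambda>x. 0 + c *\<^sub>R x)) ((\<lambda>x. c *\<^sub>R x) ` S)"
    using m assms(1) by (subst emeasure_density) (auto simp: nn_integral_cmult_indicator)
  also have "emeasure (distr lborel borel (\<lambda>x. 0 + c *\<^sub>R x)) ((\<lambda>x. c *\<^sub>R x) ` S) = emeasure lborel S"
    using m assms(1) by (subst emeasure_distr) (auto simp: inj_vimage_image_eq inj_on_def)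
  finally show ?thesis .
qed

lemma measure_lborel_scaleR_image:
  fixes S :: "'a::euclidean_space set"
  assumes "0 < c" "S \<in> sets borel"
  shows "measure lborel ((\<lambda>x. c *\<^sub>R x) ` S) = c ^ DIM('a) * measure lborel S"
  unfolding measure_def emeasure_lborel_scaleR_image[OF assms] using assms(1)
  by (simp add: enn2real_mult)

lemma emeasure_lborel_translation:
  fixes S :: "'a::euclidean_space set"
  assumes "S \<in> sets borel"
  shows "emeasure lborel ((\<lambda>x. a + x) ` S) = emeasure lborel S"
proof -
  have img: "(\<lambda>x. a + x) ` S = (\<lambda>x. - a + x) -` S" by (auto simp: image_iff algebra_simps intro!: bexI[of _ "- a + x" for x])
  have "emeasure lborel S = emeasure (distr lborel borel (\<lambda>x. - a + x)) S"
    by (subst lborel_distr_plus) (rule refl)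
  also have "\<dots> = emeasure lborel ((\<lambda>x. a + x) ` S)"
    unfolding img using assms by (subst emeasure_distr) auto
  finally show ?thesis by simp
qed

lemma measure_lborel_translation:
  fixes S :: "'a::euclidean_space set"
  shows "S \<in> sets borel \<Longrightarrow> measure lborel ((\<lambda>x. a + x) ` S) = measure lborel S"
  by (simp add: measure_def emeasure_lborel_translation)

lemma emeasure_lborel_compact_finite:
  fixes S :: "'a::euclidean_space set"
  shows "compact S \<Longrightarrow> emeasure lborel S < \<infinity>"
  by (metis compact_imp_bounded emeasure_bounded_finite)

lemma measure_lborel_mono_compact:
  fixes S T :: "'a::euclidean_space set"
  assumes "S \<subseteq> T" "compact S" "compact T"
  shows "measure lborel S \<le> measure lborel T"
  using assms emeasure_lborel_compact_finite[of T]
  by (intro measure_mono_fmeasurable) (auto simp: fmeasurable_def borel_compact)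

lemma minkowski_mono: "A \<subseteq> A' \<Longrightarrow> C \<subseteq> C' \<Longrightarrow> minkowski A C \<subseteq> minkowski A' C'"
  unfolding minkowski_def by blast

lemma minkowski_commute: "minkowski A C = minkowski C A"
  unfolding minkowski_def by (auto; use add.commute in blast)

lemma scaleR_minkowski:
  fixes A C :: "'a::euclidean_space set"
  shows "(\<lambda>v. c *\<^sub>R v) ` minkowski A C = minkowski ((\<lambda>v. c *\<^sub>R v) ` A) ((\<lambda>v. c *\<^sub>R v) ` C)"
  by (rule minkowski_linear_image) (simp add: linear_scaleR)

lemma convex_scaled_subset:
  fixes A :: "'a::euclidean_space set"
  assumes "convex A" "0 \<in> A" "0 \<le> c" "c \<le> 1"
  shows "(\<lambda>v. c *\<^sub>R v) ` A \<subseteq> A"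
  using assms convexD[OF assms(1), of _ 0 c "1 - c"] by auto

section \<open>From polytopes to convex bodies\<close>

text \<open>Each interior point of \<open>A\<close> lies in the open box of a cell contained in
  \<open>A\<close>. Finitely many such boxes cover the compact set \<open>c A\<close>, and the
  collected vertices span the polytope.\<close>

lemma inner_polytope:
  fixes A :: "'a::euclidean_space set"
  assumes A: "compact A" "convex A" "0 \<in> interior A" and c: "0 \<le> c" "c < 1"
  obtains P where "finite P" "P \<subseteq> A" "(\<lambda>v. c *\<^sub>R v) ` A \<subseteq> interior (convex hull P)"
proof -
  have loc: "\<exists>F. finite F \<and> F \<subseteq> A \<and> y \<in> interior (convex hull F)" if y: "y \<in> interior A" for y
  proof -
    obtain a b where ab: "cbox a b \<subseteq> interior A" "y \<in> box a b"
      by (rule open_contains_cbox[OF open_interior y])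
    obtain F where F: "finite F" "cbox a b = convex hull F"
      using polytope_interval[of a b] by (auto simp: polytope_def)
    have "F \<subseteq> A" using ab(1) F(2) hull_subset[of F convex] interior_subset by blast
    moreover have "y \<in> interior (convex hull F)" using ab(2) by (simp add: F(2)[symmetric])
    ultimately show ?thesis using F(1) by blast
  qed
  have sub: "(\<lambda>v. c *\<^sub>R v) ` A \<subseteq> interior A"
  proof (safe)
    fix v assume "v \<in> A"
    from mem_interior_convex_shrink[OF A(2,3) this, of "1 - c"] c
    show "c *\<^sub>R v \<in> interior A" by (simp add: algebra_simps)
  qed
  obtain F where F: "\<And>y. y \<in> interior A \<Longrightarrow> finite (F y) \<and> F y \<subseteq> A \<and> y \<in> interior (convex hull (F y))"
    using loc by metis
  have "compact ((\<lambda>v. c *\<^sub>R v) ` A)" using A(1) by (rule compact_scaling)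
  then obtain D where D: "D \<subseteq> interior A" "finite D" "(\<lambda>v. c *\<^sub>R v) ` A \<subseteq> (\<Union>y\<in>D. interior (convex hull (F y)))"
    using sub F by (elim compactE_image[of _ "interior A" "\<lambda>y. interior (convex hull (F y))"]) blast+
  show thesis
  proof
    show "finite (\<Union>(F ` D))" using D F by blast
    show "\<Union>(F ` D) \<subseteq> A" using D F by blast
    have "interior (convex hull (F y)) \<subseteq> interior (convex hull (\<Union>(F ` D)))" if "y \<in> D" for y
      using that by (intro interior_mono hull_mono) auto
    then show "(\<lambda>v. c *\<^sub>R v) ` A \<subseteq> interior (convex hull (\<Union>(F ` D)))" using D(3) by blast
  qed
qed

text \<open>With polytopes between \<open>c A\<close> and \<open>A\<close> and between
  \<open>c C\<close> and \<open>C\<close>, every volume involved changes by a factor between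
  \<open>c ^ CARD('n)\<close> and 1. The identity therefore holds for the bodies up to an error
  \<open>(1 - c ^ CARD('n)) * K\<close> with \<open>K\<close> independent of \<open>c\<close>, and
  \<open>c\<close> tends to 1.\<close>

lemma sum_volume_interpolation:
  fixes A C :: "(real^'n) set"
  assumes A: "compact A" "convex A" "0 \<in> interior A" and C: "compact C" "convex C" "0 \<in> interior C"
    and x: "0 < x"
    and l: "\<And>p x. degree p \<le> CARD('n) \<Longrightarrow> poly p x = (\<Sum>i\<le>CARD('n). poly p (real (Suc i)) * poly (l i) x)"
  defines "W \<equiv> \<lambda>x. measure lborel (minkowski ((\<lambda>v. x *\<^sub>R v) ` A) C)"
  shows "W x = (\<Sum>i\<le>CARD('n). W (real (Suc i)) * poly (l i) x)"
proof -
  define S where "S = (\<Sum>i\<le>CARD('n). W (real (Suc i)) * poly (l i) x)"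
  define K where "K = W x + (\<Sum>i\<le>CARD('n). W (real (Suc i)) * \<bar>poly (l i) x\<bar>)"
  have est: "\<bar>W x - S\<bar> \<le> (1 - c ^ CARD('n)) * K" if c: "0 < c" "c < 1" for c
  proof -
    obtain P where P: "finite P" "P \<subseteq> A" "(\<lambda>v. c *\<^sub>R v) ` A \<subseteq> interior (convex hull P)"
      using inner_polytope[OF A, of c] c by auto
    obtain Q where Q: "finite Q" "Q \<subseteq> C" "(\<lambda>v. c *\<^sub>R v) ` C \<subseteq> interior (convex hull Q)"
      using inner_polytope[OF C, of c] c by auto
    have ne: "interior (convex hull P) \<noteq> {}" "Q \<noteq> {}"
      using P(3) Q(3) A(3) C(3) interior_subset[of A] interior_subset[of C] by auto
    define v where "v = (\<lambda>x. measure lborel (minkowski ((\<lambda>v. x *\<^sub>R v) ` (convex hull P)) (convex hull Q)))"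
    have hull: "convex hull P \<subseteq> A" "convex hull Q \<subseteq> C"
      by (intro hull_minimal P Q A C)+
    have cpt: "compact (convex hull P)" "compact (convex hull Q)"
      using P Q by (auto intro: finite_imp_compact_convex_hull)
    have up: "v y \<le> W y" for y
      unfolding v_def W_def
      by (intro measure_lborel_mono_compact minkowski_mono image_mono hull compact_minkowski compact_scaling cpt A C)
    have low: "c ^ CARD('n) * W y \<le> v y" for y
    proof -
      have "c ^ CARD('n) * W y = measure lborel ((\<lambda>v. c *\<^sub>R v) ` minkowski ((\<lambda>v. y *\<^sub>R v) ` A) C)"
        unfolding W_def using c
        by (subst measure_lborel_scaleR_image) (auto intro!: borel_compact compact_minkowski compact_scaling A C)
      also have "\<dots> \<le> v y"
        unfolding v_def
      proof (intro measure_lborel_mono_compact compact_scaling compact_minkowski cpt A C)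
        have "(\<lambda>v. c *\<^sub>R v) ` (\<lambda>v. y *\<^sub>R v) ` A = (\<lambda>v. y *\<^sub>R v) ` (\<lambda>v. c *\<^sub>R v) ` A"
          by (simp add: image_image mult.commute)
        then show "(\<lambda>v. c *\<^sub>R v) ` minkowski ((\<lambda>v. y *\<^sub>R v) ` A) C
            \<subseteq> minkowski ((\<lambda>v. y *\<^sub>R v) ` (convex hull P)) (convex hull Q)"
          unfolding scaleR_minkowski using P(3) Q(3) interior_subset
          by (metis (no_types, lifting) image_mono minkowski_mono subset_trans)
      qed
      finally show ?thesis .
    qed
    have dist: "\<bar>W y - v y\<bar> \<le> (1 - c ^ CARD('n)) * W y" for y
      using up[of y] low[of y] by (simp add: algebra_simps)
    have vx: "v x = (\<Sum>i\<le>CARD('n). v (real (Suc i)) * poly (l i) x)"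
      unfolding v_def by (rule polytope_sum_volume_interpolation[OF P(1) ne(1) Q(1) ne(2) x l])
    have "\<bar>W x - S\<bar> = \<bar>(W x - v x) - (\<Sum>i\<le>CARD('n). (W (real (Suc i)) - v (real (Suc i))) * poly (l i) x)\<bar>"
      unfolding S_def by (simp add: vx left_diff_distrib sum_subtractf del: of_nat_Suc)
    also have "\<dots> \<le> \<bar>W x - v x\<bar> + (\<Sum>i\<le>CARD('n). \<bar>W (real (Suc i)) - v (real (Suc i))\<bar> * \<bar>poly (l i) x\<bar>)"
      by (rule order_trans[OF abs_triangle_ineq4 add_left_mono], rule order_trans[OF sum_abs])
         (simp only: abs_mult order_refl)
    also have "\<dots> \<le> (1 - c ^ CARD('n)) * W x + (\<Sum>i\<le>CARD('n). ((1 - c ^ CARD('n)) * W (real (Suc i))) * \<bar>poly (l i) x\<bar>)"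
      by (intro add_mono sum_mono mult_right_mono dist abs_ge_zero)
    also have "\<dots> = (1 - c ^ CARD('n)) * K"
      unfolding K_def distrib_left sum_distrib_left by (simp only: mult.assoc)
    finally show ?thesis .
  qed
  have lim: "((\<lambda>c. (1 - c ^ CARD('n)) * K) \<longlongrightarrow> (1 - 1 ^ CARD('n)) * K) (at_left 1)"
    by (intro tendsto_intros)
  have "\<bar>W x - S\<bar> \<le> (1 - 1 ^ CARD('n)) * K"
    by (rule tendsto_lowerbound[OF lim])
       (use est in \<open>auto simp: eventually_at_left[of 0 1] intro!: exI[of _ 0]\<close>)
  then show ?thesis by (simp add: S_def)
qed

text \<open>As \<open>C\<close> contains a ball, \<open>A\<close> lies in some multiple
  \<open>M C\<close>; convexity then puts \<open>x A + C\<close> between \<open>C\<close> and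
  \<open>(1 + x * M) C\<close>.\<close>

lemma sum_volume_continuous_at_0:
  fixes A C :: "'a::euclidean_space set"
  assumes A: "compact A" "0 \<in> A" and C: "compact C" "convex C" "0 \<in> interior C"
  shows "((\<lambda>x. measure lborel (minkowski ((\<lambda>v. x *\<^sub>R v) ` A) C)) \<longlongrightarrow> measure lborel C) (at_right 0)"
proof -
  obtain r where r: "0 < r" "ball 0 r \<subseteq> C" using C(3) by (auto simp: mem_interior)
  obtain b where b: "0 < b" "\<And>a. a \<in> A \<Longrightarrow> norm a \<le> b"
    using compact_imp_bounded[OF A(1)] by (auto simp: bounded_pos)
  \<comment> \<open>The factor 2 brings the norm of \<open>(1 / M) *\<^sub>R a\<close> down to
    \<open>r / 2\<close>, safely inside the open ball.\<close>
  define M where "M = 2 * b / r"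
  have M: "0 < M" using r b by (simp add: M_def)
  have AC: "A \<subseteq> (\<lambda>v. M *\<^sub>R v) ` C"
  proof
    fix a assume "a \<in> A"
    have "norm ((1 / M) *\<^sub>R a) < r"
      using b(2)[OF \<open>a \<in> A\<close>] b(1) r(1) by (simp add: M_def field_simps)
    then have "(1 / M) *\<^sub>R a \<in> C" using r by auto
    then show "a \<in> (\<lambda>v. M *\<^sub>R v) ` C" using M by (intro image_eqI[of _ _ "(1 / M) *\<^sub>R a"]) auto
  qed
  have 0: "0 \<in> C" using C(3) interior_subset by blast
  have cpt: "compact (minkowski ((\<lambda>v. x *\<^sub>R v) ` A) C)" for x
    by (intro compact_minkowski compact_scaling A C)
  have low: "measure lborel C \<le> measure lborel (minkowski ((\<lambda>v. x *\<^sub>R v) ` A) C)" for x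
    by (rule measure_lborel_mono_compact[OF _ C(1) cpt]) (use A(2) in \<open>force simp: minkowski_def\<close>)
  have up: "measure lborel (minkowski ((\<lambda>v. x *\<^sub>R v) ` A) C) \<le> (1 + x * M) ^ DIM('a) * measure lborel C" if "0 < x" for x
  proof -
    have "minkowski ((\<lambda>v. x *\<^sub>R v) ` A) C \<subseteq> (\<lambda>v. (1 + x * M) *\<^sub>R v) ` C"
    proof
      fix z assume "z \<in> minkowski ((\<lambda>v. x *\<^sub>R v) ` A) C"
      then obtain a c where ac: "a \<in> A" "c \<in> C" "z = x *\<^sub>R a + c" by (auto simp: minkowski_def)
      obtain c' where c': "c' \<in> C" "a = M *\<^sub>R c'" using AC ac(1) by auto
      define s where "s = 1 + x * M"
      have s: "0 < s" using M that by (simp add: s_def add_pos_pos)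
      have "(x * M / s) *\<^sub>R c' + (1 / s) *\<^sub>R c \<in> C"
        using c'(1) ac(2) s M that by (intro convexD[OF C(2)]) (auto simp: s_def add_divide_distrib[symmetric] add.commute)
      moreover have "z = s *\<^sub>R ((x * M / s) *\<^sub>R c' + (1 / s) *\<^sub>R c)"
        using s by (simp add: ac(3) c'(2) scaleR_add_right)
      ultimately show "z \<in> (\<lambda>v. (1 + x * M) *\<^sub>R v) ` C" unfolding s_def by blast
    qed
    then have "measure lborel (minkowski ((\<lambda>v. x *\<^sub>R v) ` A) C) \<le> measure lborel ((\<lambda>v. (1 + x * M) *\<^sub>R v) ` C)"
      by (rule measure_lborel_mono_compact[OF _ cpt compact_scaling[OF C(1)]])
    then show ?thesis using that M C(1) by (simp add: measure_lborel_scaleR_image borel_compact add_pos_pos)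
  qed
  have "((\<lambda>x. (1 + x * M) ^ DIM('a) * measure lborel C) \<longlongrightarrow> (1 + 0 * M) ^ DIM('a) * measure lborel C) (at_right 0)"
    by (intro tendsto_intros)
  then have lim: "((\<lambda>x. (1 + x * M) ^ DIM('a) * measure lborel C) \<longlongrightarrow> measure lborel C) (at_right 0)" by simp
  show ?thesis
    by (rule tendsto_sandwich[OF _ _ tendsto_const lim])
       (use low up in \<open>auto simp: eventually_at_filter\<close>)
qed

text \<open>The interpolating polynomial is right for \<open>x > 0\<close>; at \<open>x = 0\<close>
  both sides are limits from the right and agree by continuity.\<close>

lemma sum_volume_polynomial:
  fixes A C :: "(real^'n) set"
  assumes A: "compact A" "convex A" "0 \<in> interior A" and C: "compact C" "convex C" "0 \<in> interior C"
  obtains p where "degree p \<le> CARD('n)"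
    "\<And>x. 0 \<le> x \<Longrightarrow> measure lborel (minkowski ((\<lambda>v. x *\<^sub>R v) ` A) C) = poly p x"
proof -
  let ?W = "\<lambda>x. measure lborel (minkowski ((\<lambda>v. x *\<^sub>R v) ` A) C)"
  obtain l :: "nat \<Rightarrow> real poly" where l: "\<And>i. i \<le> CARD('n) \<Longrightarrow> degree (l i) \<le> CARD('n)"
    "\<And>p x. degree p \<le> CARD('n) \<Longrightarrow> poly p x = (\<Sum>i\<le>CARD('n). poly p (real (Suc i)) * poly (l i) x)"
    using lagrange_basis_nat_nodes[of "CARD('n)"] by metis
  define p where "p = (\<Sum>i\<le>CARD('n). Polynomial.smult (?W (real (Suc i))) (l i))"
  have pos: "?W x = poly p x" if "0 < x" for x
    using sum_volume_interpolation[OF A C that l(2)] by (simp add: p_def poly_sum)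
  have 0: "0 \<in> A" "A \<noteq> {}" using A(3) interior_subset by blast+
  have "(poly p \<longlongrightarrow> poly p 0) (at_right 0)" by (intro tendsto_intros)
  moreover have "(?W \<longlongrightarrow> measure lborel C) (at_right 0)"
    by (rule sum_volume_continuous_at_0[OF A(1) 0(1) C])
  moreover have "eventually (\<lambda>x. ?W x = poly p x) (at_right 0)"
    using pos by (auto simp: eventually_at_filter)
  ultimately have "poly p 0 = measure lborel C"
    using tendsto_cong[of ?W "poly p" "at_right 0" "measure lborel C"]
    by (intro tendsto_unique[OF trivial_limit_at_right_real]) auto
  moreover have "minkowski ((\<lambda>v. 0 *\<^sub>R v) ` A) C = C"
  proof -
    have "(\<lambda>v. 0 *\<^sub>R v) ` A = {0}" using 0 by auto
    then show ?thesis by (simp add: minkowski_def)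
  qed
  ultimately have "?W x = poly p x" if "0 \<le> x" for x using pos that by (cases "x = 0") auto
  moreover have "degree p \<le> CARD('n)"
    unfolding p_def by (intro degree_sum_le order_trans[OF degree_smult_le]) (auto intro: l)
  ultimately show thesis using that by blast
qed

section \<open>Mixed volumes by finite differences\<close>

text \<open>The \<open>N\<close>-th finite difference of \<open>x ^ i\<close> at 0: it kills lower
  powers and sends \<open>x ^ N\<close> to \<open>fact N\<close>. The polarization formula picks out
  a single coefficient of the volume polynomial by means of this. In the induction the factor
  \<open>Suc m\<close> is absorbed into the binomial coefficient, which lowers the exponent by
  one.\<close>

lemma alternating_binomial_power_sum:
  fixes N i :: nat
  assumes "i \<le> N"
  shows "(\<Sum>m\<le>N. real (N choose m) * (-1) ^ (N - m) * real m ^ i) = (if i = N then fact N else 0)"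
  using assms
proof (induction N arbitrary: i)
  case (Suc N)
  show ?case
  proof (cases i)
    case 0
    have "(\<Sum>m\<le>Suc N. real (Suc N choose m) * (-1) ^ (Suc N - m) * 1 ^ m) = ((1::real) + (-1)) ^ Suc N"
      unfolding binomial_ring by (intro sum.cong) auto
    then show ?thesis using 0 by simp
  next
    case (Suc k)
    then have k: "k \<le> N" using Suc.prems by simp
    have "(\<Sum>m\<le>Suc N. real (Suc N choose m) * (-1) ^ (Suc N - m) * real m ^ i)
        = (\<Sum>m\<le>N. real (Suc N choose Suc m) * (-1) ^ (N - m) * real (Suc m) ^ i)"
      unfolding sum.atMost_Suc_shift using Suc by simp
    also have "\<dots> = (\<Sum>m\<le>N. real (Suc N) * (real (N choose m) * (-1) ^ (N - m) * real (Suc m) ^ k))"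
    proof (intro sum.cong refl)
      fix m
      have "real (Suc m) * real (Suc N choose Suc m) = real (Suc N) * real (N choose m)"
        using Suc_times_binomial_eq[of N m] by (metis mult.commute of_nat_mult)
      then show "real (Suc N choose Suc m) * (-1) ^ (N - m) * real (Suc m) ^ i
          = real (Suc N) * (real (N choose m) * (-1) ^ (N - m) * real (Suc m) ^ k)"
        unfolding Suc power_Suc by (simp only: mult.assoc mult.left_commute[of _ "real (Suc m)"]) (metis mult.assoc mult.commute)
    qed
    also have "\<dots> = real (Suc N) * (\<Sum>m\<le>N. \<Sum>j\<le>k. real (k choose j) * (real (N choose m) * (-1) ^ (N - m) * real m ^ j))"
    proof -
      have "real (Suc m) ^ k = (\<Sum>j\<le>k. real (k choose j) * real m ^ j)" for m
        using binomial_ring[of "real m" 1 k] by (simp add: add.commute)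
      then show ?thesis by (simp only: sum_distrib_left mult_ac)
    qed
    also have "\<dots> = real (Suc N) * (\<Sum>j\<le>k. real (k choose j) * (if j = N then fact N else 0))"
      by (subst sum.swap) (use Suc.IH k in \<open>simp add: sum_distrib_left[symmetric]\<close>)
    also have "\<dots> = (if k = N then fact (Suc N) else 0)"
    proof (cases "k = N")
      case True
      then show ?thesis by (simp add: if_distrib[where f="\<lambda>x. _ * x"] cong: if_cong)
    next
      case False
      then have "(\<Sum>j\<le>k. real (k choose j) * (if j = N then fact N else 0)) = 0"
        using k by (intro sum.neutral) auto
      then show ?thesis using False by simp
    qed
    finally show ?thesis using Suc by simp
  qed
qed simp

lemma sum_Pow_card:
  fixes g :: "nat \<Rightarrow> real"
  assumes "finite A"
  shows "(\<Sum>J\<in>Pow A. g (card J)) = (\<Sum>m\<le>card A. real (card A choose m) * g m)"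
proof -
  have "(\<Sum>J\<in>Pow A. g (card J)) = (\<Sum>m\<in>{..card A}. \<Sum>J\<in>{J \<in> Pow A. card J = m}. g (card J))"
    using assms by (intro sum.group[symmetric]) (auto intro: card_mono)
  also have "\<dots> = (\<Sum>m\<le>card A. real (card A choose m) * g m)"
  proof (intro sum.cong refl)
    fix m
    have "(\<Sum>J\<in>{J \<in> Pow A. card J = m}. g (card J)) = real (card {J. J \<subseteq> A \<and> card J = m}) * g m"
      by (simp add: Pow_def)
    then show "(\<Sum>J\<in>{J \<in> Pow A. card J = m}. g (card J)) = real (card A choose m) * g m"
      by (simp add: n_subsets[OF assms])
  qed
  finally show ?thesis .
qed

lemma scaleR_convex_add:
  fixes B :: "'a::euclidean_space set"
  assumes "convex B" "0 \<le> a" "0 \<le> b"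
  shows "minkowski ((\<lambda>v. a *\<^sub>R v) ` B) ((\<lambda>v. b *\<^sub>R v) ` B) \<subseteq> (\<lambda>v. (a + b) *\<^sub>R v) ` B"
proof
  fix z assume "z \<in> minkowski ((\<lambda>v. a *\<^sub>R v) ` B) ((\<lambda>v. b *\<^sub>R v) ` B)"
  then obtain x y where xy: "x \<in> B" "y \<in> B" "z = a *\<^sub>R x + b *\<^sub>R y" by (auto simp: minkowski_def)
  show "z \<in> (\<lambda>v. (a + b) *\<^sub>R v) ` B"
  proof (cases "a + b = 0")
    case True
    then have "a = 0" "b = 0" using assms by auto
    then show ?thesis using xy by force
  next
    case False
    then have "(a / (a + b)) *\<^sub>R x + (b / (a + b)) *\<^sub>R y \<in> B"
      using assms xy by (intro convexD[OF assms(1)]) (auto simp: add_divide_distrib[symmetric])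
    then show ?thesis using False
      by (intro image_eqI[of _ _ "(a / (a + b)) *\<^sub>R x + (b / (a + b)) *\<^sub>R y"]) (auto simp: xy scaleR_add_right)
  qed
qed

lemma msum_replicate_append:
  fixes B :: "'a::euclidean_space set"
  assumes "convex B" "B \<noteq> {}"
  shows "msum (replicate m B @ Ks) = minkowski ((\<lambda>v. real m *\<^sub>R v) ` B) (msum Ks)"
proof (induction m)
  case 0
  have "(\<lambda>v. real 0 *\<^sub>R v) ` B = {0}" using assms(2) by auto
  then show ?case by (simp add: minkowski_def)
next
  case (Suc m)
  have "minkowski B ((\<lambda>v. real m *\<^sub>R v) ` B) = (\<lambda>v. real (Suc m) *\<^sub>R v) ` B"
  proof
    show "minkowski B ((\<lambda>v. real m *\<^sub>R v) ` B) \<subseteq> (\<lambda>v. real (Suc m) *\<^sub>R v) ` B"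
      using scaleR_convex_add[OF assms(1), of 1 "real m"] by simp
    show "(\<lambda>v. real (Suc m) *\<^sub>R v) ` B \<subseteq> minkowski B ((\<lambda>v. real m *\<^sub>R v) ` B)"
      by (auto simp: minkowski_def scaleR_add_left)
  qed
  moreover have "minkowski B (minkowski C D) = minkowski (minkowski B C) D" for C D :: "'a set"
    unfolding minkowski_def by (auto; metis add.assoc)
  ultimately show ?case using Suc by simp
qed

text \<open>The polarization sum depends on an index set \<open>J\<close> only through its number
  \<open>m\<close> of copies of \<open>B\<close> and whether it contains the index of
  \<open>K\<close>; the two sets that share the same copies carry opposite signs. The empty set is
  excluded from the polarization, which explains the exception at \<open>m = 0\<close>.\<close>

lemma mixed_volume_replicate:
  fixes B K :: "'a::euclidean_space set"
  assumes "convex B" "B \<noteq> {}"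
  shows "mixed_volume (replicate N B @ [K]) = (1 / fact (Suc N)) *
     (\<Sum>m\<le>N. real (N choose m) * (-1) ^ (N - m) *
        (measure lborel (minkowski ((\<lambda>v. real m *\<^sub>R v) ` B) K)
          - (if m = 0 then 0 else measure lborel ((\<lambda>v. real m *\<^sub>R v) ` B))))"
proof -
  let ?Ks = "replicate N B @ [K]"
  define v where "v = (\<lambda>J. measure lborel (msum (map (\<lambda>j. ?Ks ! j) (sorted_list_of_set J))))"
  define F where "F = (\<lambda>J. (-1) ^ (Suc N - card J) * v J)"
  have min0: "minkowski A {0} = A" for A :: "'a set" by (auto simp: minkowski_def)
  have map: "map (\<lambda>j. ?Ks ! j) (sorted_list_of_set J) = replicate (card J) B" if "J \<subseteq> {..<N}" for J
  proof -
    have "map (\<lambda>j. ?Ks ! j) (sorted_list_of_set J) = map (\<lambda>_. B) (sorted_list_of_set J)"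
      using that finite_subset[OF that] by (intro map_cong) (auto simp: nth_append subset_iff)
    then show ?thesis by (simp add: map_replicate_const)
  qed
  have v1: "v J = measure lborel ((\<lambda>v. real (card J) *\<^sub>R v) ` B)" if "J \<subseteq> {..<N}" for J
    unfolding v_def map[OF that] using msum_replicate_append[OF assms, of "card J" "[]"] by (simp add: min0)
  have v2: "v (insert N J) = measure lborel (minkowski ((\<lambda>v. real (card J) *\<^sub>R v) ` B) K)" if J: "J \<subseteq> {..<N}" for J
  proof -
    have fin: "finite J" using J finite_subset by blast
    have "sorted_list_of_set (set (sorted_list_of_set J @ [N])) = sorted_list_of_set J @ [N]"
      using J fin by (intro sorted_list_of_set.idem_if_sorted_distinct) (auto simp: sorted_append subset_iff less_imp_le)
    then have "sorted_list_of_set (insert N J) = sorted_list_of_set J @ [N]" using fin by simp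
    then have "map (\<lambda>j. ?Ks ! j) (sorted_list_of_set (insert N J)) = replicate (card J) B @ [K]"
      using map[OF J] by (simp add: nth_append)
    then show ?thesis unfolding v_def
      by (simp only: msum_replicate_append[OF assms] msum.simps min0)
  qed
  have disj: "Pow {..<N} \<inter> insert N ` Pow {..<N} = {}" by auto
  have inj: "inj_on (insert N) (Pow {..<N})"
  proof (rule inj_onI)
    fix I J assume "I \<in> Pow {..<N}" "J \<in> Pow {..<N}" "insert N I = insert N J"
    moreover from this have "N \<notin> I" "N \<notin> J" by auto
    ultimately show "I = J" by (metis insert_ident)
  qed
  have "sum F (Pow {..<Suc N} - {{}}) = sum F (Pow {..<Suc N}) - F {}"
    by (subst sum_diff1) auto
  also have "sum F (Pow {..<Suc N}) = sum F (Pow {..<N}) + (\<Sum>J\<in>Pow {..<N}. F (insert N J))"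
    unfolding lessThan_Suc Pow_insert by (subst sum.union_disjoint) (auto simp: disj sum.reindex[OF inj])
  also have "sum F (Pow {..<N}) = (\<Sum>J\<in>Pow {..<N}. (-1) ^ (Suc N - card J) * measure lborel ((\<lambda>v. real (card J) *\<^sub>R v) ` B))"
    by (intro sum.cong) (auto simp: F_def v1)
  also have "\<dots> = (\<Sum>m\<le>N. real (N choose m) * ((-1) ^ (Suc N - m) * measure lborel ((\<lambda>v. real m *\<^sub>R v) ` B)))"
    by (subst sum_Pow_card) auto
  also have "(\<Sum>J\<in>Pow {..<N}. F (insert N J)) = (\<Sum>J\<in>Pow {..<N}. (-1) ^ (N - card J) * measure lborel (minkowski ((\<lambda>v. real (card J) *\<^sub>R v) ` B) K))"
  proof (intro sum.cong refl)
    fix J assume J: "J \<in> Pow {..<N}"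
    then have "finite J" "N \<notin> J" by (auto intro: finite_subset)
    then show "F (insert N J) = (-1) ^ (N - card J) * measure lborel (minkowski ((\<lambda>v. real (card J) *\<^sub>R v) ` B) K)"
      using J by (simp add: F_def v2)
  qed
  also have "\<dots> = (\<Sum>m\<le>N. real (N choose m) * ((-1) ^ (N - m) * measure lborel (minkowski ((\<lambda>v. real m *\<^sub>R v) ` B) K)))"
    by (subst sum_Pow_card) auto
  also have "F {} = (\<Sum>m\<le>N. real (N choose m) * ((-1) ^ (Suc N - m) * (if m = 0 then measure lborel ((\<lambda>v. real m *\<^sub>R v) ` B) else 0)))"
  proof -
    have "(\<Sum>m\<le>N. real (N choose m) * ((-1) ^ (Suc N - m) * (if m = 0 then measure lborel ((\<lambda>v. real m *\<^sub>R v) ` B) else 0)))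
       = (\<Sum>m\<le>N. if m = 0 then (-1) ^ Suc N * measure lborel ((\<lambda>v. real 0 *\<^sub>R v) ` B) else 0)"
      by (intro sum.cong) auto
    then show ?thesis using v1[of "{}"] by (simp add: F_def)
  qed
  finally have "sum F (Pow {..<Suc N} - {{}}) = (\<Sum>m\<le>N. real (N choose m) * (-1) ^ (N - m) *
        (measure lborel (minkowski ((\<lambda>v. real m *\<^sub>R v) ` B) K)
          - (if m = 0 then 0 else measure lborel ((\<lambda>v. real m *\<^sub>R v) ` B))))"
    unfolding sum.distrib[symmetric] sum_subtractf[symmetric]
    by (simp only:, intro sum.cong refl) (auto simp: Suc_diff_le algebra_simps)
  then show ?thesis unfolding mixed_volume_def F_def v_def by (simp add: Let_def)
qed

text \<open>If \<open>p\<close> is the polynomial giving the volume of \<open>x A + K\<close>, then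
  \<open>A + e K\<close> has volume \<open>e ^ Suc N * poly p (1 / e)\<close>: the coefficients
  appear in reverse order, and the derivative at 0 is the last but one, \<open>c N\<close>. The
  finite difference in the mixed volume extracts the same coefficient, as
  \<open>fact N / fact (Suc N)\<close> times \<open>c N\<close>, and the factor
  \<open>CARD('n)\<close> repairs the quotient.\<close>

lemma minkowski_derivative_at_0:
  fixes A K :: "(real^'n) set"
  assumes A: "compact A" "convex A" "0 \<in> interior A" and K: "compact K" "convex K" "0 \<in> interior K"
  shows "((\<lambda>e. (measure lborel (minkowski A ((\<lambda>v. e *\<^sub>R v) ` K)) - measure lborel A) / e)
           \<longlongrightarrow> real CARD('n) * mixed_volume (replicate (CARD('n) - 1) A @ [K])) (at_right 0)"
proof -
  obtain N where N: "CARD('n) = Suc N" using zero_less_card_finite[where 'a='n] gr0_implies_Suc by blast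
  obtain p where p: "degree p \<le> CARD('n)"
    "\<And>x. 0 \<le> x \<Longrightarrow> measure lborel (minkowski ((\<lambda>v. x *\<^sub>R v) ` A) K) = poly p x"
    using sum_volume_polynomial[OF A K] by metis
  define c where "c = Polynomial.coeff p"
  have px: "poly p x = (\<Sum>i\<le>Suc N. c i * x ^ i)" for x
    unfolding c_def poly_altdef using p(1) N
    by (intro sum.mono_neutral_left) (auto simp: coeff_eq_0 not_le)
  have ne: "0 \<in> K" "A \<noteq> {}" "0 \<in> A" using A(3) K(3) interior_subset by blast+
  have V: "measure lborel (minkowski A ((\<lambda>v. e *\<^sub>R v) ` K)) = (\<Sum>i\<le>Suc N. c i * e ^ (Suc N - i))" if e: "0 < e" for e
  proof -
    have "(\<lambda>v. e *\<^sub>R v) ` (\<lambda>v. (1 / e) *\<^sub>R v) ` A = A" using e by (simp add: image_image)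
    then have "measure lborel (minkowski A ((\<lambda>v. e *\<^sub>R v) ` K))
        = measure lborel ((\<lambda>v. e *\<^sub>R v) ` minkowski ((\<lambda>v. (1 / e) *\<^sub>R v) ` A) K)"
      by (simp only: scaleR_minkowski)
    also have "\<dots> = e ^ Suc N * poly p (1 / e)"
      using e by (subst measure_lborel_scaleR_image)
        (auto intro!: borel_compact compact_minkowski compact_scaling A K simp: p(2) N)
    also have "\<dots> = (\<Sum>i\<le>Suc N. c i * e ^ (Suc N - i))"
      unfolding px sum_distrib_left
      by (intro sum.cong) (use e in \<open>auto simp: power_diff field_simps\<close>)
    finally show ?thesis .
  qed
  have "((\<lambda>e. \<Sum>i\<le>Suc N. c i * e ^ (Suc N - i)) \<longlongrightarrow> (\<Sum>i\<le>Suc N. c i * 0 ^ (Suc N - i))) (at_right 0)"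
    by (intro tendsto_intros)
  moreover have "(\<Sum>i\<le>Suc N. c i * 0 ^ (Suc N - i)) = c (Suc N)"
    by (subst sum.atMost_Suc) (simp, intro sum.neutral, simp)
  ultimately have lim1: "((\<lambda>e. \<Sum>i\<le>Suc N. c i * e ^ (Suc N - i)) \<longlongrightarrow> c (Suc N)) (at_right 0)" by simp
  have "((\<lambda>e. measure lborel (minkowski ((\<lambda>v. e *\<^sub>R v) ` K) A)) \<longlongrightarrow> measure lborel A) (at_right 0)"
    by (rule sum_volume_continuous_at_0[OF K(1) ne(1) A])
  moreover have "eventually (\<lambda>e. measure lborel (minkowski ((\<lambda>v. e *\<^sub>R v) ` K) A) = (\<Sum>i\<le>Suc N. c i * e ^ (Suc N - i))) (at_right 0)"
    using V by (auto simp: eventually_at_filter minkowski_commute)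
  ultimately have "((\<lambda>e. \<Sum>i\<le>Suc N. c i * e ^ (Suc N - i)) \<longlongrightarrow> measure lborel A) (at_right 0)"
    by (rule Lim_transform_eventually)
  \<comment> \<open>The same function of \<open>e\<close> has two expressions for its limit, by the
    polynomial and by continuity of the volume; this identifies the top coefficient of
    \<open>p\<close>.\<close>
  then have VA: "measure lborel A = c (Suc N)"
    using tendsto_unique[OF trivial_limit_at_right_real _ lim1] by blast
  have "((\<lambda>e. \<Sum>i\<le>N. c i * e ^ (N - i)) \<longlongrightarrow> (\<Sum>i\<le>N. c i * 0 ^ (N - i))) (at_right 0)"
    by (intro tendsto_intros)
  moreover have "(\<Sum>i\<le>N. c i * 0 ^ (N - i)) = c N"
    by (subst sum.remove[of _ N]) (auto intro!: sum.neutral)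
  ultimately have "((\<lambda>e. \<Sum>i\<le>N. c i * e ^ (N - i)) \<longlongrightarrow> c N) (at_right 0)" by simp
  moreover have "(measure lborel (minkowski A ((\<lambda>v. e *\<^sub>R v) ` K)) - measure lborel A) / e = (\<Sum>i\<le>N. c i * e ^ (N - i))"
    if "0 < e" for e
    using that unfolding V[OF that] VA
    by (simp add: sum_divide_distrib Suc_diff_le)
  ultimately have lim: "((\<lambda>e. (measure lborel (minkowski A ((\<lambda>v. e *\<^sub>R v) ` K)) - measure lborel A) / e) \<longlongrightarrow> c N) (at_right 0)"
    by (subst tendsto_cong[where g="\<lambda>e. \<Sum>i\<le>N. c i * e ^ (N - i)"]) (auto simp: eventually_at_filter)
  have "mixed_volume (replicate N A @ [K]) = (1 / fact (Suc N)) *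
     (\<Sum>m\<le>N. real (N choose m) * (-1) ^ (N - m) * (\<Sum>i\<le>N. c i * real m ^ i))"
  proof -
    \<comment> \<open>The subtracted volume is the term of degree \<open>Suc N\<close>, so what
      remains has degree at most \<open>N\<close>, the range in which the alternating sum is known.
      At \<open>m = 0\<close> that term vanishes by itself.\<close>
    have "measure lborel (minkowski ((\<lambda>v. real m *\<^sub>R v) ` A) K)
          - (if m = 0 then 0 else measure lborel ((\<lambda>v. real m *\<^sub>R v) ` A)) = (\<Sum>i\<le>N. c i * real m ^ i)" for m
    proof (cases "m = 0")
      case False
      then have "measure lborel ((\<lambda>v. real m *\<^sub>R v) ` A) = real m ^ Suc N * c (Suc N)"
        using A(1) by (subst measure_lborel_scaleR_image) (auto simp: borel_compact N VA)
      then show ?thesis using False by (simp add: p(2) px)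
    qed (simp add: p(2)[of 0, simplified] px)
    then show ?thesis unfolding mixed_volume_replicate[OF A(2) ne(2)] by simp
  qed
  also have "(\<Sum>m\<le>N. real (N choose m) * (-1) ^ (N - m) * (\<Sum>i\<le>N. c i * real m ^ i))
      = (\<Sum>i\<le>N. c i * (\<Sum>m\<le>N. real (N choose m) * (-1) ^ (N - m) * real m ^ i))"
    unfolding sum_distrib_left by (subst sum.swap) (simp only: mult_ac)
  also have "\<dots> = (\<Sum>i\<le>N. c i * (if i = N then fact N else 0))"
    by (intro sum.cong) (auto simp: alternating_binomial_power_sum)
  also have "\<dots> = c N * fact N" by (simp add: if_distrib[where f="\<lambda>x. _ * x"] cong: if_cong)
  finally have "real CARD('n) * mixed_volume (replicate (CARD('n) - 1) A @ [K]) = c N"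
    by (simp add: N fact_Suc field_simps del: of_nat_Suc)
  then show ?thesis using lim by simp
qed

text \<open>The gauge demands a translate of the body with 0 in its interior; this returns the
  answer to the original body.\<close>

lemma mixed_volume_replicate_translation:
  fixes A K :: "'a::euclidean_space set"
  assumes A: "compact A" "convex A" "A \<noteq> {}" and K: "compact K"
  shows "mixed_volume (replicate N ((\<lambda>x. a + x) ` A) @ [K]) = mixed_volume (replicate N A @ [K])"
proof -
  have B: "convex ((\<lambda>x. a + x) ` A)" "(\<lambda>x. a + x) ` A \<noteq> {}"
    using A by (auto intro: convex_translation)
  have scale: "(\<lambda>v. r *\<^sub>R v) ` (\<lambda>x. a + x) ` A = (\<lambda>x. r *\<^sub>R a + x) ` (\<lambda>v. r *\<^sub>R v) ` A" for r
    by (simp add: image_image scaleR_add_right)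
  have mink: "minkowski ((\<lambda>x. b + x) ` C) K = (\<lambda>x. b + x) ` minkowski C K" for b :: 'a and C
    unfolding minkowski_def by (auto simp: image_iff) (metis add.assoc)+
  show ?thesis
    unfolding mixed_volume_replicate[OF B] mixed_volume_replicate[OF A(2,3)] scale mink
    by (subst (1 2) measure_lborel_translation)
       (auto intro!: borel_compact compact_minkowski compact_scaling A K)
qed

section \<open>Gauges and inf-convolutions\<close>

text \<open>The gauge is not assumed even, so the directions \<open>h\<close> and \<open>- h\<close>
  have to be kept apart throughout. The upper bound by \<open>L\<close> makes \<open>p\<close>
  Lipschitz, the lower bound by \<open>m\<close> makes its sublevel sets bounded.\<close>

locale gauge_function =
  fixes p :: "'a::euclidean_space \<Rightarrow> real" and L m :: real
  assumes gauge_add: "p (x + y) \<le> p x + p y"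
    and gauge_scaleR: "0 \<le> c \<Longrightarrow> p (c *\<^sub>R x) = c * p x"
    and L_pos: "0 < L" and gauge_le_norm: "p x \<le> L * norm x"
    and m_pos: "0 < m" and norm_le_gauge: "m * norm x \<le> p x"
begin

lemma gauge_nonneg: "0 \<le> p x"
  using norm_le_gauge[of x] m_pos by (meson mult_nonneg_nonneg less_imp_le norm_ge_zero order_trans)

lemma gauge_lipschitz: "\<bar>p x - p y\<bar> \<le> L * norm (x - y)"
  using gauge_add[of y "x - y"] gauge_add[of x "y - x"] gauge_le_norm[of "x - y"] gauge_le_norm[of "y - x"]
  by (simp add: norm_minus_commute abs_le_iff)

lemma continuous_on_gauge: "continuous_on S p"
proof -
  have "L-lipschitz_on UNIV p"
    using gauge_lipschitz L_pos by (intro lipschitz_onI) (auto simp: dist_norm)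
  then show ?thesis using lipschitz_on_continuous_on continuous_on_subset by blast
qed

lemma borel_measurable_gauge [measurable]: "p \<in> borel_measurable borel"
  by (intro borel_measurable_continuous_onI continuous_on_gauge)

section \<open>Directional derivatives of a gauge\<close>

definition dquot :: "'a \<Rightarrow> 'a \<Rightarrow> real \<Rightarrow> real" where
  "dquot x h t = (p (x + t *\<^sub>R h) - p x) / t"

text \<open>Difference quotients of a convex function increase with \<open>t\<close>, so the infimum
  is the limit as \<open>t\<close> tends to 0 from the right. Defined this way, the one-sided
  derivative exists at every point and is below every quotient.\<close>

definition dderiv :: "'a \<Rightarrow> 'a \<Rightarrow> real" where
  "dderiv x h = (INF t\<in>{0<..}. dquot x h t)"

lemma dquot_mono:
  assumes "0 < s" "s \<le> t"
  shows "dquot x h s \<le> dquot x h t"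
proof -
  have "x + s *\<^sub>R h = (1 - s / t) *\<^sub>R x + (s / t) *\<^sub>R (x + t *\<^sub>R h)"
    using assms by (simp add: algebra_simps)
  also have "p \<dots> \<le> (1 - s / t) * p x + (s / t) * p (x + t *\<^sub>R h)"
    using assms by (intro order_trans[OF gauge_add]) (simp add: gauge_scaleR)
  finally have "p (x + s *\<^sub>R h) - p x \<le> (s / t) * (p (x + t *\<^sub>R h) - p x)"
    by (simp add: algebra_simps)
  then show ?thesis unfolding dquot_def using assms by (simp add: field_simps)
qed

lemma abs_dquot_le: "0 < t \<Longrightarrow> \<bar>dquot x h t\<bar> \<le> L * norm h"
  unfolding dquot_def using gauge_lipschitz[of "x + t *\<^sub>R h" x]
  by (simp add: field_simps)

lemma bdd_below_dquot: "bdd_below (dquot x h ` {0<..})"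
proof (rule bdd_belowI2)
  fix t :: real assume "t \<in> {0<..}"
  then show "- (L * norm h) \<le> dquot x h t" using abs_dquot_le[of t x h] by simp
qed

lemma dderiv_le_dquot: "0 < t \<Longrightarrow> dderiv x h \<le> dquot x h t"
  unfolding dderiv_def by (rule cINF_lower[OF bdd_below_dquot]) simp

lemma dquot_tendsto: "(dquot x h \<longlongrightarrow> dderiv x h) (at_right 0)"
proof (rule decreasing_tendsto)
  show "\<forall>\<^sub>F t in at_right 0. dderiv x h \<le> dquot x h t"
    using dderiv_le_dquot by (auto simp: eventually_at_filter)
next
  fix y assume "dderiv x h < y"
  then obtain t where "0 < t" "dquot x h t < y"
    unfolding dderiv_def by (subst (asm) cINF_less_iff[OF _ bdd_below_dquot]) auto
  then show "\<forall>\<^sub>F t in at_right 0. dquot x h t < y"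
    using le_less_trans[OF dquot_mono[OF _ less_imp_le]]
    by (auto simp: eventually_at_right_field intro!: exI[of _ t])
qed

text \<open>Convexity at a midpoint: \<open>x + t (h + k)\<close> is halfway between
  \<open>x + 2 t h\<close> and \<open>x + 2 t k\<close>.\<close>

lemma dderiv_add: "dderiv x (h + k) \<le> dderiv x h + dderiv x k"
proof (rule tendsto_le[OF trivial_limit_at_right_real])
  have half: "filterlim (\<lambda>t::real. 2 * t) (at_right 0) (at_right 0)"
    by (auto simp: filterlim_at eventually_at_filter intro!: tendsto_eq_intros)
  show "((\<lambda>t. dquot x h (2 * t) + dquot x k (2 * t)) \<longlongrightarrow> dderiv x h + dderiv x k) (at_right 0)"
    by (intro tendsto_add filterlim_compose[OF dquot_tendsto half])
  show "(dquot x (h + k) \<longlongrightarrow> dderiv x (h + k)) (at_right 0)" by (rule dquot_tendsto)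
  have "dquot x (h + k) t \<le> dquot x h (2 * t) + dquot x k (2 * t)" if "0 < t" for t
  proof -
    have "x + t *\<^sub>R (h + k) = (1/2) *\<^sub>R (x + (2 * t) *\<^sub>R h) + (1/2) *\<^sub>R (x + (2 * t) *\<^sub>R k)"
      by (simp add: algebra_simps flip: scaleR_left.add)
    also have "p \<dots> \<le> (1/2) * p (x + (2 * t) *\<^sub>R h) + (1/2) * p (x + (2 * t) *\<^sub>R k)"
      by (intro order_trans[OF gauge_add]) (simp add: gauge_scaleR)
    finally have "p (x + t *\<^sub>R (h + k)) - p x \<le> (p (x + (2 * t) *\<^sub>R h) - p x) / 2 + (p (x + (2 * t) *\<^sub>R k) - p x) / 2"
      by (simp add: field_simps)
    then have "(p (x + t *\<^sub>R (h + k)) - p x) / t \<le> ((p (x + (2 * t) *\<^sub>R h) - p x) / 2 + (p (x + (2 * t) *\<^sub>R k) - p x) / 2) / t"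
      using that by (intro divide_right_mono) auto
    then show ?thesis unfolding dquot_def by (simp add: add_divide_distrib)
  qed
  then show "\<forall>\<^sub>F t in at_right 0. dquot x (h + k) t \<le> dquot x h (2 * t) + dquot x k (2 * t)"
    by (auto simp: eventually_at_filter)
qed

lemma dderiv_0: "dderiv x 0 = 0"
  unfolding dderiv_def dquot_def by simp

lemma dderiv_scaleR:
  assumes "0 \<le> c"
  shows "dderiv x (c *\<^sub>R h) = c * dderiv x h"
proof (cases "c = 0")
  case False
  then have c: "0 < c" using assms by simp
  have "filterlim (\<lambda>t::real. c * t) (at_right 0) (at_right 0)"
    using c by (auto simp: filterlim_at eventually_at_filter intro!: tendsto_eq_intros)
  then have "((\<lambda>t. c * dquot x h (c * t)) \<longlongrightarrow> c * dderiv x h) (at_right 0)"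
    by (intro tendsto_intros filterlim_compose[OF dquot_tendsto])
  moreover have "(\<lambda>t. c * dquot x h (c * t)) = dquot x (c *\<^sub>R h)"
    using c by (auto simp: dquot_def fun_eq_iff mult.commute)
  ultimately show ?thesis
    using tendsto_unique[OF trivial_limit_at_right_real _ dquot_tendsto] by metis
qed (simp add: dderiv_0)

lemma dderiv_sum: "finite A \<Longrightarrow> dderiv x (\<Sum>a\<in>A. f a) \<le> (\<Sum>a\<in>A. dderiv x (f a))"
  by (induction A rule: finite_induct) (auto simp: dderiv_0 intro: order_trans[OF dderiv_add])

lemma dderiv_minus: "- dderiv x (- h) \<le> dderiv x h"
  using dderiv_add[of x h "- h"] by (simp add: dderiv_0)

text \<open>A sublinear function that is odd on the coordinate vectors is linear.\<close>

lemma dderiv_linear: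
  assumes "\<And>b. b \<in> Basis \<Longrightarrow> dderiv x b + dderiv x (- b) = 0"
  shows "dderiv x h = (\<Sum>b\<in>Basis. dderiv x b *\<^sub>R b) \<bullet> h"
proof -
  let ?g = "\<Sum>b\<in>Basis. dderiv x b *\<^sub>R b"
  have le: "dderiv x h \<le> ?g \<bullet> h" for h
  proof -
    have "dderiv x h = dderiv x (\<Sum>b\<in>Basis. (h \<bullet> b) *\<^sub>R b)" by (simp add: euclidean_representation)
    also have "\<dots> \<le> (\<Sum>b\<in>Basis. dderiv x ((h \<bullet> b) *\<^sub>R b))" by (rule dderiv_sum) simp
    also have "\<dots> = (\<Sum>b\<in>Basis. dderiv x b * (b \<bullet> h))"
    proof (intro sum.cong refl)
      fix b :: 'a assume b: "b \<in> Basis"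
      show "dderiv x ((h \<bullet> b) *\<^sub>R b) = dderiv x b * (b \<bullet> h)"
      proof (cases "0 \<le> h \<bullet> b")
        case False
        then have "dderiv x ((- (h \<bullet> b)) *\<^sub>R (- b)) = - (h \<bullet> b) * dderiv x (- b)"
          by (intro dderiv_scaleR) simp
        then show ?thesis using assms[OF b] by (simp add: inner_commute eq_neg_iff_add_eq_0[symmetric] add.commute)
      qed (simp add: dderiv_scaleR inner_commute)
    qed
    also have "\<dots> = ?g \<bullet> h" by (simp add: inner_sum_left)
    finally show ?thesis .
  qed
  show ?thesis using le[of h] le[of "- h"] dderiv_minus[of x h] by simp
qed

lemma integrable_compact_support:
  fixes f :: "'a \<Rightarrow> real"
  assumes "continuous_on UNIV f" "\<And>x. r < norm x \<Longrightarrow> f x = 0"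
  shows "integrable lborel f"
proof -
  have "integrable lborel (\<lambda>x. indicator (cball 0 r) x *\<^sub>R f x)"
    by (rule borel_integrable_compact[OF compact_cball continuous_on_subset[OF assms(1)]]) simp
  moreover have "(\<lambda>x. indicator (cball 0 r) x *\<^sub>R f x) = f"
    using assms(2) by (auto simp: fun_eq_iff indicator_def not_le)
  ultimately show ?thesis by simp
qed

lemma integral_translate:
  fixes f :: "'a \<Rightarrow> real"
  shows "f \<in> borel_measurable borel \<Longrightarrow> (\<integral>x. f x \<partial>lborel) = (\<integral>x. f (a + x) \<partial>lborel)"
  using integral_distr[of "(+) a" lborel borel f] by (simp add: lborel_distr_plus)

text \<open>Summation by parts. A translation by \<open>t e\<close> moves the difference from the
  gauge, of which only first-order bounds are known, onto the 1-Lipschitz hat function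
  \<open>\<phi>\<close>; the weighted second difference quotient thus has an integral of order
  \<open>t\<close>. The enlarged radius \<open>r + 1\<close> accounts for the translation, as
  \<open>t \<le> 1\<close>.\<close>

lemma integral_second_difference_le:
  fixes e :: 'a
  assumes t: "0 < t" "t \<le> 1" and e: "norm e = 1" and r: "0 < r"
  defines "\<phi> \<equiv> \<lambda>x::'a. max 0 (r - norm x)"
  shows "(\<integral>x. \<phi> x * (dquot x e t + dquot x (- e) t) \<partial>lborel) \<le> t * (L * measure lborel (cball (0::'a) (r + 1)))"
    and "integrable lborel (\<lambda>x. \<phi> x * (dquot x e t + dquot x (- e) t))"
proof -
  have c\<phi>: "continuous_on UNIV \<phi>" "continuous_on UNIV (\<lambda>x. \<phi> (t *\<^sub>R e + x))"
    unfolding \<phi>_def by (intro continuous_intros)+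
  have cq: "continuous_on UNIV (\<lambda>x. dquot x h t)" for h
    unfolding dquot_def using t
    by (intro continuous_intros continuous_on_compose2[OF continuous_on_gauge[of UNIV]]) auto
  have zero: "\<phi> x = 0" if "r < norm x" for x using that by (simp add: \<phi>_def)
  have zero': "\<phi> (t *\<^sub>R e + x) = 0" if "r + 1 < norm x" for x
  proof (rule zero)
    have "norm x \<le> norm (t *\<^sub>R e + x) + norm (t *\<^sub>R e)"
      by (metis add_diff_cancel_left' norm_triangle_sub norm_minus_commute add.commute norm_triangle_ineq4)
    then show "r < norm (t *\<^sub>R e + x)" using that t e by simp
  qed
  have i1: "integrable lborel (\<lambda>x. \<phi> x * dquot x h t)" for h
    by (rule integrable_compact_support[of _ r]) (auto simp: zero intro!: continuous_intros c\<phi> cq)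
  have i2: "integrable lborel (\<lambda>x. \<phi> (t *\<^sub>R e + x) * dquot x e t)"
    by (rule integrable_compact_support[of _ "r + 1"]) (auto simp: zero' intro!: continuous_intros c\<phi> cq)
  show int: "integrable lborel (\<lambda>x. \<phi> x * (dquot x e t + dquot x (- e) t))"
    unfolding distrib_left by (intro Bochner_Integration.integrable_add i1)
  \<comment> \<open>At the translated point the quotient in direction \<open>- e\<close> is minus
    the quotient in direction \<open>e\<close> at the original point.\<close>
  have "(\<integral>x. \<phi> x * dquot x (- e) t \<partial>lborel) = (\<integral>x. \<phi> (t *\<^sub>R e + x) * dquot (t *\<^sub>R e + x) (- e) t \<partial>lborel)"
    using i1[of "- e"] by (intro integral_translate) (auto dest: borel_measurable_integrable)
  also have "\<dots> = - (\<integral>x. \<phi> (t *\<^sub>R e + x) * dquot x e t \<partial>lborel)"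
    unfolding Bochner_Integration.integral_minus[symmetric]
    by (intro Bochner_Integration.integral_cong) (auto simp: dquot_def algebra_simps divide_simps)
  finally have "(\<integral>x. \<phi> x * (dquot x e t + dquot x (- e) t) \<partial>lborel)
      = (\<integral>x. (\<phi> x - \<phi> (t *\<^sub>R e + x)) * dquot x e t \<partial>lborel)"
    unfolding distrib_left left_diff_distrib by (simp add: i1 i2)
  also have "\<dots> \<le> (\<integral>x. (t * L) * indicator (cball (0::'a) (r + 1)) x \<partial>lborel)"
  proof (rule Bochner_Integration.integral_mono)
    show "integrable lborel (\<lambda>x. (\<phi> x - \<phi> (t *\<^sub>R e + x)) * dquot x e t)"
      unfolding left_diff_distrib by (intro Bochner_Integration.integrable_diff i1 i2)
    show "integrable lborel (\<lambda>x. (t * L) * indicator (cball (0::'a) (r + 1)) x)"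
      using emeasure_bounded_finite[of "cball (0::'a) (r + 1)"]
      by (intro integrable_mult_right integrable_real_indicator) auto
    fix x
    show "(\<phi> x - \<phi> (t *\<^sub>R e + x)) * dquot x e t \<le> (t * L) * indicator (cball 0 (r + 1)) x"
    proof (cases "norm x \<le> r + 1")
      case True
      have n: "\<bar>norm (t *\<^sub>R e + x) - norm x\<bar> \<le> t"
        using norm_triangle_ineq3[of "t *\<^sub>R e + x" x] t e by simp
      have "\<bar>\<phi> x - \<phi> (t *\<^sub>R e + x)\<bar> \<le> t" unfolding \<phi>_def using n by linarith
      then have "\<bar>\<phi> x - \<phi> (t *\<^sub>R e + x)\<bar> * \<bar>dquot x e t\<bar> \<le> t * L"
        using abs_dquot_le[OF t(1), of x e] e t L_pos by (intro mult_mono) auto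
      then show ?thesis using True by (simp add: abs_mult[symmetric] abs_le_iff)
    next
      case False
      then show ?thesis using zero[of x] zero'[of x] by simp
    qed
  qed
  also have "\<dots> = t * (L * measure lborel (cball (0::'a) (r + 1)))" by simp
  finally show "(\<integral>x. \<phi> x * (dquot x e t + dquot x (- e) t) \<partial>lborel) \<le> t * (L * measure lborel (cball (0::'a) (r + 1)))" .
qed

text \<open>The sum of the two quotients is nonnegative by convexity and tends to the defect of
  oddness, while its weighted integrals tend to 0; by Fatou's lemma the defect vanishes almost
  everywhere. Countably many hat functions exhaust the space.\<close>

lemma AE_dderiv_odd:
  fixes e :: 'a
  assumes e: "norm e = 1"
  shows "AE x in lborel. dderiv x e + dderiv x (- e) = 0"
proof -
  have "AE x in lborel. norm x < real r \<longrightarrow> dderiv x e + dderiv x (- e) = 0" if r: "0 < r" for r :: nat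
  proof -
    define \<phi> where "\<phi> = (\<lambda>x::'a. max 0 (real r - norm x))"
    define t where "t = (\<lambda>k. 1 / real (Suc k))"
    have t: "0 < t k" "t k \<le> 1" for k by (auto simp: t_def)
    have t0: "t \<longlonglongrightarrow> 0" unfolding t_def by (rule LIMSEQ_Suc[OF lim_1_over_n])
    then have tr: "filterlim t (at_right 0) sequentially"
      using t by (auto simp: filterlim_at intro!: always_eventually) (metis less_irrefl)
    define G where "G = (\<lambda>k x. \<phi> x * (dquot x e (t k) + dquot x (- e) (t k)))"
    have lim: "(\<lambda>k. G k x) \<longlonglongrightarrow> \<phi> x * (dderiv x e + dderiv x (- e))" for x
      unfolding G_def by (intro tendsto_intros filterlim_compose[OF dquot_tendsto tr])
    have nn: "0 \<le> G k x" for k x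
      unfolding G_def \<phi>_def
      using dderiv_le_dquot[OF t(1)[of k], of x e] dderiv_le_dquot[OF t(1)[of k], of x "- e"] dderiv_minus[of x e]
      by (intro mult_nonneg_nonneg) auto
    have int: "integrable lborel (G k)" for k
      unfolding G_def \<phi>_def using integral_second_difference_le(2)[OF t e, of "real r"] r by simp
    have [measurable]: "G k \<in> borel_measurable lborel" for k using int by auto
    have "(\<integral>\<^sup>+x. liminf (\<lambda>k. ennreal (G k x)) \<partial>lborel) \<le> liminf (\<lambda>k. \<integral>\<^sup>+x. ennreal (G k x) \<partial>lborel)"
      by (rule nn_integral_liminf) measurable
    also have "\<dots> \<le> liminf (\<lambda>k. ennreal (t k * (L * measure lborel (cball (0::'a) (real r + 1)))))"
    proof (intro Liminf_mono always_eventually allI)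
      fix k
      have "(\<integral>\<^sup>+x. ennreal (G k x) \<partial>lborel) = ennreal (\<integral>x. G k x \<partial>lborel)"
        by (rule nn_integral_eq_integral[OF int]) (simp add: nn)
      also have "\<dots> \<le> ennreal (t k * (L * measure lborel (cball (0::'a) (real r + 1))))"
        unfolding G_def \<phi>_def using integral_second_difference_le(1)[OF t e, of "real r"] r by (intro ennreal_leI) simp
      finally show "(\<integral>\<^sup>+x. ennreal (G k x) \<partial>lborel) \<le> ennreal (t k * (L * measure lborel (cball (0::'a) (real r + 1))))" .
    qed
    also have "\<dots> = ennreal (0 * (L * measure lborel (cball (0::'a) (real r + 1))))"
      by (intro lim_imp_Liminf tendsto_ennrealI tendsto_intros t0) simp
    finally have "(\<integral>\<^sup>+x. liminf (\<lambda>k. ennreal (G k x)) \<partial>lborel) = 0" by simp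
    then have "AE x in lborel. liminf (\<lambda>k. ennreal (G k x)) = 0"
      by (subst (asm) nn_integral_0_iff_AE) auto
    then show ?thesis
    proof (rule AE_mp, intro AE_I2 impI)
      fix x :: 'a assume "liminf (\<lambda>k. ennreal (G k x)) = 0" "norm x < real r"
      moreover have "liminf (\<lambda>k. ennreal (G k x)) = ennreal (\<phi> x * (dderiv x e + dderiv x (- e)))"
        by (intro lim_imp_Liminf tendsto_ennrealI lim) simp
      moreover have "0 \<le> dderiv x e + dderiv x (- e)" using dderiv_minus[of x e] by simp
      moreover have "0 < \<phi> x" using \<open>norm x < real r\<close> by (simp add: \<phi>_def)
      ultimately show "dderiv x e + dderiv x (- e) = 0"
        by (simp add: ennreal_eq_0_iff mult_le_0_iff)
    qed
  qed
  then have "AE x in lborel. \<forall>r::nat. 0 < r \<longrightarrow> norm x < real r \<longrightarrow> dderiv x e + dderiv x (- e) = 0"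
    by (subst AE_all_countable) auto
  then show ?thesis
  proof (rule AE_mp, intro AE_I2 impI)
    fix x :: 'a assume *: "\<forall>r::nat. 0 < r \<longrightarrow> norm x < real r \<longrightarrow> dderiv x e + dderiv x (- e) = 0"
    obtain r :: nat where "norm x < real r" using reals_Archimedean2 by blast
    then show "dderiv x e + dderiv x (- e) = 0"
      using * by (metis le_less_trans norm_ge_zero of_nat_0_less_iff)
  qed
qed

lemma AE_dderiv_linear: "AE x in lborel. \<exists>g. \<forall>h. dderiv x h = g \<bullet> h"
proof -
  have "AE x in lborel. \<forall>b\<in>Basis. dderiv x b + dderiv x (- b) = 0"
    using AE_dderiv_odd by (subst AE_finite_all) (auto simp: norm_Basis)
  then show ?thesis
  proof (rule AE_mp, intro AE_I2 impI)
    fix x :: 'a assume "\<forall>b\<in>Basis. dderiv x b + dderiv x (- b) = 0"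
    then have "\<forall>h. dderiv x h = (\<Sum>b\<in>Basis. dderiv x b *\<^sub>R b) \<bullet> h" using dderiv_linear by blast
    then show "\<exists>g. \<forall>h. dderiv x h = g \<bullet> h" by blast
  qed
qed

end

section \<open>Inf-convolutions and their derivative under scaling of the set\<close>

text \<open>For nonempty \<open>S\<close> the set where \<open>infconv p S\<close> is below
  \<open>r\<close> is the Minkowski sum of \<open>S\<close> and the set where \<open>p\<close> is
  below \<open>r\<close>. Strict inequalities make this exact even where the infimum is not
  attained.\<close>

definition infconv :: "('a::euclidean_space \<Rightarrow> real) \<Rightarrow> 'a set \<Rightarrow> 'a \<Rightarrow> real" where
  "infconv p S x = (INF s\<in>S. p (x - s))"

text \<open>Truncation to the window of levels between \<open>a\<close> and \<open>b\<close>. The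
  integral of a difference of truncated functions is the integral over that window of the volumes
  between their level sets.\<close>

definition clamp_real :: "real \<Rightarrow> real \<Rightarrow> real \<Rightarrow> real" where
  "clamp_real a b y = max a (min b y)"

lemma clamp_real_mono: "x \<le> y \<Longrightarrow> clamp_real a b x \<le> clamp_real a b y"
  unfolding clamp_real_def by auto

lemma clamp_real_diff_le: "x \<le> y \<Longrightarrow> clamp_real a b y - clamp_real a b x \<le> y - x"
  unfolding clamp_real_def by auto

lemma borel_measurable_clamp_real [measurable]: "clamp_real a b \<in> borel_measurable borel"
  unfolding clamp_real_def by measurable

text \<open>The Minkowski functional. \<open>R x\<close> collects the factors \<open>r\<close> for
  which \<open>r B\<close> contains \<open>x\<close>; since 0 lies in \<open>B\<close> it is upward
  closed, so everything above its infimum belongs to it. A ball inside \<open>B\<close> gives the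
  constant \<open>1 / \<rho>\<close>, a ball around \<open>B\<close> the constant
  \<open>1 / b\<close>.\<close>

lemma convex_body_gauge:
  fixes B :: "'a::euclidean_space set"
  assumes B: "compact B" "convex B" "0 \<in> interior B"
  obtains p L m where "gauge_function p L m" "B = {x. p x \<le> 1}"
proof -
  obtain \<rho> where \<rho>: "0 < \<rho>" "cball 0 \<rho> \<subseteq> B" using B(3) by (auto simp: mem_interior_cball)
  obtain b where b: "0 < b" "\<And>x. x \<in> B \<Longrightarrow> norm x \<le> b"
    using compact_imp_bounded[OF B(1)] by (auto simp: bounded_pos)
  have 0: "0 \<in> B" using B(3) interior_subset by blast
  define R where "R = (\<lambda>x. {r. 0 < r \<and> (1 / r) *\<^sub>R x \<in> B})"
  define p where "p = (\<lambda>x. Inf (R x))"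
  have bdd: "bdd_below (R x)" for x by (rule bdd_belowI[of _ 0]) (simp add: R_def)
  have big: "r \<in> R x" if "norm x \<le> \<rho> * r" "0 < r" for x r
    using that \<rho> by (auto simp: R_def field_simps intro!: subsetD[OF \<rho>(2)])
  have ne: "R x \<noteq> {}" for x
    using big[of x "norm x / \<rho> + 1"] \<rho>(1) by (auto simp: field_simps add_pos_nonneg)
  have up: "s \<in> R x" if "r \<in> R x" "r \<le> s" for r s x
  proof -
    have "(r / s) *\<^sub>R ((1 / r) *\<^sub>R x) + (1 - r / s) *\<^sub>R 0 \<in> B"
      using that 0 by (intro convexD[OF B(2)]) (auto simp: R_def)
    then show ?thesis using that by (simp add: R_def)
  qed
  have less: "r \<in> R x" if "p x < r" for x r
    using that up unfolding p_def cInf_less_iff[OF ne bdd] by (meson less_imp_le)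
  have le: "p x \<le> r" if "r \<in> R x" for x r
    unfolding p_def using that by (rule cInf_lower[OF _ bdd])
  have pl: "p x \<le> (1 / \<rho>) * norm x" for x
  proof (rule field_le_epsilon)
    fix e :: real assume "0 < e"
    then show "p x \<le> (1 / \<rho>) * norm x + e"
      using \<rho>(1) by (intro le big) (auto simp: field_simps add_nonneg_pos)
  qed
  have lp: "(1 / b) * norm x \<le> p x" for x
    unfolding p_def
  proof (rule cInf_greatest[OF ne])
    fix r assume "r \<in> R x"
    then have "norm ((1 / r) *\<^sub>R x) \<le> b" "0 < r" using b(2)[of "(1 / r) *\<^sub>R x"] by (auto simp: R_def)
    then show "(1 / b) * norm x \<le> r" using b(1) by (simp add: field_simps)
  qed
  have add: "p (x + y) \<le> p x + p y" for x y
  proof (rule field_le_epsilon)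
    fix e :: real assume e: "0 < e"
    define r s where "r = p x + e / 2" and "s = p y + e / 2"
    have "r \<in> R x" "s \<in> R y" using less[of x r] less[of y s] e by (auto simp: r_def s_def)
    then have rs: "0 < r" "0 < s" "(1 / r) *\<^sub>R x \<in> B" "(1 / s) *\<^sub>R y \<in> B" by (auto simp: R_def)
    then have "(r / (r + s)) *\<^sub>R ((1 / r) *\<^sub>R x) + (s / (r + s)) *\<^sub>R ((1 / s) *\<^sub>R y) \<in> B"
      by (intro convexD[OF B(2)]) (auto simp: add_divide_distrib[symmetric])
    then have "r + s \<in> R (x + y)" using rs by (simp add: R_def scaleR_add_right)
    then show "p (x + y) \<le> p x + p y + e" using le unfolding r_def s_def by fastforce
  qed
  have scale_le: "p (c *\<^sub>R x) \<le> c * p x" if "0 < c" for c x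
  proof -
    have "p (c *\<^sub>R x) / c \<le> p x"
    proof (rule field_le_epsilon)
      fix e :: real assume "0 < e"
      then have "p x + e \<in> R x" by (intro less) simp
      then have "c * (p x + e) \<in> R (c *\<^sub>R x)" using that by (simp add: R_def)
      then show "p (c *\<^sub>R x) / c \<le> p x + e" using le[of "c * (p x + e)"] that by (simp add: field_simps)
    qed
    then show ?thesis using that by (simp add: field_simps)
  qed
  have scale: "p (c *\<^sub>R x) = c * p x" if "0 \<le> c" for c x
  proof (cases "c = 0")
    case True
    then show ?thesis using pl[of 0] lp[of 0] by simp
  next
    case False
    then have c: "0 < c" using that by simp
    have "p ((1 / c) *\<^sub>R (c *\<^sub>R x)) \<le> (1 / c) * p (c *\<^sub>R x)" using c by (intro scale_le) simp
    then have "c * p x \<le> p (c *\<^sub>R x)" using c by (simp add: field_simps)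
    then show ?thesis using scale_le[OF c, of x] by simp
  qed
  have "B = {x. p x \<le> 1}"
  proof (intro equalityI subsetI)
    fix x assume "x \<in> B" then show "x \<in> {x. p x \<le> 1}" using le[of 1 x] by (simp add: R_def)
  next
    fix x assume x: "x \<in> {x. p x \<le> 1}"
    \<comment> \<open>At \<open>p x = 1\<close> membership is not immediate from the infimum;
      slightly shrunk points do lie in \<open>B\<close>, and \<open>B\<close> is closed.\<close>
    have "(\<lambda>k. (1 / (1 + 1 / real (Suc k))) *\<^sub>R x) \<longlonglongrightarrow> (1 / (1 + 0)) *\<^sub>R x"
      by (intro tendsto_intros LIMSEQ_Suc[OF lim_1_over_n]) simp
    moreover have "(1 / (1 + 1 / real (Suc k))) *\<^sub>R x \<in> B" for k
    proof -
      have "0 < 1 / real (Suc k)" by simp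
      moreover have "p x \<le> 1" using x by simp
      ultimately have "p x < 1 + 1 / real (Suc k)" by linarith
      then show ?thesis using less[of x "1 + 1 / real (Suc k)"] unfolding R_def by blast
    qed
    ultimately show "x \<in> B"
      using closed_sequentially[OF compact_imp_closed[OF B(1)]] by fastforce
  qed
  moreover have "gauge_function p (1 / \<rho>) (1 / b)"
    by unfold_locales (use add scale pl lp \<rho>(1) b(1) in auto)
  ultimately show thesis using that by blast
qed

context gauge_function
begin

lemma bdd_below_infconv: "bdd_below ((\<lambda>s. p (x - s)) ` S)"
  by (rule bdd_belowI2[of _ 0]) (rule gauge_nonneg)

lemma infconv_less_iff: "S \<noteq> {} \<Longrightarrow> infconv p S x < r \<longleftrightarrow> (\<exists>s\<in>S. p (x - s) < r)"
  unfolding infconv_def by (rule cINF_less_iff[OF _ bdd_below_infconv])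

lemma infconv_le: "s \<in> S \<Longrightarrow> infconv p S x \<le> p (x - s)"
  unfolding infconv_def by (rule cINF_lower[OF bdd_below_infconv])

lemma infconv_le_gauge: "0 \<in> S \<Longrightarrow> infconv p S x \<le> p x"
  using infconv_le[of 0 S x] by simp

lemma infconv_lipschitz:
  assumes "S \<noteq> {}"
  shows "\<bar>infconv p S x - infconv p S y\<bar> \<le> L * norm (x - y)"
proof -
  have "infconv p S x - L * norm (x - y) \<le> infconv p S y" for x y
    unfolding infconv_def[of p S y]
  proof (rule cINF_greatest[OF assms])
    fix s assume "s \<in> S"
    then show "infconv p S x - L * norm (x - y) \<le> p (y - s)"
      using infconv_le[of s S x] gauge_lipschitz[of "x - s" "y - s"] by simp
  qed
  from this[of x y] this[of y x] show ?thesis by (simp add: norm_minus_commute abs_le_iff)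
qed

lemma borel_measurable_infconv:
  assumes "S \<noteq> {}" shows "infconv p S \<in> borel_measurable borel"
proof -
  have "L-lipschitz_on UNIV (infconv p S)"
    using infconv_lipschitz[OF assms] L_pos by (intro lipschitz_onI) (auto simp: dist_norm)
  then show ?thesis by (intro borel_measurable_continuous_onI lipschitz_on_continuous_on)
qed

lemma infconv_ge:
  assumes "S \<noteq> {}" "\<And>s. s \<in> S \<Longrightarrow> norm s \<le> R"
  shows "p x - L * R \<le> infconv p S x"
  unfolding infconv_def
proof (rule cINF_greatest[OF assms(1)])
  fix s assume "s \<in> S"
  then have "L * norm s \<le> L * R" using assms(2) L_pos by simp
  then show "p x - L * R \<le> p (x - s)" using gauge_lipschitz[of x "x - s"] by simp
qed

text \<open>Minus the derivative of \<open>e \<mapsto> infconv p (e S) x\<close> at 0. Where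
  \<open>p\<close> has a gradient \<open>g\<close>, the derivative in direction \<open>- s\<close>
  is \<open>- (g \<bullet> s)\<close>, and this becomes the support function of \<open>S\<close> at
  \<open>g\<close>.\<close>

definition dsup :: "'a set \<Rightarrow> 'a \<Rightarrow> real" where
  "dsup S x = (SUP s\<in>S. - dderiv x (- s))"

lemma minus_dderiv_le: "- dderiv x h \<le> L * norm h"
proof -
  have "- (L * norm h) \<le> dderiv x h"
    unfolding dderiv_def
  proof (rule cINF_greatest)
    fix t :: real assume "t \<in> {0<..}"
    then show "- (L * norm h) \<le> dquot x h t" using abs_dquot_le[of t x h] by simp
  qed simp
  then show ?thesis by simp
qed

lemma bdd_above_dsup:
  assumes "\<And>s. s \<in> S \<Longrightarrow> norm s \<le> R"
  shows "bdd_above ((\<lambda>s. - dderiv x (- s)) ` S)"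
proof (rule bdd_aboveI2)
  fix s assume "s \<in> S"
  then have "L * norm (- s) \<le> L * R" using assms L_pos by simp
  then show "- dderiv x (- s) \<le> L * R" using minus_dderiv_le[of x "- s"] by simp
qed

text \<open>Monotone quotients give the upper bound for every \<open>e\<close> and \<open>s\<close>
  at once, as \<open>dderiv\<close> lies below each of them. From below, one nearly optimal
  \<open>s\<close> suffices, whose own quotient converges.\<close>

lemma infconv_quotient_tendsto_dsup:
  assumes S: "\<And>s. s \<in> S \<Longrightarrow> norm s \<le> R" "0 \<in> S"
  shows "((\<lambda>e. (p x - infconv p ((\<lambda>s. e *\<^sub>R s) ` S) x) / e) \<longlongrightarrow> dsup S x) (at_right 0)"
proof (rule increasing_tendsto)
  have q: "p (x - e *\<^sub>R s) = p x + e * dquot x (- s) e" if "0 < e" for e s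
    using that by (simp add: dquot_def)
  have "p x - e * dsup S x \<le> infconv p ((\<lambda>s. e *\<^sub>R s) ` S) x" if e: "0 < e" for e
    unfolding infconv_def
  proof (rule cINF_greatest)
    fix y assume "y \<in> (\<lambda>s. e *\<^sub>R s) ` S"
    then obtain s where s: "s \<in> S" "y = e *\<^sub>R s" by auto
    have "- dderiv x (- s) \<le> dsup S x"
      unfolding dsup_def using s(1) by (rule cSUP_upper[OF _ bdd_above_dsup[OF S(1)]])
    then have "- dquot x (- s) e \<le> dsup S x" using dderiv_le_dquot[OF e, of x "- s"] by simp
    from mult_left_mono[OF this, of e] show "p x - e * dsup S x \<le> p (x - y)"
      using e by (simp add: s(2) q)
  qed (use S in auto)
  then show "\<forall>\<^sub>F e in at_right 0. (p x - infconv p ((\<lambda>s. e *\<^sub>R s) ` S) x) / e \<le> dsup S x"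
    by (auto simp: eventually_at_filter divide_le_eq algebra_simps intro!: always_eventually)
  fix y assume "y < dsup S x"
  then obtain s where s: "s \<in> S" "y < - dderiv x (- s)"
    unfolding dsup_def using less_cSUP_iff[OF _ bdd_above_dsup[OF S(1)]] S(2) by blast
  have "((\<lambda>e. - dquot x (- s) e) \<longlongrightarrow> - dderiv x (- s)) (at_right 0)"
    by (intro tendsto_minus dquot_tendsto)
  then have "\<forall>\<^sub>F e in at_right 0. y < - dquot x (- s) e" using s(2) by (rule order_tendstoD)
  moreover have "\<forall>\<^sub>F e in at_right 0. 0 < (e::real)" by (auto simp: eventually_at_filter)
  ultimately show "\<forall>\<^sub>F e in at_right 0. y < (p x - infconv p ((\<lambda>s. e *\<^sub>R s) ` S) x) / e"
  proof eventually_elim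
    case (elim e)
    have "infconv p ((\<lambda>s. e *\<^sub>R s) ` S) x \<le> p (x - e *\<^sub>R s)" using s(1) by (intro infconv_le) auto
    then have "e * - dquot x (- s) e \<le> p x - infconv p ((\<lambda>s. e *\<^sub>R s) ` S) x"
      using elim by (simp add: q)
    then have "- dquot x (- s) e \<le> (p x - infconv p ((\<lambda>s. e *\<^sub>R s) ` S) x) / e"
      using elim by (simp add: pos_le_divide_eq mult.commute)
    then show ?case using elim by simp
  qed
qed

lemma borel_measurable_dsup:
  assumes S: "\<And>s. s \<in> S \<Longrightarrow> norm s \<le> R" "0 \<in> S"
  shows "dsup S \<in> borel_measurable borel"
proof (rule borel_measurable_LIMSEQ_real)
  define t where "t = (\<lambda>k. 1 / real (Suc k))"
  have "t \<longlonglongrightarrow> 0" unfolding t_def by (rule LIMSEQ_Suc[OF lim_1_over_n])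
  then have "filterlim t (at_right 0) sequentially"
    by (auto simp: filterlim_at t_def intro!: always_eventually)
  then show "(\<lambda>k. (p x - infconv p ((\<lambda>s. t k *\<^sub>R s) ` S) x) / t k) \<longlonglongrightarrow> dsup S x" for x
    using filterlim_compose[OF infconv_quotient_tendsto_dsup[OF S, of x], of t] by simp
  have "(\<lambda>s. t k *\<^sub>R s) ` S \<noteq> {}" for k using S(2) by auto
  from borel_measurable_infconv[OF this]
  show "(\<lambda>x. (p x - infconv p ((\<lambda>s. t k *\<^sub>R s) ` S) x) / t k) \<in> borel_measurable borel" for k
    by measurable
qed

lemma convex_gauge_le: "convex {x. p x \<le> r}"
proof (rule convexI)
  fix x y and u v :: real assume "x \<in> {x. p x \<le> r}" "y \<in> {x. p x \<le> r}" "0 \<le> u" "0 \<le> v" "u + v = 1"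
  then have "p (u *\<^sub>R x + v *\<^sub>R y) \<le> u * p x + v * p y" "u * p x \<le> u * r" "v * p y \<le> v * r"
    using gauge_add[of "u *\<^sub>R x" "v *\<^sub>R y"] by (auto simp: gauge_scaleR intro: mult_left_mono)
  moreover have "u * r + v * r = r" using \<open>u + v = 1\<close> by (metis distrib_right mult_1)
  ultimately show "u *\<^sub>R x + v *\<^sub>R y \<in> {x. p x \<le> r}" by simp
qed

lemma compact_gauge_le: "compact {x. p x \<le> r}"
proof -
  have "closed {x. p x \<le> r}" by (intro closed_Collect_le continuous_on_gauge continuous_on_const)
  moreover have "{x. p x \<le> r} \<subseteq> cball 0 (r / m)"
    using order_trans[OF norm_le_gauge] m_pos by (auto simp: field_simps)
  ultimately show ?thesis using bounded_subset bounded_cball compact_eq_bounded_closed by metis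
qed

text \<open>Moving outwards along a ray raises \<open>p\<close>, so the level set consists of
  frontier points of a convex set.\<close>

lemma null_sets_gauge_eq:
  assumes "0 < r" shows "{x. p x = r} \<in> null_sets lborel"
proof -
  have "x \<in> frontier {x. p x \<le> r}" if x: "p x = r" for x
  proof -
    have "x \<notin> interior {x. p x \<le> r}"
    proof
      assume "x \<in> interior {x. p x \<le> r}"
      then obtain e where e: "0 < e" "cball x e \<subseteq> {x. p x \<le> r}" by (auto simp: mem_interior_cball)
      have nx: "0 < norm x" using x assms gauge_le_norm[of x] L_pos by (cases "x = 0") auto
      have "(1 + e / norm x) *\<^sub>R x \<in> cball x e"
        using nx e by (simp add: dist_norm algebra_simps)
      then have "(1 + e / norm x) * r \<le> r" using e nx x by (auto simp: gauge_scaleR dest!: subsetD)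
      moreover have "0 < (e / norm x) * r" using e nx assms by simp
      ultimately show False by (simp add: distrib_right)
    qed
    moreover have "x \<in> closure {x. p x \<le> r}" using x closure_subset by fastforce
    ultimately show ?thesis by (simp add: frontier_def)
  qed
  then have "{x. p x = r} \<subseteq> frontier {x. p x \<le> r}" by blast
  then have "negligible {x. p x = r}"
    by (rule negligible_subset[OF negligible_convex_frontier[OF convex_gauge_le[of r]]])
  moreover have "{x. p x = r} \<in> sets borel" by measurable
  ultimately show ?thesis by (simp add: negligible_iff_null_sets null_sets_completion_iff)
qed

text \<open>Dominated convergence. Away from the null levels \<open>a\<close> and \<open>b\<close>
  the truncation is locally constant or locally the identity, and the quotient tends to 0 or to
  \<open>dsup\<close>. It is at most \<open>L * R\<close> and vanishes where \<open>p x\<close>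
  exceeds \<open>b + L * R\<close>, because the inf-convolution then still exceeds
  \<open>b\<close>.\<close>

lemma clamp_integral_limit:
  assumes S: "\<And>s. s \<in> S \<Longrightarrow> norm s \<le> R" "0 \<in> S" and ab: "0 < a" "a < b"
    and e: "\<And>k. 0 < e k" "\<And>k. e k \<le> 1" "e \<longlonglongrightarrow> 0"
  shows "(\<lambda>k. \<integral>\<^sup>+x. ennreal ((clamp_real a b (p x) - clamp_real a b (infconv p ((\<lambda>s. e k *\<^sub>R s) ` S) x)) / e k) \<partial>lborel)
     \<longlonglongrightarrow> (\<integral>\<^sup>+x. ennreal (dsup S x) * indicator {x. a < p x \<and> p x < b} x \<partial>lborel)"
proof -
  define q where "q = (\<lambda>k. infconv p ((\<lambda>s. e k *\<^sub>R s) ` S))"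
  have ne: "(\<lambda>s. e k *\<^sub>R s) ` S \<noteq> {}" for k using S(2) by auto
  have R: "0 \<le> R" using S by force
  have [measurable]: "q k \<in> borel_measurable borel" for k
    unfolding q_def by (rule borel_measurable_infconv[OF ne])
  note [measurable] = borel_measurable_dsup[OF S]
  have q_le: "q k x \<le> p x" for k x unfolding q_def using S(2) by (intro infconv_le_gauge) force
  have q_ge: "p x - L * (e k * R) \<le> q k x" for k x
    unfolding q_def
  proof (rule infconv_ge[OF ne])
    fix s assume "s \<in> (\<lambda>s. e k *\<^sub>R s) ` S"
    then obtain u where u: "u \<in> S" "s = e k *\<^sub>R u" by auto
    have "e k * norm u \<le> e k * R" using S(1)[OF u(1)] e(1)[of k] by (intro mult_left_mono) auto
    then show "norm s \<le> e k * R" using u(2) e(1)[of k] by simp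
  qed
  have qlim: "(\<lambda>k. q k x) \<longlonglongrightarrow> p x" for x
  proof (rule tendsto_sandwich[OF _ _ _ tendsto_const])
    have "(\<lambda>k. p x - L * (e k * R)) \<longlonglongrightarrow> p x - L * (0 * R)" by (intro tendsto_intros e)
    then show "(\<lambda>k. p x - L * (e k * R)) \<longlonglongrightarrow> p x" by simp
  qed (use q_le q_ge in auto)
  have er: "filterlim e (at_right 0) sequentially"
    using e by (auto simp: filterlim_at intro!: always_eventually) (metis less_irrefl)
  let ?f = "\<lambda>k x. (clamp_real a b (p x) - clamp_real a b (q k x)) / e k"
  have lim: "(\<lambda>k. ?f k x) \<longlonglongrightarrow> dsup S x * indicator {x. a < p x \<and> p x < b} x" if x: "p x \<noteq> a" "p x \<noteq> b" for x
  proof -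
    consider "p x < a" | "b < p x" | "a < p x" "p x < b" using x by linarith
    then show ?thesis
    proof cases
      case 1
      then have "?f k x = 0" for k using q_le[of k x] ab by (simp add: clamp_real_def)
      then have "(\<lambda>k. ?f k x) = (\<lambda>k. 0)" by (intro ext)
      then show ?thesis using 1 by (simp only:) simp
    next
      case 2
      have "\<forall>\<^sub>F k in sequentially. b < q k x" using qlim 2 by (rule order_tendstoD)
      then have "\<forall>\<^sub>F k in sequentially. 0 = ?f k x"
        by eventually_elim (use 2 ab in \<open>simp add: clamp_real_def\<close>)
      then have "(\<lambda>k. ?f k x) \<longlonglongrightarrow> 0" by (rule Lim_transform_eventually[OF tendsto_const])
      then show ?thesis using 2 by simp
    next
      case 3
      have "\<forall>\<^sub>F k in sequentially. a < q k x" "\<forall>\<^sub>F k in sequentially. q k x < b"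
        by (rule order_tendstoD(1)[OF qlim 3(1)], rule order_tendstoD(2)[OF qlim 3(2)])
      then have ev: "\<forall>\<^sub>F k in sequentially. (p x - q k x) / e k = ?f k x"
        by eventually_elim (use 3 in \<open>simp add: clamp_real_def\<close>)
      have "(\<lambda>k. (p x - q k x) / e k) \<longlonglongrightarrow> dsup S x"
        unfolding q_def by (rule filterlim_compose[OF infconv_quotient_tendsto_dsup[OF S] er])
      from Lim_transform_eventually[OF this ev] show ?thesis using 3 by simp
    qed
  qed
  let ?w = "\<lambda>x. ennreal (L * R) * indicator {x. p x \<le> b + L * R} x"
  have bound: "ennreal (?f k x) \<le> ?w x" for k x
  proof (cases "p x \<le> b + L * R")
    case True
    have "clamp_real a b (p x) - clamp_real a b (q k x) \<le> e k * (L * R)"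
      using clamp_real_diff_le[OF q_le[of k x], of a b] q_ge[of x k] by (simp add: algebra_simps)
    then have "?f k x \<le> L * R" using e(1)[of k] by (simp add: pos_divide_le_eq mult.commute)
    then show ?thesis using True by (simp add: ennreal_leI)
  next
    case False
    have "e k * R \<le> 1 * R" using e(2) R by (intro mult_right_mono)
    then have "L * (e k * R) \<le> L * R" using L_pos by simp
    then have "b < q k x" using q_ge[of x k] False by simp
    then show ?thesis using False q_le[of k x] by (simp add: clamp_real_def)
  qed
  have fin: "(\<integral>\<^sup>+x. ?w x \<partial>lborel) < \<infinity>"
    using emeasure_lborel_compact_finite[OF compact_gauge_le[of "b + L * R"]]
    by (subst nn_integral_cmult_indicator) (auto simp: ennreal_mult_less_top)
  have "AE x in lborel. p x \<noteq> a \<and> p x \<noteq> b"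
    using AE_not_in[OF null_sets_gauge_eq[OF ab(1)]] AE_not_in[OF null_sets_gauge_eq[of b]] ab by auto
  then have "AE x in lborel. (\<lambda>k. ennreal (?f k x)) \<longlonglongrightarrow> ennreal (dsup S x) * indicator {x. a < p x \<and> p x < b} x"
  proof (rule AE_mp, intro AE_I2 impI)
    fix x assume "p x \<noteq> a \<and> p x \<noteq> b"
    then have "(\<lambda>k. ennreal (?f k x)) \<longlonglongrightarrow> ennreal (dsup S x * indicator {x. a < p x \<and> p x < b} x)"
      by (intro tendsto_ennrealI lim) auto
    then show "(\<lambda>k. ennreal (?f k x)) \<longlonglongrightarrow> ennreal (dsup S x) * indicator {x. a < p x \<and> p x < b} x"
      by (cases "a < p x \<and> p x < b") auto
  qed
  then have "(\<lambda>k. \<integral>\<^sup>+x. ennreal (?f k x) \<partial>lborel)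
      \<longlonglongrightarrow> (\<integral>\<^sup>+x. ennreal (dsup S x) * indicator {x. a < p x \<and> p x < b} x \<partial>lborel)"
    using bound fin by (intro nn_integral_dominated_convergence[where w = ?w]) auto
  then show ?thesis unfolding q_def .
qed

end

section \<open>Volume of thin shells around convex bodies\<close>

text \<open>Let \<open>D\<close> be what \<open>C\<close> newly sweeps when moved along
  \<open>v / k\<close>. By convexity the \<open>k\<close> translates of \<open>D\<close> by
  multiples of \<open>v / k\<close> are disjoint, and all lie in the region swept along
  \<open>v\<close>.\<close>

lemma translates_disjoint_bound:
  fixes C :: "'a::euclidean_space set"
  assumes C: "compact C" "convex C" and k: "0 < (k::nat)"
  shows "real k * (measure lborel (minkowski C (closed_segment 0 ((1 / real k) *\<^sub>R v))) - measure lborel C)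
          \<le> measure lborel (minkowski C (closed_segment 0 v))"
proof -
  define e where "e = (1 / real k) *\<^sub>R v"
  define D where "D = minkowski C (closed_segment 0 e) - C"
  have seg: "closed_segment 0 w = {s *\<^sub>R w | s. 0 \<le> s \<and> s \<le> 1}" for w :: 'a
    by (auto simp: closed_segment_def)
  have cpt: "compact (minkowski C (closed_segment 0 w))" for w
    by (intro compact_minkowski C compact_segment)
  have Db: "D \<in> sets borel" unfolding D_def using cpt C by (auto intro: borel_compact)
  have CC: "C \<subseteq> minkowski C (closed_segment 0 e)" by (force simp: minkowski_def)
  have Dm: "measure lborel D = measure lborel (minkowski C (closed_segment 0 e)) - measure lborel C"
    unfolding D_def using cpt C CC emeasure_lborel_compact_finite[OF cpt[of e]]
    by (intro measure_Diff) (auto simp: borel_compact less_top)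
  have shift_b: "(\<lambda>x. a + x) ` D \<in> sets borel" for a
  proof -
    have "(\<lambda>x. a + x) ` D = (\<lambda>x. a + x) ` minkowski C (closed_segment 0 e) - (\<lambda>x. a + x) ` C"
      unfolding D_def by (intro image_set_diff) auto
    moreover have "(\<lambda>x. a + x) ` minkowski C (closed_segment 0 e) \<in> sets borel" "(\<lambda>x. a + x) ` C \<in> sets borel"
      by (intro borel_compact compact_translation cpt C)+
    ultimately show ?thesis by simp
  qed
  have disj: "(\<lambda>x. real i *\<^sub>R e + x) ` D \<inter> (\<lambda>x. real j *\<^sub>R e + x) ` D = {}" if ij: "i < j" for i j :: nat
  proof (rule ccontr)
    assume "\<not> ?thesis"
    then obtain x y where xy: "x \<in> D" "y \<in> D" "real i *\<^sub>R e + x = real j *\<^sub>R e + y" by blast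
    obtain c s where c: "c \<in> C" "x = c + s *\<^sub>R e" "0 \<le> s" "s \<le> 1"
      using xy(1) unfolding D_def minkowski_def seg by auto
    obtain d t where d: "d \<in> C" "y = d + t *\<^sub>R e" "0 \<le> t" "t \<le> 1"
      using xy(2) unfolding D_def minkowski_def seg by auto
    \<comment> \<open>Nonnegative because \<open>i < j\<close> are integers and
      \<open>s \<le> 1\<close>. Then \<open>c\<close> lies ahead of \<open>y\<close> and
      \<open>d\<close> behind it on one line, so \<open>y\<close> is between two points of
      \<open>C\<close>, contrary to \<open>y \<in> D\<close>.\<close>
    define u where "u = real j - real i - s"
    have u: "0 \<le> u" using ij c(4) by (simp add: u_def)
    have cy: "c = y + u *\<^sub>R e" using xy(3) c(2) by (simp add: u_def algebra_simps)
    have "y \<in> C"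
    proof (cases "u + t = 0")
      case True
      then have "t = 0" using u d by simp
      then show ?thesis using d by simp
    next
      case False
      then have ut: "0 < u + t" using u d by simp
      have "(u / (u + t)) *\<^sub>R d + (t / (u + t)) *\<^sub>R c \<in> C"
        using ut u d c by (intro convexD[OF C(2)]) (auto simp: add_divide_distrib[symmetric])
      moreover have "(u / (u + t)) *\<^sub>R d + (t / (u + t)) *\<^sub>R c = (u / (u + t) + t / (u + t)) *\<^sub>R y"
        using d(2) cy by (simp add: algebra_simps)
      moreover have "u / (u + t) + t / (u + t) = 1" using ut by (simp add: add_divide_distrib[symmetric])
      ultimately show ?thesis by simp
    qed
    then show False using xy(2) by (simp add: D_def)
  qed
  then have "disjoint_family_on (\<lambda>i. (\<lambda>x. real i *\<^sub>R e + x) ` D) {..<k}"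
    unfolding disjoint_family_on_def by (metis inf_commute linorder_neqE_nat)
  moreover have D_sub: "(\<lambda>x. real i *\<^sub>R e + x) ` D \<subseteq> minkowski C (closed_segment 0 v)" if "i < k" for i
  proof
    fix z assume "z \<in> (\<lambda>x. real i *\<^sub>R e + x) ` D"
    then obtain c s where c: "c \<in> C" "z = real i *\<^sub>R e + (c + s *\<^sub>R e)" "0 \<le> s" "s \<le> 1"
      unfolding D_def minkowski_def seg by auto
    have "z = c + ((real i + s) / real k) *\<^sub>R v" using c(2) by (simp add: e_def add_divide_distrib algebra_simps)
    moreover have "0 \<le> (real i + s) / real k" "(real i + s) / real k \<le> 1"
      using c that by (auto simp: divide_le_eq)
    ultimately show "z \<in> minkowski C (closed_segment 0 v)" using c(1) unfolding minkowski_def seg by blast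
  qed
  ultimately have "measure lborel (\<Union>i\<in>{..<k}. (\<lambda>x. real i *\<^sub>R e + x) ` D) = (\<Sum>i\<in>{..<k}. measure lborel ((\<lambda>x. real i *\<^sub>R e + x) ` D))"
  proof (intro measure_finite_Union)
    fix i assume "i \<in> {..<k}"
    then have "emeasure lborel ((\<lambda>x. real i *\<^sub>R e + x) ` D) \<le> emeasure lborel (minkowski C (closed_segment 0 v))"
      using D_sub cpt by (intro emeasure_mono) (auto intro: borel_compact)
    then show "emeasure lborel ((\<lambda>x. real i *\<^sub>R e + x) ` D) \<noteq> \<infinity>"
      using emeasure_lborel_compact_finite[OF cpt[of v]] by (auto simp: top_unique)
  qed (use shift_b in auto)
  also have "\<dots> = real k * measure lborel D" by (simp add: measure_lborel_translation Db)
  finally have "real k * measure lborel D = measure lborel (\<Union>i\<in>{..<k}. (\<lambda>x. real i *\<^sub>R e + x) ` D)" by simp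
  also have "\<dots> \<le> measure lborel (minkowski C (closed_segment 0 v))"
    using D_sub shift_b cpt emeasure_lborel_compact_finite[OF cpt[of v]]
    by (intro measure_mono_fmeasurable) (auto simp: fmeasurable_def borel_compact)
  finally show ?thesis by (simp add: Dm e_def)
qed

text \<open>Taking \<open>k\<close> as the integer part of \<open>1 / e\<close> gives
  \<open>e \<le> 1 / k \<le> 2 * e\<close>: the first inequality enlarges the segment to one of
  length a \<open>k\<close>-th part, the second produces the factor 2.\<close>

lemma segment_shell_bound:
  fixes C :: "'a::euclidean_space set"
  assumes C: "compact C" "convex C" and e: "0 < e" "e \<le> 1"
  shows "measure lborel (minkowski C (closed_segment 0 (e *\<^sub>R v))) - measure lborel C
          \<le> 2 * e * measure lborel (minkowski C (closed_segment 0 v))"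
proof -
  define k where "k = nat \<lfloor>1 / e\<rfloor>"
  have k1: "1 \<le> 1 / e" using e by simp
  then have k: "0 < k" "real k \<le> 1 / e" "1 / e < real k + 1"
    unfolding k_def by (simp_all, linarith+)
  have "1 / e < 2 * real k" using k by linarith
  then have ke: "e \<le> 1 / real k" "1 / real k \<le> 2 * e" using k e by (auto simp: field_simps)
  have "closed_segment 0 (e *\<^sub>R v) \<subseteq> closed_segment 0 ((1 / real k) *\<^sub>R v)"
  proof
    fix z assume "z \<in> closed_segment 0 (e *\<^sub>R v)"
    then obtain s where s: "0 \<le> s" "s \<le> 1" "z = (s * e) *\<^sub>R v" by (auto simp: closed_segment_def)
    have "s * e * real k \<le> 1" using s ke(1) k e mult_mono[of s 1 "e * real k" 1] by (simp add: field_simps)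
    then show "z \<in> closed_segment 0 ((1 / real k) *\<^sub>R v)"
      using s e k by (auto simp: closed_segment_def intro!: exI[of _ "s * e * real k"])
  qed
  then have "measure lborel (minkowski C (closed_segment 0 (e *\<^sub>R v))) - measure lborel C
      \<le> measure lborel (minkowski C (closed_segment 0 ((1 / real k) *\<^sub>R v))) - measure lborel C"
    by (intro diff_right_mono measure_lborel_mono_compact minkowski_mono compact_minkowski C compact_segment) auto
  also have "\<dots> \<le> (1 / real k) * measure lborel (minkowski C (closed_segment 0 v))"
    using translates_disjoint_bound[OF C k(1), of v] k by (simp add: field_simps)
  also have "\<dots> \<le> 2 * e * measure lborel (minkowski C (closed_segment 0 v))"
    using ke by (intro mult_right_mono) auto
  finally show ?thesis .
qed

lemma minkowski_cbox_segment:
  fixes u :: "'a::euclidean_space"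
  assumes b: "b \<in> Basis" and u: "u \<bullet> b = 0" "\<And>i. i \<in> Basis \<Longrightarrow> 0 \<le> u \<bullet> i" and r: "0 \<le> r"
  shows "minkowski (cbox 0 u) (closed_segment 0 (r *\<^sub>R b)) = cbox 0 (u + r *\<^sub>R b)"
proof (intro equalityI subsetI)
  fix z assume "z \<in> minkowski (cbox 0 u) (closed_segment 0 (r *\<^sub>R b))"
  then obtain y s where *: "y \<in> cbox 0 u" "0 \<le> s" "s \<le> 1" "z = y + (s * r) *\<^sub>R b"
    by (auto simp: minkowski_def closed_segment_def)
  have "s * r \<le> r" using * r by (simp add: mult_left_le_one_le)
  then show "z \<in> cbox 0 (u + r *\<^sub>R b)"
    using * r b by (auto simp: mem_box inner_add_left inner_Basis)
next
  fix z assume z: "z \<in> cbox 0 (u + r *\<^sub>R b)"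
  define y where "y = z - (z \<bullet> b) *\<^sub>R b"
  have zb: "0 \<le> z \<bullet> b" "z \<bullet> b \<le> r" using z b u by (auto simp: mem_box inner_add_left)
  have "y \<in> cbox 0 u"
    using z b u by (auto simp: mem_box y_def inner_diff_left inner_add_left inner_Basis split: if_splits)
  moreover have "(z \<bullet> b) *\<^sub>R b \<in> closed_segment 0 (r *\<^sub>R b)"
  proof (cases "r = 0")
    case False
    then show ?thesis using zb r by (auto simp: closed_segment_def intro!: exI[of _ "z \<bullet> b / r"])
  qed (use zb in simp)
  moreover have "z = y + (z \<bullet> b) *\<^sub>R b" by (simp add: y_def)
  ultimately show "z \<in> minkowski (cbox 0 u) (closed_segment 0 (r *\<^sub>R b))" unfolding minkowski_def by blast
qed

lemma minkowski_translation:
  fixes a :: "'a::ab_group_add"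
  shows "minkowski C ((\<lambda>x. a + x) ` D) = (\<lambda>x. a + x) ` minkowski C D"
proof (intro equalityI subsetI)
  fix z assume "z \<in> minkowski C ((\<lambda>x. a + x) ` D)"
  then obtain c d where "c \<in> C" "d \<in> D" "z = a + (c + d)"
    by (auto simp: minkowski_def add.left_commute)
  then show "z \<in> (\<lambda>x. a + x) ` minkowski C D" unfolding minkowski_def by blast
next
  fix z assume "z \<in> (\<lambda>x. a + x) ` minkowski C D"
  then obtain c d where "c \<in> C" "d \<in> D" "z = c + (a + d)"
    by (auto simp: minkowski_def add.left_commute)
  then show "z \<in> minkowski C ((\<lambda>x. a + x) ` D)" unfolding minkowski_def by blast
qed

lemma minkowski_assoc:
  "minkowski (minkowski A B) C = minkowski A (minkowski B C)"
  unfolding minkowski_def by (auto; metis add.assoc)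

text \<open>A box is a Minkowski sum of segments. They are added one direction at a time, each at a
  cost of at most \<open>2 * e\<close> times the volume of the sum with the full box. A translation
  first moves one corner of the box to 0.\<close>

lemma box_shell_bound:
  fixes C :: "'a::euclidean_space set"
  assumes C: "compact C" "convex C" and e: "0 < e" "e \<le> 1" and R: "\<And>i. i \<in> Basis \<Longrightarrow> 0 \<le> R \<bullet> i"
  shows "measure lborel (minkowski C (cbox (- e *\<^sub>R R) (e *\<^sub>R R))) - measure lborel C
          \<le> 2 * e * DIM('a) * measure lborel (minkowski C (cbox (- R) R))"
proof -
  define u where "u = (\<lambda>J. \<Sum>b\<in>J. (2 * (R \<bullet> b)) *\<^sub>R (b::'a))"
  have ub: "u J \<bullet> i = (if i \<in> J then 2 * (R \<bullet> i) else 0)" if "J \<subseteq> Basis" "i \<in> Basis" for J i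
  proof -
    have fin: "finite J" using that finite_Basis finite_subset by blast
    have "u J \<bullet> i = (\<Sum>b\<in>J. if b = i then 2 * (R \<bullet> b) else 0)"
      unfolding u_def inner_sum_left using that by (intro sum.cong) (auto simp: inner_Basis)
    then show ?thesis using fin by simp
  qed
  have cpt: "compact (minkowski C (cbox 0 w))" "convex (minkowski C (cbox 0 w))" for w
    by (intro compact_minkowski convex_minkowski C compact_cbox convex_box)+
  have "measure lborel (minkowski C (cbox 0 (e *\<^sub>R u J))) - measure lborel C
      \<le> 2 * e * real (card J) * measure lborel (minkowski C (cbox 0 (u J)))" if "J \<subseteq> Basis" for J
    using finite_subset[OF that finite_Basis] that
  proof (induction J rule: finite_induct)
    case empty
    have "minkowski C {0} = C" by (simp add: minkowski_def)
    then show ?case by (simp add: u_def)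
  next
    case (insert b J)
    then have J: "J \<subseteq> Basis" and b: "b \<in> Basis" by auto
    have uJ: "u (insert b J) = u J + (2 * (R \<bullet> b)) *\<^sub>R b"
      using insert by (simp add: u_def add.commute)
    have nn: "0 \<le> u J \<bullet> i" if "i \<in> Basis" for i using ub[OF J that] R[OF that] by auto
    have box: "minkowski C (cbox 0 (r *\<^sub>R u (insert b J)))
        = minkowski (minkowski C (cbox 0 (r *\<^sub>R u J))) (closed_segment 0 (r *\<^sub>R (2 * (R \<bullet> b)) *\<^sub>R b))" if "0 < r" for r
    proof -
      have "minkowski (cbox 0 (r *\<^sub>R u J)) (closed_segment 0 ((r * (2 * (R \<bullet> b))) *\<^sub>R b))
          = cbox 0 (r *\<^sub>R u J + (r * (2 * (R \<bullet> b))) *\<^sub>R b)"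
        by (rule minkowski_cbox_segment) (use b ub[OF J b] insert(2) nn R[OF b] that in auto)
      then show ?thesis unfolding minkowski_assoc uJ scaleR_add_right by simp
    qed
    let ?P = "minkowski C (cbox 0 (e *\<^sub>R u J))"
    have "measure lborel (minkowski C (cbox 0 (e *\<^sub>R u (insert b J)))) - measure lborel ?P
        \<le> 2 * e * measure lborel (minkowski ?P (closed_segment 0 ((2 * (R \<bullet> b)) *\<^sub>R b)))"
      unfolding box[OF e(1)] by (rule segment_shell_bound[OF cpt e])
    also have "\<dots> \<le> 2 * e * measure lborel (minkowski C (cbox 0 (u (insert b J))))"
    proof -
      have "cbox 0 (e *\<^sub>R u J) \<subseteq> cbox 0 (u J)"
        using order_trans[OF _ mult_left_le_one_le[OF nn less_imp_le[OF e(1)] e(2)]]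
        by (auto simp: mem_box)
      then have "minkowski ?P (closed_segment 0 ((2 * (R \<bullet> b)) *\<^sub>R b)) \<subseteq> minkowski C (cbox 0 (u (insert b J)))"
        using box[of 1] by (simp add: minkowski_mono)
      then show ?thesis using e
        by (intro mult_left_mono measure_lborel_mono_compact cpt compact_minkowski compact_segment) auto
    qed
    finally have 1: "measure lborel (minkowski C (cbox 0 (e *\<^sub>R u (insert b J)))) - measure lborel ?P
        \<le> 2 * e * measure lborel (minkowski C (cbox 0 (u (insert b J))))" .
    have "cbox 0 (u J) \<subseteq> cbox 0 (u (insert b J))"
    proof
      fix x assume x: "x \<in> cbox 0 (u J)"
      have "u J \<bullet> i \<le> u (insert b J) \<bullet> i" if "i \<in> Basis" for i
        using R[OF b] b that unfolding uJ by (simp add: inner_add_left inner_Basis)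
      then show "x \<in> cbox 0 (u (insert b J))" using x by (force simp: mem_box)
    qed
    then have "measure lborel (minkowski C (cbox 0 (u J))) \<le> measure lborel (minkowski C (cbox 0 (u (insert b J))))"
      by (intro measure_lborel_mono_compact cpt minkowski_mono) auto
    then have "2 * e * real (card J) * measure lborel (minkowski C (cbox 0 (u J)))
        \<le> 2 * e * real (card J) * measure lborel (minkowski C (cbox 0 (u (insert b J))))"
      using e by (intro mult_left_mono) auto
    with 1 insert.IH[OF J] show ?case using insert(1,2) by (simp add: algebra_simps)
  qed
  from this[of Basis] have main: "measure lborel (minkowski C (cbox 0 (e *\<^sub>R u Basis))) - measure lborel C
      \<le> 2 * e * DIM('a) * measure lborel (minkowski C (cbox 0 (u Basis)))" by simp
  have uB: "u Basis = 2 *\<^sub>R R"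
    by (rule euclidean_eqI) (simp add: ub)
  have shift: "minkowski C (cbox (- r *\<^sub>R R) (r *\<^sub>R R)) = (\<lambda>x. - r *\<^sub>R R + x) ` minkowski C (cbox 0 (r *\<^sub>R u Basis))" for r
  proof -
    have "cbox (- r *\<^sub>R R) (r *\<^sub>R R) = (\<lambda>x. - r *\<^sub>R R + x) ` cbox 0 (r *\<^sub>R u Basis)"
      unfolding uB cbox_translation[symmetric] by (simp add: scaleR_2 scaleR_add_right)
    then show ?thesis by (simp only: minkowski_translation)
  qed
  have meas: "measure lborel (minkowski C (cbox (- r *\<^sub>R R) (r *\<^sub>R R))) = measure lborel (minkowski C (cbox 0 (r *\<^sub>R u Basis)))" for r
    unfolding shift by (intro measure_lborel_translation borel_compact cpt)
  show ?thesis using main meas[of e] meas[of 1] by simp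
qed

section \<open>Averages over a window of levels\<close>

text \<open>Layer-cake formula: the truncated difference at \<open>z\<close> is the length of the
  set of levels in the window with \<open>f z < r \<le> g z\<close>, and Fubini exchanges level and
  point. The general measure \<open>N\<close> allows both Lebesgue measure and its product with the
  probability space.\<close>

lemma nn_integral_clamp_layers:
  fixes f g :: "'b \<Rightarrow> real"
  assumes N: "sigma_finite_measure N" and [measurable]: "f \<in> borel_measurable N" "g \<in> borel_measurable N"
    and le: "\<And>z. f z \<le> g z" and ab: "a \<le> b"
  shows "(\<integral>\<^sup>+z. ennreal (clamp_real a b (g z) - clamp_real a b (f z)) \<partial>N)
       = (\<integral>\<^sup>+r. emeasure N {z \<in> space N. f z < r \<and> r \<le> g z} * indicator {a..b} r \<partial>lborel)"
proof -
  interpret N: sigma_finite_measure N by fact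
  interpret pair_sigma_finite N lborel
    by unfold_locales
  have pt: "ennreal (clamp_real a b (g z) - clamp_real a b (f z))
      = (\<integral>\<^sup>+r. indicator {r. f z < r \<and> r \<le> g z} r * indicator {a..b} r \<partial>lborel)" for z
  proof -
    let ?S = "{r. f z < r \<and> r \<le> g z} \<inter> {a..b}"
    let ?u = "clamp_real a b (f z)" and ?v = "clamp_real a b (g z)"
    have uv: "?u \<le> ?v" by (rule clamp_real_mono[OF le])
    have "emeasure lborel ?S \<le> emeasure lborel {?u..?v}"
      by (intro emeasure_mono) (auto simp: clamp_real_def)
    moreover have "emeasure lborel {?u<..<?v} \<le> emeasure lborel ?S"
      using ab by (intro emeasure_mono) (auto simp: clamp_real_def split: if_splits)
    ultimately have "emeasure lborel ?S = ennreal (?v - ?u)" using uv by simp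
    moreover have "?S \<in> sets lborel" by measurable
    then have "(\<integral>\<^sup>+r. indicator {r. f z < r \<and> r \<le> g z} r * indicator {a..b} r \<partial>lborel) = emeasure lborel ?S"
      unfolding indicator_inter_arith[symmetric] by (rule nn_integral_indicator)
    ultimately show ?thesis by simp
  qed
  have "(\<integral>\<^sup>+z. ennreal (clamp_real a b (g z) - clamp_real a b (f z)) \<partial>N)
      = (\<integral>\<^sup>+z. \<integral>\<^sup>+r. indicator {r. f z < r \<and> r \<le> g z} r * indicator {a..b} r \<partial>lborel \<partial>N)"
    by (simp only: pt)
  also have "\<dots> = (\<integral>\<^sup>+r. \<integral>\<^sup>+z. indicator {r. f z < r \<and> r \<le> g z} r * indicator {a..b} r \<partial>N \<partial>lborel)"
    by (rule Fubini'[symmetric]) measurable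
  also have "\<dots> = (\<integral>\<^sup>+r. emeasure N {z \<in> space N. f z < r \<and> r \<le> g z} * indicator {a..b} r \<partial>lborel)"
  proof (intro nn_integral_cong)
    fix r :: real
    have "(\<integral>\<^sup>+z. indicator {r. f z < r \<and> r \<le> g z} r * indicator {a..b} r \<partial>N)
        = (\<integral>\<^sup>+z. indicator {z \<in> space N. f z < r \<and> r \<le> g z} z * indicator {a..b} r \<partial>N)"
      by (intro nn_integral_cong) (auto simp: indicator_def)
    also have "\<dots> = emeasure N {z \<in> space N. f z < r \<and> r \<le> g z} * indicator {a..b} r"
      by (subst nn_integral_multc) auto
    finally show "(\<integral>\<^sup>+z. indicator {r. f z < r \<and> r \<le> g z} r * indicator {a..b} r \<partial>N)
        = emeasure N {z \<in> space N. f z < r \<and> r \<le> g z} * indicator {a..b} r" .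
  qed
  finally show ?thesis .
qed

lemma nn_integral_clamp_layers_divide:
  fixes f g :: "'b \<Rightarrow> real"
  assumes N: "sigma_finite_measure N" and [measurable]: "f \<in> borel_measurable N" "g \<in> borel_measurable N"
    and le: "\<And>z. f z \<le> g z" and ab: "a \<le> b" and e: "0 < e"
  shows "(\<integral>\<^sup>+z. ennreal ((clamp_real a b (g z) - clamp_real a b (f z)) / e) \<partial>N)
       = ennreal (1 / e) * (\<integral>\<^sup>+r. emeasure N {z \<in> space N. f z < r \<and> r \<le> g z} * indicator {a..b} r \<partial>lborel)"
proof -
  have "(\<integral>\<^sup>+z. ennreal ((clamp_real a b (g z) - clamp_real a b (f z)) / e) \<partial>N)
      = (\<integral>\<^sup>+z. ennreal (1 / e) * ennreal (clamp_real a b (g z) - clamp_real a b (f z)) \<partial>N)"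
    using e clamp_real_mono[OF le, of a b] by (intro nn_integral_cong) (simp flip: ennreal_mult)
  also have "\<dots> = ennreal (1 / e) * (\<integral>\<^sup>+z. ennreal (clamp_real a b (g z) - clamp_real a b (f z)) \<partial>N)"
    by (intro nn_integral_cmult) measurable
  finally show ?thesis using nn_integral_clamp_layers[OF N assms(2,3) le ab] by simp
qed

text \<open>\<open>F e\<close> stands for a shell volume at level 1 and \<open>G r\<close> for the
  one at level \<open>r\<close>, related by homogeneity. Over the window, \<open>e / r\<close> stays
  between \<open>e / (1 + \<delta>)\<close> and \<open>e\<close>, and \<open>r ^ n\<close> between 1
  and \<open>(1 + \<delta>) ^ n\<close>.\<close>

lemma window_average_bounds:
  fixes F G :: "real \<Rightarrow> ennreal"
  assumes G: "\<And>r. 1 \<le> r \<Longrightarrow> r \<le> 1 + \<delta> \<Longrightarrow> G r = ennreal (r ^ n) * F (e / r)"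
    and mono: "\<And>x y. 0 < x \<Longrightarrow> x \<le> y \<Longrightarrow> F x \<le> F y" and \<delta>: "0 < \<delta>" and e: "0 < e"
  shows "ennreal \<delta> * F (e / (1 + \<delta>)) \<le> (\<integral>\<^sup>+r. G r * indicator {1..1 + \<delta>} r \<partial>lborel)"
    and "(\<integral>\<^sup>+r. G r * indicator {1..1 + \<delta>} r \<partial>lborel) \<le> ennreal (\<delta> * (1 + \<delta>) ^ n) * F e"
proof -
  have const: "(\<integral>\<^sup>+r. c * indicator {1..1 + \<delta>} r \<partial>lborel) = c * ennreal \<delta>" for c
    using \<delta> by (subst nn_integral_cmult_indicator) auto
  have "F (e / (1 + \<delta>)) * indicator {1..1 + \<delta>} r \<le> G r * indicator {1..1 + \<delta>} r" for r
  proof (cases "r \<in> {1..1 + \<delta>}")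
    case True
    have "F (e / (1 + \<delta>)) \<le> F (e / r)" using True \<delta> e by (intro mono) (auto intro: divide_left_mono)
    moreover have "1 \<le> ennreal (r ^ n)" using True by simp
    ultimately have "1 * F (e / (1 + \<delta>)) \<le> ennreal (r ^ n) * F (e / r)" by (intro mult_mono) auto
    then show ?thesis using True G by simp
  qed simp
  then have "(\<integral>\<^sup>+r. F (e / (1 + \<delta>)) * indicator {1..1 + \<delta>} r \<partial>lborel) \<le> (\<integral>\<^sup>+r. G r * indicator {1..1 + \<delta>} r \<partial>lborel)"
    by (intro nn_integral_mono) auto
  then show "ennreal \<delta> * F (e / (1 + \<delta>)) \<le> (\<integral>\<^sup>+r. G r * indicator {1..1 + \<delta>} r \<partial>lborel)"
    by (simp add: const mult.commute)
  have "G r * indicator {1..1 + \<delta>} r \<le> (ennreal ((1 + \<delta>) ^ n) * F e) * indicator {1..1 + \<delta>} r" for r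
  proof (cases "r \<in> {1..1 + \<delta>}")
    case True
    have "e * 1 \<le> e * r" using True e by (intro mult_left_mono) auto
    then have "F (e / r) \<le> F e" using True e by (intro mono) (auto simp: divide_le_eq)
    moreover have "ennreal (r ^ n) \<le> ennreal ((1 + \<delta>) ^ n)" using True by (intro ennreal_leI power_mono) auto
    ultimately have "ennreal (r ^ n) * F (e / r) \<le> ennreal ((1 + \<delta>) ^ n) * F e" by (intro mult_mono) auto
    then show ?thesis using True G by simp
  qed simp
  then have "(\<integral>\<^sup>+r. G r * indicator {1..1 + \<delta>} r \<partial>lborel) \<le> (\<integral>\<^sup>+r. (ennreal ((1 + \<delta>) ^ n) * F e) * indicator {1..1 + \<delta>} r \<partial>lborel)"
    by (intro nn_integral_mono) auto
  also have "\<dots> = ennreal (\<delta> * (1 + \<delta>) ^ n) * F e"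
    unfolding const using \<delta> by (simp add: ennreal_mult mult_ac)
  finally show "(\<integral>\<^sup>+r. G r * indicator {1..1 + \<delta>} r \<partial>lborel) \<le> ennreal (\<delta> * (1 + \<delta>) ^ n) * F e" .
qed

text \<open>A Tauberian step: the averages \<open>A\<close> have known slopes \<open>Q\<close>, and
  the sandwich that monotonicity leaves between \<open>F\<close> and \<open>A\<close> loses only
  powers of \<open>1 + \<delta>\<close>. For each target \<open>y\<close> a small window is fixed
  first, and then \<open>e\<close> tends to 0.\<close>

lemma slope_limit_of_window_averages:
  fixes F :: "real \<Rightarrow> real" and A :: "real \<Rightarrow> real \<Rightarrow> real"
  assumes low: "\<And>\<delta> e. 0 < \<delta> \<Longrightarrow> 0 < e \<Longrightarrow> e \<le> 1 \<Longrightarrow> \<delta> * F (e / (1 + \<delta>)) \<le> A \<delta> e"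
    and up: "\<And>\<delta> e. 0 < \<delta> \<Longrightarrow> 0 < e \<Longrightarrow> e \<le> 1 \<Longrightarrow> A \<delta> e \<le> \<delta> * (1 + \<delta>) ^ n * F e"
    and lim: "\<And>\<delta>. 0 < \<delta> \<Longrightarrow> ((\<lambda>e. A \<delta> e / e) \<longlongrightarrow> Q \<delta>) (at_right 0)"
    and Q: "\<And>\<delta>. 0 < \<delta> \<Longrightarrow> \<delta> * c / (1 + \<delta>) \<le> Q \<delta>" "\<And>\<delta>. 0 < \<delta> \<Longrightarrow> Q \<delta> \<le> \<delta> * (1 + \<delta>) ^ n * c"
  shows "((\<lambda>e. F e / e) \<longlongrightarrow> c) (at_right 0)"
proof (rule order_tendstoI)
  fix y assume y: "y < c"
  have "((\<lambda>\<delta>. c / ((1 + \<delta>) ^ n * (1 + \<delta>))) \<longlongrightarrow> c / ((1 + 0) ^ n * (1 + 0))) (at_right (0::real))"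
    by (intro tendsto_intros) auto
  then have "\<forall>\<^sub>F \<delta> in at_right 0. y < c / ((1 + \<delta>) ^ n * (1 + \<delta>))" using y by (auto dest: order_tendstoD)
  then have "\<forall>\<^sub>F \<delta> in at_right 0. 0 < \<delta> \<and> y < c / ((1 + \<delta>) ^ n * (1 + \<delta>))"
    by (simp add: eventually_conj_iff eventually_at_filter)
  then obtain \<delta> where \<delta>: "0 < \<delta>" "y < c / ((1 + \<delta>) ^ n * (1 + \<delta>))"
    using eventually_happens trivial_limit_at_right_real by blast
  define w where "w = \<delta> * (1 + \<delta>) ^ n"
  have w: "0 < w" using \<delta> by (simp add: w_def)
  have "(\<delta> * c / (1 + \<delta>)) / w = c / ((1 + \<delta>) ^ n * (1 + \<delta>))" using \<delta> by (simp add: w_def)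
  then have "y < (\<delta> * c / (1 + \<delta>)) / w" using \<delta>(2) by (simp only:)
  also have "\<dots> \<le> Q \<delta> / w" using Q(1)[OF \<delta>(1)] w by (intro divide_right_mono) auto
  finally have yQ: "y < Q \<delta> / w" .
  have "((\<lambda>e. (A \<delta> e / e) / w) \<longlongrightarrow> Q \<delta> / w) (at_right 0)"
    using w by (intro tendsto_divide lim \<delta> tendsto_const) simp
  then have "\<forall>\<^sub>F e in at_right 0. y < (A \<delta> e / e) / w" using yQ by (rule order_tendstoD)
  moreover have "\<forall>\<^sub>F e in at_right (0::real). 0 < e \<and> e \<le> 1"
    by (auto simp: eventually_at_right_field intro!: exI[of _ 1])
  ultimately show "\<forall>\<^sub>F e in at_right 0. y < F e / e"
  proof eventually_elim
    case (elim e)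
    have "(A \<delta> e / e) / w \<le> F e / e"
      using up[OF \<delta>(1), of e] elim w by (simp add: w_def field_simps)
    then show ?case using elim by simp
  qed
next
  fix y assume y: "c < y"
  have "((\<lambda>\<delta>. c * ((1 + \<delta>) ^ n * (1 + \<delta>))) \<longlongrightarrow> c * ((1 + 0) ^ n * (1 + 0))) (at_right (0::real))"
    by (intro tendsto_intros)
  then have "\<forall>\<^sub>F \<delta> in at_right 0. c * ((1 + \<delta>) ^ n * (1 + \<delta>)) < y" using y by (auto dest: order_tendstoD)
  then have "\<forall>\<^sub>F \<delta> in at_right 0. 0 < \<delta> \<and> c * ((1 + \<delta>) ^ n * (1 + \<delta>)) < y"
    by (simp add: eventually_conj_iff eventually_at_filter)
  then obtain \<delta> where \<delta>: "0 < \<delta>" "c * ((1 + \<delta>) ^ n * (1 + \<delta>)) < y"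
    using eventually_happens trivial_limit_at_right_real by blast
  \<comment> \<open>The lower sandwich bounds \<open>F (e / (1 + \<delta>))\<close>; used at
    \<open>(1 + \<delta>) * e\<close> it bounds \<open>F e\<close> from above.\<close>
  have sc: "filterlim (\<lambda>e::real. (1 + \<delta>) * e) (at_right 0) (at_right 0)"
    using \<delta> by (auto simp: filterlim_at eventually_at_filter add_pos_pos intro!: tendsto_eq_intros)
  have "Q \<delta> * ((1 + \<delta>) / \<delta>) \<le> \<delta> * (1 + \<delta>) ^ n * c * ((1 + \<delta>) / \<delta>)"
    using Q(2)[OF \<delta>(1)] \<delta> by (intro mult_right_mono) auto
  also have "\<dots> = c * ((1 + \<delta>) ^ n * (1 + \<delta>))" using \<delta>(1) by simp
  also have "\<dots> < y" by (rule \<delta>(2))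
  finally have yQ: "Q \<delta> * ((1 + \<delta>) / \<delta>) < y" .
  have "((\<lambda>e. A \<delta> ((1 + \<delta>) * e) / ((1 + \<delta>) * e) * ((1 + \<delta>) / \<delta>)) \<longlongrightarrow> Q \<delta> * ((1 + \<delta>) / \<delta>)) (at_right 0)"
    by (intro tendsto_mult tendsto_const filterlim_compose[OF lim[OF \<delta>(1)] sc])
  then have "\<forall>\<^sub>F e in at_right 0. A \<delta> ((1 + \<delta>) * e) / ((1 + \<delta>) * e) * ((1 + \<delta>) / \<delta>) < y" using yQ by (rule order_tendstoD)
  moreover have "\<forall>\<^sub>F e in at_right (0::real). 0 < e \<and> (1 + \<delta>) * e \<le> 1"
    using \<delta> by (auto simp: eventually_at_right_field field_simps intro!: exI[of _ "1 / (1 + \<delta>)"])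
  ultimately show "\<forall>\<^sub>F e in at_right 0. F e / e < y"
  proof eventually_elim
    case (elim e)
    have "\<delta> * F e \<le> A \<delta> ((1 + \<delta>) * e)"
      using low[OF \<delta>(1), of "(1 + \<delta>) * e"] elim \<delta> by simp
    then have "F e / e \<le> A \<delta> ((1 + \<delta>) * e) / (\<delta> * e)"
      using elim \<delta> by (simp add: field_simps)
    also have "\<dots> = A \<delta> ((1 + \<delta>) * e) / ((1 + \<delta>) * e) * ((1 + \<delta>) / \<delta>)"
      using elim \<delta> by simp
    finally show ?case using elim by simp
  qed
qed

section \<open>Scaling and uniform bounds for shells of inf-convolutions\<close>

context gauge_function
begin

lemma infconv_scale_less_iff:
  assumes "S \<noteq> {}" "0 < r"
  shows "infconv p ((\<lambda>s. e *\<^sub>R s) ` S) (r *\<^sub>R y) < r * c \<longleftrightarrow> infconv p ((\<lambda>s. (e / r) *\<^sub>R s) ` S) y < c"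
proof -
  have "p (r *\<^sub>R y - e *\<^sub>R s) = r * p (y - (e / r) *\<^sub>R s)" for s
    using assms(2) gauge_scaleR[of r "y - (e / r) *\<^sub>R s"] by (simp add: scaleR_diff_right)
  then show ?thesis using assms by (simp add: infconv_less_iff)
qed

text \<open>Homogeneity of the gauge: dilation by \<open>r\<close> carries level 1 to level
  \<open>r\<close> and the set \<open>(e / r) S\<close> to \<open>e S\<close>. Hence all levels of a
  window are governed by one function of the scale.\<close>

lemma emeasure_infconv_shell_scale:
  assumes S: "S \<noteq> {}" and r: "0 < r"
  shows "emeasure lborel {x. infconv p ((\<lambda>s. e *\<^sub>R s) ` S) x < r \<and> r \<le> p x}
       = ennreal (r ^ DIM('a)) * emeasure lborel {x. infconv p ((\<lambda>s. (e / r) *\<^sub>R s) ` S) x < 1 \<and> 1 \<le> p x}"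
proof -
  have ne: "(\<lambda>s. c *\<^sub>R s) ` S \<noteq> {}" for c using S by auto
  note [measurable] = borel_measurable_infconv[OF ne]
  have "{x. infconv p ((\<lambda>s. e *\<^sub>R s) ` S) x < r \<and> r \<le> p x}
      = (\<lambda>x. r *\<^sub>R x) ` {x. infconv p ((\<lambda>s. (e / r) *\<^sub>R s) ` S) x < 1 \<and> 1 \<le> p x}"
  proof (intro equalityI subsetI)
    fix x assume x: "x \<in> {x. infconv p ((\<lambda>s. e *\<^sub>R s) ` S) x < r \<and> r \<le> p x}"
    have "x = r *\<^sub>R ((1 / r) *\<^sub>R x)" using r by simp
    moreover have "infconv p ((\<lambda>s. (e / r) *\<^sub>R s) ` S) ((1 / r) *\<^sub>R x) < 1"
      using infconv_scale_less_iff[OF S r, of e "(1 / r) *\<^sub>R x" 1] x r by simp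
    moreover have "1 \<le> p ((1 / r) *\<^sub>R x)" using x r by (simp add: gauge_scaleR)
    ultimately show "x \<in> (\<lambda>x. r *\<^sub>R x) ` {x. infconv p ((\<lambda>s. (e / r) *\<^sub>R s) ` S) x < 1 \<and> 1 \<le> p x}" by blast
  qed (use infconv_scale_less_iff[OF S r, of e _ 1] r in \<open>auto simp: gauge_scaleR\<close>)
  then show ?thesis by (simp only:) (intro emeasure_lborel_scaleR_image r, measurable)
qed

lemma emeasure_gauge_less: "0 < r \<Longrightarrow> emeasure lborel {x. p x < r} = emeasure lborel {x. p x \<le> r}"
proof -
  assume r: "0 < r"
  have "{x. p x \<le> r} = {x. p x < r} \<union> {x. p x = r}" by auto
  moreover have "emeasure lborel ({x. p x < r} \<union> {x. p x = r}) = emeasure lborel {x. p x < r}"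
    by (intro emeasure_Un_null_set null_sets_gauge_eq r) measurable
  ultimately show ?thesis by simp
qed

text \<open>Enlarging \<open>S\<close> to the box \<open>cbox (- R) R\<close> restores the convexity
  on which a bound linear in \<open>e\<close> rests. The sublevel set of \<open>p\<close> is in turn
  enclosed in a cube of half-width \<open>c\<close>, so that the bound is a product over
  coordinates, a form whose mean can later be factored by independence.\<close>

lemma infconv_shell_bound:
  assumes S: "0 \<in> S" "S \<subseteq> cbox (- R) R" and e: "0 < e" "e \<le> 1" and r: "0 < r" "r \<le> m * c"
  shows "emeasure lborel {x. infconv p ((\<lambda>s. e *\<^sub>R s) ` S) x < r \<and> r \<le> p x}
        \<le> ennreal (2 * e * DIM('a) * (\<Prod>i\<in>Basis. 2 * c + 2 * (R \<bullet> i)))"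
proof -
  have R: "0 \<le> R \<bullet> i" if "i \<in> Basis" for i using S that by (auto simp: mem_box subset_iff)
  have c: "0 \<le> c" using r m_pos by (meson less_le_trans less_imp_le mult_le_0_iff not_le)
  define C where "C = {x. p x \<le> r}"
  define P where "P = minkowski C (cbox (- e *\<^sub>R R) (e *\<^sub>R R))"
  have C: "compact C" "convex C" unfolding C_def by (rule compact_gauge_le convex_gauge_le)+
  have P: "compact P" unfolding P_def by (intro compact_minkowski C compact_cbox)
  have sub: "{x. infconv p ((\<lambda>s. e *\<^sub>R s) ` S) x < r \<and> r \<le> p x} \<subseteq> P - {x. p x < r}"
  proof
    fix x assume x: "x \<in> {x. infconv p ((\<lambda>s. e *\<^sub>R s) ` S) x < r \<and> r \<le> p x}"
    moreover have "(\<lambda>s. e *\<^sub>R s) ` S \<noteq> {}" using S(1) by auto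
    ultimately obtain s where s: "s \<in> S" "p (x - e *\<^sub>R s) < r" by (auto simp: infconv_less_iff)
    have "e *\<^sub>R s \<in> cbox (- e *\<^sub>R R) (e *\<^sub>R R)"
    proof -
      have "s \<in> cbox (- R) R" using s(1) S(2) by blast
      then have si: "- (R \<bullet> i) \<le> s \<bullet> i" "s \<bullet> i \<le> R \<bullet> i" if "i \<in> Basis" for i
        using that by (auto simp: mem_box)
      have "e * - (R \<bullet> i) \<le> e * (s \<bullet> i)" "e * (s \<bullet> i) \<le> e * (R \<bullet> i)" if "i \<in> Basis" for i
        using si[OF that] e by (intro mult_left_mono; simp)+
      then show ?thesis by (simp add: mem_box)
    qed
    moreover have "x = (x - e *\<^sub>R s) + e *\<^sub>R s" by simp
    ultimately have "x \<in> P" unfolding P_def minkowski_def C_def using s(2) less_imp_le by blast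
    then show "x \<in> P - {x. p x < r}" using x by simp
  qed
  have CP: "{x. p x < r} \<subseteq> P"
  proof
    fix x assume "x \<in> {x. p x < r}"
    then have "x \<in> C" "0 \<in> cbox (- e *\<^sub>R R) (e *\<^sub>R R)" using R e by (auto simp: C_def mem_box)
    then show "x \<in> P" unfolding P_def minkowski_def by force
  qed
  have "emeasure lborel {x. infconv p ((\<lambda>s. e *\<^sub>R s) ` S) x < r \<and> r \<le> p x} \<le> emeasure lborel (P - {x. p x < r})"
    using sub P by (intro emeasure_mono) (auto intro: borel_compact)
  also have "\<dots> = emeasure lborel P - emeasure lborel {x. p x < r}"
    using P CP emeasure_lborel_compact_finite[OF C(1)] emeasure_gauge_less[OF r(1)]
    by (intro emeasure_Diff) (auto intro: borel_compact simp: C_def)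
  also have "\<dots> = ennreal (measure lborel P - measure lborel C)"
    unfolding emeasure_gauge_less[OF r(1)] C_def[symmetric]
    using emeasure_lborel_compact_finite[OF C(1)] emeasure_lborel_compact_finite[OF P]
    by (simp add: emeasure_eq_ennreal_measure ennreal_minus less_top)
  also have "\<dots> \<le> ennreal (2 * e * DIM('a) * (\<Prod>i\<in>Basis. 2 * c + 2 * (R \<bullet> i)))"
  proof (rule ennreal_leI)
    let ?c = "c *\<^sub>R (\<Sum>i\<in>Basis. i) :: 'a"
    have ci: "?c \<bullet> i = c" if "i \<in> Basis" for i using that by (simp add: inner_sum_left inner_Basis)
    have "minkowski C (cbox (- R) R) \<subseteq> cbox (- (?c + R)) (?c + R)"
    proof
      fix z assume "z \<in> minkowski C (cbox (- R) R)"
      then obtain x y where xy: "p x \<le> r" "y \<in> cbox (- R) R" "z = x + y" by (auto simp: minkowski_def C_def)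
      have "norm x \<le> c" using norm_le_gauge[of x] xy(1) r m_pos by (meson mult_le_cancel_left_pos order_trans)
      then have xi: "\<bar>x \<bullet> i\<bar> \<le> c" if "i \<in> Basis" for i using Basis_le_norm[OF that, of x] by simp
      have "- (?c + R) \<bullet> i \<le> z \<bullet> i \<and> z \<bullet> i \<le> (?c + R) \<bullet> i" if i: "i \<in> Basis" for i
      proof -
        have "- (R \<bullet> i) \<le> y \<bullet> i" "y \<bullet> i \<le> R \<bullet> i" using xy(2) i by (auto simp: mem_box)
        moreover have "(?c + R) \<bullet> i = c + R \<bullet> i" unfolding inner_add_left ci[OF i] ..
        ultimately show ?thesis using xi[OF i] unfolding inner_minus_left xy(3) by (simp only: inner_add_left[of x]) linarith
      qed
      then show "z \<in> cbox (- (?c + R)) (?c + R)" unfolding mem_box by blast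
    qed
    then have "measure lborel (minkowski C (cbox (- R) R)) \<le> measure lborel (cbox (- (?c + R)) (?c + R))"
      by (intro measure_lborel_mono_compact compact_minkowski C compact_cbox)
    also have "\<dots> = (\<Prod>i\<in>Basis. ((?c + R) - - (?c + R)) \<bullet> i)"
    proof -
      have "- (?c + R) \<bullet> i \<le> (?c + R) \<bullet> i" if "i \<in> Basis" for i
        unfolding inner_minus_left inner_add_left ci[OF that] using R[OF that] c by simp
      then show ?thesis by (subst measure_lborel_cbox_eq) auto
    qed
    also have "\<dots> = (\<Prod>i\<in>Basis. 2 * c + 2 * (R \<bullet> i))"
    proof (intro prod.cong refl)
      fix i :: 'a assume "i \<in> Basis"
      then show "(?c + R - - (?c + R)) \<bullet> i = 2 * c + 2 * (R \<bullet> i)"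
        using ci[of i] unfolding inner_diff_left inner_minus_left inner_add_left by linarith
    qed
    finally have "2 * e * DIM('a) * measure lborel (minkowski C (cbox (- R) R)) \<le> 2 * e * DIM('a) * (\<Prod>i\<in>Basis. 2 * c + 2 * (R \<bullet> i))"
      using e by (intro mult_left_mono) auto
    then show "measure lborel P - measure lborel C \<le> 2 * e * DIM('a) * (\<Prod>i\<in>Basis. 2 * c + 2 * (R \<bullet> i))"
      using box_shell_bound[OF C e R] unfolding P_def by linarith
  qed
  finally show ?thesis .
qed

text \<open>The shell bound integrated over the window; its factor \<open>e\<close> cancels the
  divisor, leaving a bound independent of \<open>e\<close> that serves as dominating
  function.\<close>

lemma clamp_integral_bound:
  assumes S: "0 \<in> S" "S \<subseteq> cbox (- R) R" and e: "0 < e" "e \<le> 1" and ab: "0 < a" "a < b" "b \<le> m * c"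
  shows "(\<integral>\<^sup>+x. ennreal ((clamp_real a b (p x) - clamp_real a b (infconv p ((\<lambda>s. e *\<^sub>R s) ` S) x)) / e) \<partial>lborel)
        \<le> ennreal ((b - a) * (2 * DIM('a) * (\<Prod>i\<in>Basis. 2 * c + 2 * (R \<bullet> i))))"
proof -
  define q where "q = infconv p ((\<lambda>s. e *\<^sub>R s) ` S)"
  define W where "W = 2 * DIM('a) * (\<Prod>i\<in>Basis. 2 * c + 2 * (R \<bullet> i))"
  have ne: "(\<lambda>s. e *\<^sub>R s) ` S \<noteq> {}" using S by auto
  have [measurable]: "q \<in> borel_measurable borel" unfolding q_def by (rule borel_measurable_infconv[OF ne])
  have q_le: "q x \<le> p x" for x unfolding q_def using S(1) by (intro infconv_le_gauge) force
  have R: "0 \<le> R \<bullet> i" if "i \<in> Basis" for i using S that by (auto simp: mem_box subset_iff)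
  have c: "0 \<le> c" using ab m_pos by (meson less_trans less_le_trans less_imp_le mult_le_0_iff not_le)
  have W: "0 \<le> W" unfolding W_def using R c by (intro mult_nonneg_nonneg prod_nonneg) auto
  have "(\<integral>\<^sup>+x. ennreal ((clamp_real a b (p x) - clamp_real a b (q x)) / e) \<partial>lborel)
      = ennreal (1 / e) * (\<integral>\<^sup>+r. emeasure lborel {x \<in> space lborel. q x < r \<and> r \<le> p x} * indicator {a..b} r \<partial>lborel)"
    using ab e by (intro nn_integral_clamp_layers_divide sigma_finite_lborel q_le) auto
  also have "\<dots> \<le> ennreal (1 / e) * (\<integral>\<^sup>+r. ennreal (e * W) * indicator {a..b} r \<partial>lborel)"
  proof (intro mult_left_mono nn_integral_mono)
    fix r :: real
    show "emeasure lborel {x \<in> space lborel. q x < r \<and> r \<le> p x} * indicator {a..b} r \<le> ennreal (e * W) * indicator {a..b} r"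
      using infconv_shell_bound[OF S e, of r c] ab
      by (cases "r \<in> {a..b}") (auto simp: q_def W_def mult_ac)
  qed simp
  also have "(\<integral>\<^sup>+r. ennreal (e * W) * indicator {a..b} r \<partial>lborel) = ennreal (e * W) * ennreal (b - a)"
    using ab by (subst nn_integral_cmult_indicator) auto
  also have "ennreal (1 / e) * (ennreal (e * W) * ennreal (b - a)) = ennreal ((b - a) * W)"
    using e W ab by (simp flip: ennreal_mult)
  finally show ?thesis unfolding q_def W_def .
qed

end

section \<open>Window integrals for a deterministic convex body\<close>

context gauge_function
begin

text \<open>The open sublevel set and the compact Minkowski sum differ only in the null frontier. An
  interior point remains in the sum after dilation by \<open>1 + \<eta>\<close>; scaling its
  decomposition back makes the gauge part strictly smaller than 1 and keeps the other part in
  \<open>K\<close>, as \<open>K\<close> is convex and contains 0.\<close>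

lemma emeasure_infconv_convex_less:
  assumes K: "compact K" "convex K" "0 \<in> K"
  shows "emeasure lborel {x. infconv p K x < 1} = emeasure lborel (minkowski {x. p x \<le> 1} K)"
proof -
  define P where "P = minkowski {x. p x \<le> 1} K"
  have ne: "K \<noteq> {}" using K by auto
  have P: "compact P" "convex P"
    unfolding P_def by (intro compact_minkowski convex_minkowski K compact_gauge_le convex_gauge_le)+
  have iff: "infconv p K x < 1 \<longleftrightarrow> (\<exists>s\<in>K. p (x - s) < 1)" for x by (rule infconv_less_iff[OF ne])
  have sub: "{x. infconv p K x < 1} \<subseteq> P"
  proof
    fix x assume "x \<in> {x. infconv p K x < 1}"
    then obtain s where s: "s \<in> K" "p (x - s) < 1" using iff by auto
    have "x = (x - s) + s" by simp
    then show "x \<in> P" unfolding P_def minkowski_def using s less_imp_le by blast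
  qed
  have int: "interior P \<subseteq> {x. infconv p K x < 1}"
  proof
    fix z assume "z \<in> interior P"
    then obtain d where d: "0 < d" "cball z d \<subseteq> P" by (auto simp: mem_interior_cball)
    \<comment> \<open>Small enough that the dilation moves \<open>z\<close> by at most
      \<open>d\<close>; the added 1 covers \<open>z = 0\<close>.\<close>
    define \<eta> where "\<eta> = d / (norm z + 1)"
    have \<eta>: "0 < \<eta>" using d by (simp add: \<eta>_def add_nonneg_pos)
    have "\<eta> * norm z \<le> \<eta> * (norm z + 1)" using \<eta> by simp
    also have "\<dots> = d" by (simp add: \<eta>_def add_nonneg_eq_0_iff)
    finally have "(1 + \<eta>) *\<^sub>R z \<in> cball z d" using \<eta> by (simp add: dist_norm algebra_simps)
    then have "(1 + \<eta>) *\<^sub>R z \<in> P" using d(2) by blast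
    then obtain b k where bk: "p b \<le> 1" "k \<in> K" "(1 + \<eta>) *\<^sub>R z = b + k"
      unfolding P_def minkowski_def by auto
    define c where "c = 1 / (1 + \<eta>)"
    have c: "0 < c" "c < 1" using \<eta> by (auto simp: c_def)
    have "c *\<^sub>R ((1 + \<eta>) *\<^sub>R z) = c *\<^sub>R b + c *\<^sub>R k" by (simp add: bk(3) scaleR_add_right)
    then have "z - c *\<^sub>R k = c *\<^sub>R b" using \<eta> by (simp add: c_def)
    then have "p (z - c *\<^sub>R k) = c * p b" using c by (simp add: gauge_scaleR)
    also have "\<dots> \<le> c * 1" using bk(1) c by (intro mult_left_mono) auto
    finally have "p (z - c *\<^sub>R k) < 1" using c by simp
    moreover have "c *\<^sub>R k \<in> K" using convex_scaled_subset[OF K(2,3), of c] c bk(2) by auto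
    ultimately show "z \<in> {x. infconv p K x < 1}" using iff by auto
  qed
  have "P \<subseteq> {x. infconv p K x < 1} \<union> frontier P"
    using int closure_subset[of P] by (auto simp: frontier_def)
  moreover have fr: "frontier P \<in> null_sets lborel"
    using negligible_convex_frontier[OF P(2)] by (simp add: negligible_iff_null_sets null_sets_completion_iff)
  note [measurable] = borel_measurable_infconv[OF ne]
  have m: "{x. infconv p K x < 1} \<in> sets lborel" by measurable
  ultimately have "emeasure lborel P \<le> emeasure lborel ({x. infconv p K x < 1} \<union> frontier P)"
    by (intro emeasure_mono) auto
  also have "\<dots> = emeasure lborel {x. infconv p K x < 1}"
    by (rule emeasure_Un_null_set[OF m fr])
  finally show ?thesis
    using emeasure_mono[OF sub, of lborel] P(1) unfolding P_def[symmetric]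
    by (intro antisym) (auto intro: borel_compact)
qed

lemma emeasure_infconv_shell_convex:
  assumes K: "compact K" "convex K" "0 \<in> K"
  shows "emeasure lborel {x. infconv p K x < 1 \<and> 1 \<le> p x}
       = ennreal (measure lborel (minkowski {x. p x \<le> 1} K) - measure lborel {x. p x \<le> 1})"
proof -
  let ?B = "{x. p x \<le> 1}"
  have ne: "K \<noteq> {}" using K by auto
  note [measurable] = borel_measurable_infconv[OF ne]
  have "{x. infconv p K x < 1 \<and> 1 \<le> p x} = {x. infconv p K x < 1} - {x. p x < 1}" by auto
  moreover have "{x. p x < 1} \<subseteq> {x. infconv p K x < 1}"
    using infconv_le_gauge[OF K(3)] by (auto intro: le_less_trans)
  moreover have fin: "emeasure lborel ?B < \<infinity>" "emeasure lborel (minkowski ?B K) < \<infinity>"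
    by (intro emeasure_lborel_compact_finite compact_minkowski compact_gauge_le K)+
  moreover have "emeasure lborel {x. p x < 1} \<noteq> \<infinity>"
    using fin(1) emeasure_gauge_less[of 1] by (simp add: less_top)
  ultimately have "emeasure lborel {x. infconv p K x < 1 \<and> 1 \<le> p x}
      = emeasure lborel {x. infconv p K x < 1} - emeasure lborel {x. p x < 1}"
    by (simp only:) (intro emeasure_Diff; simp)
  also have "\<dots> = emeasure lborel (minkowski ?B K) - emeasure lborel ?B"
    by (simp add: emeasure_infconv_convex_less[OF K] emeasure_gauge_less)
  also have "\<dots> = ennreal (measure lborel (minkowski ?B K) - measure lborel ?B)"
    using fin by (simp add: emeasure_eq_ennreal_measure ennreal_minus less_top)
  finally show ?thesis .
qed

text \<open>For convex \<open>K\<close> containing 0 the sets \<open>e K\<close> increase with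
  \<open>e\<close>, so the shell volume is monotone and the window sandwich applies. Its averages
  converge to \<open>Q\<close> and its slope to \<open>D\<close>; comparing the two bounds
  \<open>Q\<close> in terms of \<open>D\<close> up to factors that tend to 1 as the window
  shrinks.\<close>

lemma window_integral_bounds:
  assumes K: "compact K" "convex K" "0 \<in> K" and \<delta>: "0 < \<delta>"
    and D: "((\<lambda>e. (measure lborel (minkowski {x. p x \<le> 1} ((\<lambda>v. e *\<^sub>R v) ` K)) - measure lborel {x. p x \<le> 1}) / e) \<longlongrightarrow> D) (at_right 0)"
  defines "Q \<equiv> \<integral>\<^sup>+x. ennreal (dsup K x) * indicator {x. 1 < p x \<and> p x < 1 + \<delta>} x \<partial>lborel"
  shows "ennreal (\<delta> * D / (1 + \<delta>)) \<le> Q" "Q \<le> ennreal (\<delta> * (1 + \<delta>) ^ DIM('a) * D)"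
proof -
  define f where "f = (\<lambda>e. measure lborel (minkowski {x. p x \<le> 1} ((\<lambda>v. e *\<^sub>R v) ` K)) - measure lborel {x. p x \<le> 1})"
  have D': "((\<lambda>e. f e / e) \<longlongrightarrow> D) (at_right 0)" using D unfolding f_def .
  define F where "F = (\<lambda>e. ennreal (f e))"
  have sc: "compact ((\<lambda>v. e *\<^sub>R v) ` K)" "convex ((\<lambda>v. e *\<^sub>R v) ` K)" "0 \<in> (\<lambda>v. e *\<^sub>R v) ` K" for e
    using K by (auto intro: compact_scaling convex_scaling)
  have F: "emeasure lborel {x. infconv p ((\<lambda>v. e *\<^sub>R v) ` K) x < 1 \<and> 1 \<le> p x} = F e" for e
    unfolding F_def f_def by (rule emeasure_infconv_shell_convex[OF sc])
  have mono: "F x \<le> F y" if xy: "0 < x" "x \<le> y" for x y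
  proof -
    have "(\<lambda>v. x *\<^sub>R v) ` K = (\<lambda>v. y *\<^sub>R v) ` (\<lambda>v. (x / y) *\<^sub>R v) ` K" using xy by (simp add: image_image)
    also have "\<dots> \<subseteq> (\<lambda>v. y *\<^sub>R v) ` K" using xy by (intro image_mono convex_scaled_subset K) auto
    finally show ?thesis unfolding F_def f_def
      by (intro ennreal_leI diff_right_mono measure_lborel_mono_compact minkowski_mono compact_minkowski compact_gauge_le sc) auto
  qed
  define e where "e = (\<lambda>k. 1 / real (Suc k))"
  have e: "0 < e k" "e k \<le> 1" for k by (auto simp: e_def)
  have e0: "e \<longlonglongrightarrow> 0" unfolding e_def by (rule LIMSEQ_Suc[OF lim_1_over_n])
  define J where "J = (\<lambda>k. \<integral>\<^sup>+x. ennreal ((clamp_real 1 (1 + \<delta>) (p x) - clamp_real 1 (1 + \<delta>) (infconv p ((\<lambda>s. e k *\<^sub>R s) ` K) x)) / e k) \<partial>lborel)"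
  obtain R where R: "\<And>s. s \<in> K \<Longrightarrow> norm s \<le> R" using compact_imp_bounded[OF K(1)] by (auto simp: bounded_iff)
  have Jlim: "J \<longlonglongrightarrow> Q"
    unfolding J_def Q_def using \<delta> by (intro clamp_integral_limit[OF R K(3) _ _ e e0]) auto
  have J: "J k = ennreal (1 / e k) * (\<integral>\<^sup>+r. emeasure lborel {x. infconv p ((\<lambda>s. e k *\<^sub>R s) ` K) x < r \<and> r \<le> p x} * indicator {1..1 + \<delta>} r \<partial>lborel)" for k
  proof -
    have ne: "(\<lambda>s. e k *\<^sub>R s) ` K \<noteq> {}" using K by auto
    show ?thesis
      unfolding J_def using \<delta> e borel_measurable_infconv[OF ne] infconv_le_gauge[OF sc(3)]
        nn_integral_clamp_layers_divide[OF sigma_finite_lborel, of "infconv p ((\<lambda>s. e k *\<^sub>R s) ` K)" p 1 "1 + \<delta>" "e k"]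
      by simp
  qed
  have G: "emeasure lborel {x. infconv p ((\<lambda>s. e k *\<^sub>R s) ` K) x < r \<and> r \<le> p x} = ennreal (r ^ DIM('a)) * F (e k / r)" if "1 \<le> r" for r k
    using that K(3) emeasure_infconv_shell_scale[of K r "e k"] by (auto simp: F)
  have er: "filterlim e (at_right 0) sequentially"
    using e0 e by (auto simp: filterlim_at intro!: always_eventually) (metis less_irrefl)
  have er': "filterlim (\<lambda>k. e k / (1 + \<delta>)) (at_right 0) sequentially"
    using e0 e \<delta> by (auto simp: filterlim_at intro!: always_eventually tendsto_eq_intros) (metis less_irrefl)
  have "(\<lambda>k. ennreal (\<delta> * (f (e k / (1 + \<delta>)) / (e k / (1 + \<delta>)) / (1 + \<delta>)))) \<longlonglongrightarrow> ennreal (\<delta> * (D / (1 + \<delta>)))"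
  proof -
    have "(\<lambda>k. f (e k / (1 + \<delta>)) / (e k / (1 + \<delta>))) \<longlonglongrightarrow> D"
      by (rule filterlim_compose[OF D' er'])
    then show ?thesis using \<delta> by (intro tendsto_ennrealI tendsto_mult tendsto_divide tendsto_const) auto
  qed
  moreover have "ennreal (\<delta> * (f (e k / (1 + \<delta>)) / (e k / (1 + \<delta>)) / (1 + \<delta>))) \<le> J k" for k
  proof -
    have "ennreal (1 / e k) * (ennreal \<delta> * F (e k / (1 + \<delta>))) \<le> J k"
      unfolding J by (intro mult_left_mono window_average_bounds(1)[OF G mono \<delta> e(1)]) auto
    moreover have "\<delta> * (f (e k / (1 + \<delta>)) / (e k / (1 + \<delta>)) / (1 + \<delta>)) = (1 / e k) * (\<delta> * f (e k / (1 + \<delta>)))"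
    proof -
      have "\<delta> * (y / (a / b) / b) = (1 / a) * (\<delta> * y)" if "b \<noteq> 0" for a b y :: real
        using that by simp
      note * = this
      show ?thesis by (rule *) (use \<delta> in simp)
    qed
    moreover have "ennreal ((1 / e k) * (\<delta> * f (e k / (1 + \<delta>)))) = ennreal (1 / e k) * (ennreal \<delta> * F (e k / (1 + \<delta>)))"
      unfolding F_def using e(1)[of k] \<delta> by (subst ennreal_mult', simp, subst ennreal_mult', simp, simp)
    ultimately show ?thesis by (simp only:)
  qed
  ultimately show "ennreal (\<delta> * D / (1 + \<delta>)) \<le> Q"
    using LIMSEQ_le[OF _ Jlim] by auto
  have "(\<lambda>k. ennreal (\<delta> * (1 + \<delta>) ^ DIM('a) * (f (e k) / e k))) \<longlonglongrightarrow> ennreal (\<delta> * (1 + \<delta>) ^ DIM('a) * D)"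
    by (intro tendsto_ennrealI tendsto_intros filterlim_compose[OF D' er])
  moreover have "J k \<le> ennreal (\<delta> * (1 + \<delta>) ^ DIM('a) * (f (e k) / e k))" for k
  proof -
    have "J k \<le> ennreal (1 / e k) * (ennreal (\<delta> * (1 + \<delta>) ^ DIM('a)) * F (e k))"
      unfolding J by (intro mult_left_mono window_average_bounds(2)[OF G mono \<delta> e(1)]) auto
    moreover have "\<delta> * (1 + \<delta>) ^ DIM('a) * (f (e k) / e k) = (1 / e k) * (\<delta> * (1 + \<delta>) ^ DIM('a) * f (e k))"
      by simp
    moreover have "ennreal ((1 / e k) * (\<delta> * (1 + \<delta>) ^ DIM('a) * f (e k))) = ennreal (1 / e k) * (ennreal (\<delta> * (1 + \<delta>) ^ DIM('a)) * F (e k))"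
      unfolding F_def using e(1)[of k] \<delta> by (subst ennreal_mult', simp, subst ennreal_mult', simp, simp)
    ultimately show ?thesis by (simp only:)
  qed
  ultimately show "Q \<le> ennreal (\<delta> * (1 + \<delta>) ^ DIM('a) * D)"
    using LIMSEQ_le[OF Jlim] by auto
qed

end

section \<open>Stable laws and Spitzer's identity\<close>

text \<open>For \<open>\<bar>x\<bar> > 1\<close> restrict to \<open>s\<close> between
  \<open>1 / (2 * \<bar>x\<bar>)\<close> and \<open>1 / \<bar>x\<bar>\<close>. There
  \<open>1 - cos (s * x)\<close> is at least \<open>d = 1 - cos (1 / 2)\<close> and
  \<open>1 / s\<^sup>2\<close> at least \<open>x\<^sup>2\<close>, on an interval of length
  \<open>1 / (2 * \<bar>x\<bar>)\<close>. The integral is at least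
  \<open>d * \<bar>x\<bar> / 2\<close>, which gives \<open>c\<close>; the summand 1 covers small
  \<open>x\<close>.\<close>

lemma abs_le_integral_one_minus_cos:
  fixes x :: real
  defines "c \<equiv> 2 / (1 - cos (1 / 2))"
  shows "ennreal \<bar>x\<bar> \<le> 1 + ennreal c * (\<integral>\<^sup>+s. ennreal ((1 - cos (s * x)) / s\<^sup>2) * indicator {0..1} s \<partial>lborel)"
proof (cases "\<bar>x\<bar> \<le> 1")
  case True
  then have "ennreal \<bar>x\<bar> \<le> 1 + 0" by simp
  also have "\<dots> \<le> 1 + ennreal c * (\<integral>\<^sup>+s. ennreal ((1 - cos (s * x)) / s\<^sup>2) * indicator {0..1} s \<partial>lborel)"
    by (intro add_left_mono) simp
  finally show ?thesis .
next
  case False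
  define d :: real where "d = 1 - cos (1 / 2)"
  have "cos (1 / 2 :: real) < cos 0" using pi_gt3 by (intro cos_monotone_0_pi) auto
  then have d: "0 < d" by (simp add: d_def)
  define A where "A = {1 / (2 * \<bar>x\<bar>)..1 / \<bar>x\<bar>}"
  have x: "1 < \<bar>x\<bar>" using False by simp
  have pt: "ennreal (d * x\<^sup>2) * indicator A s \<le> ennreal ((1 - cos (s * x)) / s\<^sup>2) * indicator {0..1} s" for s
  proof (cases "s \<in> A")
    case True
    have 1: "1 / 2 \<le> s * \<bar>x\<bar>" "s * \<bar>x\<bar> \<le> 1" using True x by (auto simp: A_def field_simps)
    have "0 < 1 / (2 * \<bar>x\<bar>)" using x by simp
    then have s: "0 < s" using True unfolding A_def by (meson atLeastAtMost_iff less_le_trans)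
    have "s * 1 \<le> s * \<bar>x\<bar>" using x s by (intro mult_left_mono) auto
    then have s1: "s \<le> 1" using 1 by simp
    have "cos (s * \<bar>x\<bar>) \<le> cos (1 / 2)" using 1 pi_gt3 by (intro cos_monotone_0_pi_le) auto
    moreover have "cos (s * \<bar>x\<bar>) = cos (s * x)" by (cases "0 \<le> x") auto
    ultimately have "d \<le> 1 - cos (s * x)" by (simp add: d_def)
    moreover have "(s * \<bar>x\<bar>)\<^sup>2 \<le> 1" using 1 by (intro power_le_one) auto
    then have "d * (s * \<bar>x\<bar>)\<^sup>2 \<le> d * 1" using d by (intro mult_left_mono) auto
    ultimately have "d * x\<^sup>2 \<le> (1 - cos (s * x)) / s\<^sup>2"
      using s by (simp add: pos_le_divide_eq power_mult_distrib mult_ac)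
    then show ?thesis using True s s1 by (simp add: ennreal_leI)
  qed simp
  have "ennreal (d * x\<^sup>2) * emeasure lborel A \<le> (\<integral>\<^sup>+s. ennreal ((1 - cos (s * x)) / s\<^sup>2) * indicator {0..1} s \<partial>lborel)"
  proof -
    have "(\<integral>\<^sup>+s. ennreal (d * x\<^sup>2) * indicator A s \<partial>lborel)
        \<le> (\<integral>\<^sup>+s. ennreal ((1 - cos (s * x)) / s\<^sup>2) * indicator {0..1} s \<partial>lborel)"
      by (intro nn_integral_mono pt)
    then show ?thesis by (subst (asm) nn_integral_cmult_indicator) (auto simp: A_def)
  qed
  moreover have "emeasure lborel A = ennreal (1 / (2 * \<bar>x\<bar>))"
    using x unfolding A_def by (subst emeasure_lborel_Icc) (auto simp: field_simps)
  ultimately have "ennreal c * (ennreal (d * x\<^sup>2) * ennreal (1 / (2 * \<bar>x\<bar>)))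
      \<le> ennreal c * (\<integral>\<^sup>+s. ennreal ((1 - cos (s * x)) / s\<^sup>2) * indicator {0..1} s \<partial>lborel)"
    by (intro mult_left_mono) auto
  moreover have *: "c * (d * x\<^sup>2 * (1 / (2 * \<bar>x\<bar>))) = \<bar>x\<bar>"
  proof -
    have "c = 2 / d" by (simp add: c_def d_def)
    moreover have "x\<^sup>2 = \<bar>x\<bar> * \<bar>x\<bar>" by (simp add: power2_eq_square)
    moreover have "(2 / d) * (d * (y * y) * (1 / (2 * y))) = y" if "y \<noteq> 0" for y :: real
      using d that by simp
    from this[of "\<bar>x\<bar>"] have "(2 / d) * (d * (\<bar>x\<bar> * \<bar>x\<bar>) * (1 / (2 * \<bar>x\<bar>))) = \<bar>x\<bar>" using x by simp
    ultimately show ?thesis by (simp only:)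
  qed
  then have "ennreal c * (ennreal (d * x\<^sup>2) * ennreal (1 / (2 * \<bar>x\<bar>))) = ennreal \<bar>x\<bar>"
  proof -
    have "0 \<le> c" "0 \<le> d * x\<^sup>2" "0 \<le> 1 / (2 * \<bar>x\<bar>)" using d by (simp_all add: c_def d_def)
    then have "ennreal c * (ennreal (d * x\<^sup>2) * ennreal (1 / (2 * \<bar>x\<bar>))) = ennreal (c * (d * x\<^sup>2 * (1 / (2 * \<bar>x\<bar>))))"
      by (simp only: ennreal_mult mult_nonneg_nonneg)
    then show ?thesis using * by (simp only:)
  qed
  ultimately have "ennreal \<bar>x\<bar> \<le> ennreal c * (\<integral>\<^sup>+s. ennreal ((1 - cos (s * x)) / s\<^sup>2) * indicator {0..1} s \<partial>lborel)"
    by simp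
  also have "\<dots> \<le> 1 + \<dots>" by simp
  finally show ?thesis .
qed

text \<open>After exchanging integrals, the mean of \<open>1 - cos (s * x)\<close> is read off the
  characteristic function and is at most \<open>\<bar>s\<bar> powr \<alpha>\<close>; the remaining
  \<open>s powr (\<alpha> - 2)\<close> is integrable at 0 because
  \<open>\<alpha> > 1\<close>.\<close>

lemma stable_integrable:
  assumes N: "real_distribution N" and ch: "\<And>s. char N s = complex_of_real (exp (- (\<bar>s\<bar> powr \<alpha>)))" and \<alpha>: "1 < \<alpha>"
  shows "integrable N (\<lambda>x. x)"
proof -
  interpret real_distribution N by fact
  interpret pair_sigma_finite N lborel by unfold_locales
  have cosint: "integrable N (\<lambda>x. cos (s * x))" for s
    by (rule integrable_const_bound[of _ 1]) auto
  have Ecos: "(\<integral>x. cos (s * x) \<partial>N) = exp (- (\<bar>s\<bar> powr \<alpha>))" for s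
  proof -
    have i: "integrable N (\<lambda>x. iexp (s * x))"
      by (rule integrable_const_bound[of _ 1]) auto
    have "Re (char N s) = (\<integral>x. Re (iexp (s * x)) \<partial>N)"
      unfolding char_def by (rule integral_Re[OF i, symmetric])
    then show ?thesis by (simp add: ch Re_exp)
  qed
  have inner: "(\<integral>\<^sup>+x. ennreal ((1 - cos (s * x)) / s\<^sup>2) \<partial>N) \<le> ennreal (s powr (\<alpha> - 2))" if "s \<in> {0..1}" for s
  proof (cases "s = 0")
    case False
    have "(\<integral>\<^sup>+x. ennreal ((1 - cos (s * x)) / s\<^sup>2) \<partial>N) = ennreal (\<integral>x. (1 - cos (s * x)) / s\<^sup>2 \<partial>N)"
      by (rule nn_integral_eq_integral) (auto intro!: integrable_divide Bochner_Integration.integrable_diff cosint)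
    also have "(\<integral>x. (1 - cos (s * x)) / s\<^sup>2 \<partial>N) = (1 - exp (- (\<bar>s\<bar> powr \<alpha>))) / s\<^sup>2"
    proof -
      have "(\<integral>x. 1 - cos (s * x) \<partial>N) = 1 - exp (- (\<bar>s\<bar> powr \<alpha>))"
        using cosint prob_space by (subst Bochner_Integration.integral_diff) (simp_all add: Ecos)
      then show ?thesis by simp
    qed
    also have "\<dots> \<le> \<bar>s\<bar> powr \<alpha> / s\<^sup>2"
      using exp_ge_add_one_self[of "- (\<bar>s\<bar> powr \<alpha>)"] by (intro divide_right_mono) auto
    also have "\<bar>s\<bar> powr \<alpha> / s\<^sup>2 = s powr (\<alpha> - 2)"
      using that False by (simp add: powr_diff)
    finally show ?thesis by (simp add: ennreal_leI)
  qed simp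
  have "(\<integral>\<^sup>+x. \<integral>\<^sup>+s. ennreal ((1 - cos (s * x)) / s\<^sup>2) * indicator {0..1} s \<partial>lborel \<partial>N)
      = (\<integral>\<^sup>+s. \<integral>\<^sup>+x. ennreal ((1 - cos (s * x)) / s\<^sup>2) * indicator {0..1} s \<partial>N \<partial>lborel)"
    by (rule Fubini'[symmetric]) measurable
  also have "\<dots> \<le> (\<integral>\<^sup>+s. ennreal (s powr (\<alpha> - 2) * indicator {0..1} s) \<partial>lborel)"
  proof (intro nn_integral_mono)
    fix s :: real
    show "(\<integral>\<^sup>+x. ennreal ((1 - cos (s * x)) / s\<^sup>2) * indicator {0..1} s \<partial>N) \<le> ennreal (s powr (\<alpha> - 2) * indicator {0..1} s)"
      using inner[of s] by (cases "s \<in> {0..1}") (auto simp: nn_integral_multc)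
  qed
  also have "\<dots> = ennreal (1 / (\<alpha> - 1))"
  proof (rule nn_integral_has_integral_lborel)
    have "((\<lambda>x. x powr (\<alpha> - 2)) has_integral (1 powr (\<alpha> - 2 + 1) / (\<alpha> - 2 + 1))) {0..1}"
      using \<alpha> by (intro has_integral_powr_from_0) auto
    then have "((\<lambda>s. s powr (\<alpha> - 2)) has_integral 1 / (\<alpha> - 1)) {0..1}" by (simp add: algebra_simps)
    moreover have "(\<lambda>s. s powr (\<alpha> - 2) * indicator {0..1} s) = (\<lambda>s. if s \<in> {0..1} then s powr (\<alpha> - 2) else 0)"
      by (auto simp: fun_eq_iff indicator_def)
    ultimately show "((\<lambda>s. s powr (\<alpha> - 2) * indicator {0..1} s) has_integral 1 / (\<alpha> - 1)) UNIV"
      by (simp only: has_integral_restrict_UNIV)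
  qed auto
  finally have fin: "(\<integral>\<^sup>+x. \<integral>\<^sup>+s. ennreal ((1 - cos (s * x)) / s\<^sup>2) * indicator {0..1} s \<partial>lborel \<partial>N) \<le> ennreal (1 / (\<alpha> - 1))" .
  let ?c = "2 / (1 - cos (1 / 2))"
  have "(\<integral>\<^sup>+x. ennreal \<bar>x\<bar> \<partial>N) \<le> (\<integral>\<^sup>+x. 1 + ennreal ?c * (\<integral>\<^sup>+s. ennreal ((1 - cos (s * x)) / s\<^sup>2) * indicator {0..1} s \<partial>lborel) \<partial>N)"
    by (intro nn_integral_mono abs_le_integral_one_minus_cos)
  also have "\<dots> = 1 + ennreal ?c * (\<integral>\<^sup>+x. \<integral>\<^sup>+s. ennreal ((1 - cos (s * x)) / s\<^sup>2) * indicator {0..1} s \<partial>lborel \<partial>N)"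
    using emeasure_space_1 by (subst nn_integral_add) (auto simp: nn_integral_cmult)
  also have "\<dots> \<le> 1 + ennreal ?c * ennreal (1 / (\<alpha> - 1))"
    by (intro add_left_mono mult_left_mono fin) simp
  also have "\<dots> < \<infinity>" by (simp add: ennreal_mult_less_top)
  finally show ?thesis by (intro integrableI_bounded) auto
qed

lemma char_distr_scale:
  assumes "prob_space M" "Y \<in> borel_measurable M"
  shows "char (distr M borel (\<lambda>\<omega>. c * Y \<omega>)) s = char (distr M borel Y) (c * s)"
  using assms(2) by (simp add: char_def integral_distr mult_ac)

context prob_space
begin

lemma distr_eqI_char:
  fixes Y Z :: "'a \<Rightarrow> real"
  assumes "Y \<in> borel_measurable M" "Z \<in> borel_measurable M"
    and "\<And>s. char (distr M borel Y) s = char (distr M borel Z) s"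
  shows "distr M borel Y = distr M borel Z"
  using assms by (intro Levy_uniqueness) (auto intro: real_distribution_distr)

lemma expectation_cong_distr:
  fixes Y Z :: "'a \<Rightarrow> real" and f :: "real \<Rightarrow> real"
  assumes [measurable]: "Y \<in> borel_measurable M" "Z \<in> borel_measurable M" "f \<in> borel_measurable borel"
    and "distr M borel Y = distr M borel Z"
  shows "(\<integral>\<omega>. f (Y \<omega>) \<partial>M) = (\<integral>\<omega>. f (Z \<omega>) \<partial>M)"
    "integrable M (\<lambda>\<omega>. f (Y \<omega>)) \<longleftrightarrow> integrable M (\<lambda>\<omega>. f (Z \<omega>))"
  using assms(4) integral_distr[of Y M borel f] integral_distr[of Z M borel f]
    integrable_distr_eq[of Y M borel f] integrable_distr_eq[of Z M borel f] by simp_all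

text \<open>Characteristic functions show that \<open>Z\<close> has the law of
  \<open>v powr (1 / \<alpha>)\<close> times \<open>Y\<close> and that \<open>Y\<close> is
  symmetric; symmetry makes the mean positive part half the mean absolute value.\<close>

lemma stable_positive_part:
  fixes Y Z :: "'a \<Rightarrow> real"
  assumes [measurable]: "Y \<in> borel_measurable M" "Z \<in> borel_measurable M" and \<alpha>: "1 < \<alpha>" and v: "0 \<le> v"
    and Y: "\<And>s. char (distr M borel Y) s = complex_of_real (exp (- (\<bar>s\<bar> powr \<alpha>)))"
    and Z: "\<And>s. char (distr M borel Z) s = complex_of_real (exp (- v * \<bar>s\<bar> powr \<alpha>))"
  shows "integrable M Z" "(\<integral>\<omega>. max 0 (Z \<omega>) \<partial>M) = v powr (1 / \<alpha>) * (\<integral>\<omega>. \<bar>Y \<omega>\<bar> \<partial>M) / 2"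
proof -
  define c where "c = v powr (1 / \<alpha>)"
  have c: "0 \<le> c" by (simp add: c_def)
  have ca: "c powr \<alpha> = v" using v \<alpha> by (simp add: c_def powr_powr)
  have intY: "integrable M Y"
  proof -
    have "integrable (distr M borel Y) (\<lambda>x. x)"
      by (rule stable_integrable[of _ \<alpha>]) (use Y \<alpha> in \<open>auto intro: real_distribution_distr\<close>)
    then show ?thesis by (simp add: integrable_distr_eq)
  qed
  have eq: "distr M borel Z = distr M borel (\<lambda>\<omega>. c * Y \<omega>)"
    using c ca by (intro distr_eqI_char) (auto simp: Z char_distr_scale[OF prob_space_axioms] Y abs_mult powr_mult)
  have sym: "distr M borel Y = distr M borel (\<lambda>\<omega>. - 1 * Y \<omega>)"
  proof (rule distr_eqI_char)
    fix s
    show "char (distr M borel Y) s = char (distr M borel (\<lambda>\<omega>. - 1 * Y \<omega>)) s"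
      unfolding char_distr_scale[OF prob_space_axioms assms(1)] Y by simp
  qed simp_all
  have m0: "(\<lambda>x::real. max 0 x) \<in> borel_measurable borel" by measurable
  show "integrable M Z"
  proof -
    have m: "(\<lambda>\<omega>. c * Y \<omega>) \<in> borel_measurable M" by measurable
    have "integrable M Z \<longleftrightarrow> integrable M (\<lambda>\<omega>. c * Y \<omega>)"
      by (rule expectation_cong_distr(2)[OF assms(2) m measurable_ident eq, unfolded id_def])
    then show ?thesis using intY by simp
  qed
  have "(\<integral>\<omega>. max 0 (Y \<omega>) \<partial>M) = (\<integral>\<omega>. max 0 (- Y \<omega>) \<partial>M)"
  proof -
    have m: "(\<lambda>\<omega>. - 1 * Y \<omega>) \<in> borel_measurable M" by measurable
    show ?thesis using expectation_cong_distr(1)[OF assms(1) m m0 sym] by simp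
  qed
  moreover have "(\<integral>\<omega>. \<bar>Y \<omega>\<bar> \<partial>M) = (\<integral>\<omega>. max 0 (Y \<omega>) + max 0 (- Y \<omega>) \<partial>M)"
    by (intro Bochner_Integration.integral_cong) auto
  moreover have "\<dots> = (\<integral>\<omega>. max 0 (Y \<omega>) \<partial>M) + (\<integral>\<omega>. max 0 (- Y \<omega>) \<partial>M)"
    using intY by (intro Bochner_Integration.integral_add) auto
  ultimately have half: "(\<integral>\<omega>. max 0 (Y \<omega>) \<partial>M) = (\<integral>\<omega>. \<bar>Y \<omega>\<bar> \<partial>M) / 2" by simp
  have "(\<integral>\<omega>. max 0 (Z \<omega>) \<partial>M) = (\<integral>\<omega>. max 0 (c * Y \<omega>) \<partial>M)"
  proof -
    have m: "(\<lambda>\<omega>. c * Y \<omega>) \<in> borel_measurable M" by measurable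
    show ?thesis by (rule expectation_cong_distr(1)[OF assms(2) m m0 eq])
  qed
  also have "(\<lambda>\<omega>. max 0 (c * Y \<omega>)) = (\<lambda>\<omega>. c * max 0 (Y \<omega>))"
    using c by (auto simp: max_mult_distrib_left)
  finally show "(\<integral>\<omega>. max 0 (Z \<omega>) \<partial>M) = v powr (1 / \<alpha>) * (\<integral>\<omega>. \<bar>Y \<omega>\<bar> \<partial>M) / 2"
    by (simp add: half c_def)
qed

end

section \<open>Product laws and Spitzer's identity\<close>

context prob_space
begin

text \<open>Iterated products: the outer index runs over the coordinates of the process, the inner
  one over its increments.\<close>

lemma nested_product_law:
  fixes Z :: "'j::finite \<Rightarrow> nat \<Rightarrow> 'a \<Rightarrow> real"
  assumes indep: "indep_vars (\<lambda>_. PiM {..<N} (\<lambda>_. borel)) (\<lambda>j \<omega>. \<lambda>k\<in>{..<N}. Z j k \<omega>) UNIV"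
    and indep_j: "\<And>j. indep_vars (\<lambda>_. borel) (Z j) {..<N}"
    and law: "\<And>j k. k < N \<Longrightarrow> distr M borel (Z j k) = \<nu>" and N: "0 < N"
  shows "distr M (PiM UNIV (\<lambda>_. PiM {..<N} (\<lambda>_. borel))) (\<lambda>\<omega> j. \<lambda>k\<in>{..<N}. Z j k \<omega>)
       = PiM UNIV (\<lambda>_. PiM {..<N} (\<lambda>_. \<nu>))"
proof -
  have inner: "distr M (PiM {..<N} (\<lambda>_. borel)) (\<lambda>\<omega>. \<lambda>k\<in>{..<N}. Z j k \<omega>) = PiM {..<N} (\<lambda>_. \<nu>)" for j
  proof -
    have "distr M (PiM {..<N} (\<lambda>_. borel)) (\<lambda>\<omega>. \<lambda>k\<in>{..<N}. Z j k \<omega>) = PiM {..<N} (\<lambda>k. distr M borel (Z j k))"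
      using indep_j[of j] N
      by (subst indep_vars_iff_distr_eq_PiM'[symmetric]) (auto simp: indep_vars_def)
    also have "\<dots> = PiM {..<N} (\<lambda>_. \<nu>)" by (intro PiM_cong) (auto simp: law)
    finally show ?thesis .
  qed
  have rv: "random_variable (PiM {..<N} (\<lambda>_. borel)) (\<lambda>\<omega>. \<lambda>k\<in>{..<N}. Z j k \<omega>)" for j
    using indep by (auto simp: indep_vars_def)
  have "distr M (PiM UNIV (\<lambda>_. PiM {..<N} (\<lambda>_. borel))) (\<lambda>\<omega>. \<lambda>j\<in>UNIV. \<lambda>k\<in>{..<N}. Z j k \<omega>)
      = PiM UNIV (\<lambda>j. distr M (PiM {..<N} (\<lambda>_. borel)) (\<lambda>\<omega>. \<lambda>k\<in>{..<N}. Z j k \<omega>))"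
    using indep by (subst indep_vars_iff_distr_eq_PiM'[symmetric]) (auto intro: rv)
  moreover have "(\<lambda>\<omega>. \<lambda>j\<in>UNIV. \<lambda>k\<in>{..<N}. Z j k \<omega>) = (\<lambda>\<omega> j. \<lambda>k\<in>{..<N}. Z j k \<omega>)" by (auto simp: fun_eq_iff)
  ultimately show ?thesis by (simp only: inner)
qed

text \<open>Spitzer's identity for exchangeable increments: on the event that the last partial sum is
  positive the maximum equals the first increment plus the maximum of the remaining walk, and a
  cyclic shift of the increments turns the latter into the maximum of the shorter walk.\<close>

lemma spitzer_exchangeable:
  fixes Y :: "nat \<Rightarrow> 'a \<Rightarrow> real"
  assumes int: "\<And>k. k < N \<Longrightarrow> integrable M (Y k)"
    and exch: "\<And>\<sigma> (\<Phi> :: (nat \<Rightarrow> real) \<Rightarrow> real). \<sigma> permutes {..<N} \<Longrightarrow> \<Phi> \<in> borel_measurable (PiM {..<N} (\<lambda>_. borel)) \<Longrightarrow>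
      (\<integral>\<omega>. \<Phi> (\<lambda>k\<in>{..<N}. Y (\<sigma> k) \<omega>) \<partial>M) = (\<integral>\<omega>. \<Phi> (\<lambda>k\<in>{..<N}. Y k \<omega>) \<partial>M)"
  assumes n: "n \<le> N"
  shows "(\<integral>\<omega>. (MAX k\<in>{..n}. \<Sum>i<k. Y i \<omega>) \<partial>M) = (\<Sum>k=1..n. (\<integral>\<omega>. max 0 (\<Sum>i<k. Y i \<omega>) \<partial>M) / k)"
  using n
proof (induction n)
  case (Suc n)
  let ?S = "\<lambda>k \<omega>. \<Sum>i<k. Y i \<omega>"
  let ?M = "\<lambda>n \<omega>. MAX k\<in>{..n}. ?S k \<omega>"
  have nN: "n < N" using Suc.prems by simp
  have [measurable]: "Y k \<in> borel_measurable M" if "k < N" for k using int[OF that] by auto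
  have intS: "integrable M (?S k)" if "k \<le> Suc n" for k
    using that Suc.prems by (intro Bochner_Integration.integrable_sum int) auto
  have intM: "integrable M (?M k)" if "k \<le> Suc n" for k
    using that
  proof (induction k)
    case (Suc k)
    have "?M (Suc k) = (\<lambda>\<omega>. max (?S (Suc k) \<omega>) (?M k \<omega>))"
      unfolding atMost_Suc by (subst image_insert, subst Max_insert) auto
    then show ?case using Suc intS[of "Suc k"] by (simp del: sum.lessThan_Suc)
  qed simp
  let ?P = "\<lambda>\<omega>. indicat_real {\<omega>. 0 < ?S (Suc n) \<omega>} \<omega>"
  have Pm [measurable]: "(\<lambda>\<omega>. ?P \<omega>) \<in> borel_measurable M"
  proof -
    have "?S (Suc n) \<in> borel_measurable M" using intS[of "Suc n"] by auto
    then have "(\<lambda>\<omega>. indicat_real {0<..} (?S (Suc n) \<omega>)) \<in> borel_measurable M"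
      by (rule measurable_compose) simp
    moreover have "(\<lambda>\<omega>. indicat_real {0<..} (?S (Suc n) \<omega>)) = ?P" by (auto simp: indicator_def)
    ultimately show ?thesis by simp
  qed
  have intP: "integrable M (\<lambda>\<omega>. ?P \<omega> * f \<omega>)" if "integrable M f" for f :: "'a \<Rightarrow> real"
  proof (rule Bochner_Integration.integrable_bound[OF that])
    show "(\<lambda>\<omega>. ?P \<omega> * f \<omega>) \<in> borel_measurable M"
      by (rule borel_measurable_times[OF Pm borel_measurable_integrable[OF that]])
  qed (auto simp: indicator_def)
  define T where "T = (\<lambda>\<omega>. MAX k\<in>{..n}. \<Sum>i<k. Y (Suc i) \<omega>)"
  \<comment> \<open>On the complement of the event the last partial sum is at most 0, hence at most
    \<open>?M n\<close>, and the maximum does not change; the final bracket vanishes on the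
    event.\<close>
  have split: "?M (Suc n) \<omega> = ?P \<omega> * Y 0 \<omega> + ?P \<omega> * T \<omega> + (?M n \<omega> - ?P \<omega> * ?M n \<omega>)" for \<omega>
  proof (cases "0 < ?S (Suc n) \<omega>")
    case True
    have "{..Suc n} = insert 0 (Suc ` {..n})" by (auto simp: image_iff less_Suc_eq_0_disj Suc_le_eq elim: less_SucE) (metis Suc_le_mono atMost_iff not0_implies_Suc)
    then have "?M (Suc n) \<omega> = max 0 (MAX k\<in>{..n}. ?S (Suc k) \<omega>)"
      by (simp add: image_image del: sum.lessThan_Suc)
    also have "\<dots> = (MAX k\<in>{..n}. ?S (Suc k) \<omega>)"
    proof -
      have "?S (Suc n) \<omega> \<le> (MAX k\<in>{..n}. ?S (Suc k) \<omega>)" by (intro Max_ge) auto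
      with True have "0 \<le> (MAX k\<in>{..n}. ?S (Suc k) \<omega>)" by (meson less_imp_le less_le_trans)
      then show ?thesis by (rule max_absorb2)
    qed
    also have "\<dots> = (MAX k\<in>{..n}. (\<Sum>i<k. Y (Suc i) \<omega>) + Y 0 \<omega>)"
      by (simp only: sum.lessThan_Suc_shift add.commute)
    also have "\<dots> = T \<omega> + Y 0 \<omega>"
      unfolding T_def by (rule Max_add_commute) auto
    finally show ?thesis using True by (simp del: sum.lessThan_Suc)
  next
    case False
    have "?M (Suc n) \<omega> = max (?S (Suc n) \<omega>) (?M n \<omega>)"
      unfolding atMost_Suc by (subst image_insert, subst Max_insert) auto
    moreover have "?S 0 \<omega> \<le> ?M n \<omega>" by (intro Max_ge finite_imageI imageI) auto
    ultimately show ?thesis using False by (simp del: sum.lessThan_Suc)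
  qed
  have intT: "integrable M T"
  proof -
    have "integrable M (\<lambda>\<omega>. MAX k\<in>{..m}. \<Sum>i<k. Y (Suc i) \<omega>)" if "m \<le> n" for m
      using that
    proof (induction m)
      case (Suc m)
      have "(\<lambda>\<omega>. MAX k\<in>{..Suc m}. \<Sum>i<k. Y (Suc i) \<omega>) = (\<lambda>\<omega>. max (\<Sum>i<Suc m. Y (Suc i) \<omega>) (MAX k\<in>{..m}. \<Sum>i<k. Y (Suc i) \<omega>))"
        unfolding atMost_Suc by (subst image_insert, subst Max_insert) auto
      moreover have "integrable M (\<lambda>\<omega>. \<Sum>i<Suc m. Y (Suc i) \<omega>)"
        using Suc.prems nN by (intro Bochner_Integration.integrable_sum int) auto
      ultimately show ?case using Suc by (simp del: sum.lessThan_Suc)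
    qed simp
    then show ?thesis by (simp add: T_def)
  qed
  have sumperm: "(\<Sum>i<Suc n. Y (\<sigma> i) \<omega>) = ?S (Suc n) \<omega>" if "\<sigma> permutes {..<Suc n}" for \<sigma> \<omega>
    using sum.permute[OF that, of "\<lambda>i. Y i \<omega>"] by (simp add: o_def del: sum.lessThan_Suc)
  have perm: "\<sigma> permutes {..<N}" if "\<sigma> permutes {..<Suc n}" for \<sigma>
    using that nN by (rule_tac permutes_subset) auto
  have Sum_m: "(\<lambda>y. \<Sum>i<k. y i) \<in> borel_measurable (PiM {..<N} (\<lambda>_. borel :: real measure))" if "k \<le> N" for k
    using that by (intro borel_measurable_sum measurable_component_singleton) auto
  have Pos_m: "(\<lambda>y. indicat_real {0<..} (\<Sum>i<Suc n. y i)) \<in> borel_measurable (PiM {..<N} (\<lambda>_. borel :: real measure))"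
    by (rule measurable_compose[OF Sum_m]) (use nN in auto)
  have shift: "(\<integral>\<omega>. ?P \<omega> * T \<omega> \<partial>M) = (\<integral>\<omega>. ?P \<omega> * ?M n \<omega> \<partial>M)"
  proof -
    \<comment> \<open>The permuted sequence reads \<open>Y 1, ..., Y n, Y 0\<close>: its first
      \<open>n\<close> partial sums are those in \<open>T\<close>, while the sum of all
      \<open>n + 1\<close> increments, which determines the event, is unchanged.\<close>
    define \<sigma> where "\<sigma> = (\<lambda>i. if i < n then Suc i else if i = n then 0 else i)"
    have \<sigma>: "\<sigma> permutes {..<Suc n}"
    proof (rule bij_imp_permutes)
      show "bij_betw \<sigma> {..<Suc n} {..<Suc n}"
        by (rule bij_betwI[of _ _ _ "\<lambda>i. if i = 0 then n else i - 1"]) (auto simp: \<sigma>_def)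
    qed (auto simp: \<sigma>_def)
    define \<Phi> where "\<Phi> = (\<lambda>y::nat \<Rightarrow> real. indicat_real {0<..} (\<Sum>i<Suc n. y i) * (MAX k\<in>{..n}. \<Sum>i<k. y i))"
    have \<Phi>: "\<Phi> \<in> borel_measurable (PiM {..<N} (\<lambda>_. borel))"
      unfolding \<Phi>_def using nN
      by (intro borel_measurable_times borel_measurable_Max Pos_m Sum_m) auto
    have "(\<integral>\<omega>. ?P \<omega> * T \<omega> \<partial>M) = (\<integral>\<omega>. \<Phi> (\<lambda>k\<in>{..<N}. Y (\<sigma> k) \<omega>) \<partial>M)"
    proof (intro Bochner_Integration.integral_cong refl)
      fix \<omega>
      have 1: "(\<Sum>i<Suc n. (\<lambda>k\<in>{..<N}. Y (\<sigma> k) \<omega>) i) = ?S (Suc n) \<omega>"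
        unfolding sumperm[OF \<sigma>, symmetric] using nN by (intro sum.cong) auto
      have 2: "(\<Sum>i<k. (\<lambda>k\<in>{..<N}. Y (\<sigma> k) \<omega>) i) = (\<Sum>i<k. Y (Suc i) \<omega>)" if "k \<in> {..n}" for k
        using that nN by (intro sum.cong) (auto simp: \<sigma>_def)
      have 3: "(MAX k\<in>{..n}. \<Sum>i<k. (\<lambda>k\<in>{..<N}. Y (\<sigma> k) \<omega>) i) = T \<omega>"
        unfolding T_def by (intro arg_cong[of _ _ Max] image_cong refl 2)
      show "?P \<omega> * T \<omega> = \<Phi> (\<lambda>k\<in>{..<N}. Y (\<sigma> k) \<omega>)"
        unfolding \<Phi>_def 1 3 by (simp add: indicator_def del: sum.lessThan_Suc)
    qed
    also have "\<dots> = (\<integral>\<omega>. \<Phi> (\<lambda>k\<in>{..<N}. Y k \<omega>) \<partial>M)" by (rule exch[OF perm[OF \<sigma>] \<Phi>])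
    also have "\<dots> = (\<integral>\<omega>. ?P \<omega> * ?M n \<omega> \<partial>M)"
    proof (intro Bochner_Integration.integral_cong refl)
      fix \<omega>
      have 2: "(\<Sum>i<k. (\<lambda>k\<in>{..<N}. Y k \<omega>) i) = ?S k \<omega>" if "k \<le> Suc n" for k
        using that nN by (intro sum.cong) auto
      have 3: "(MAX k\<in>{..n}. \<Sum>i<k. (\<lambda>k\<in>{..<N}. Y k \<omega>) i) = ?M n \<omega>"
        by (intro arg_cong[of _ _ Max] image_cong refl 2) auto
      show "\<Phi> (\<lambda>k\<in>{..<N}. Y k \<omega>) = ?P \<omega> * ?M n \<omega>"
        unfolding \<Phi>_def 2[OF order_refl] 3 by (simp add: indicator_def del: sum.lessThan_Suc)
    qed
    finally show ?thesis .
  qed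
  \<comment> \<open>Swapping increments 0 and \<open>i\<close> preserves the event, so all
    \<open>n + 1\<close> increments contribute equally to the mean positive part; this is the origin
    of the divisor \<open>k\<close> in the identity.\<close>
  have first: "(\<integral>\<omega>. ?P \<omega> * Y i \<omega> \<partial>M) = (\<integral>\<omega>. ?P \<omega> * Y 0 \<omega> \<partial>M)" if i: "i < Suc n" for i
  proof -
    define \<sigma> where "\<sigma> = Transposition.transpose 0 i"
    have \<sigma>: "\<sigma> permutes {..<Suc n}" unfolding \<sigma>_def using i by (intro permutes_swap_id) auto
    define \<Phi> where "\<Phi> = (\<lambda>y::nat \<Rightarrow> real. indicat_real {0<..} (\<Sum>i<Suc n. y i) * y 0)"
    have \<Phi>: "\<Phi> \<in> borel_measurable (PiM {..<N} (\<lambda>_. borel))"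
      unfolding \<Phi>_def using nN
      by (intro borel_measurable_times Pos_m measurable_component_singleton) auto
    have "(\<integral>\<omega>. ?P \<omega> * Y i \<omega> \<partial>M) = (\<integral>\<omega>. \<Phi> (\<lambda>k\<in>{..<N}. Y (\<sigma> k) \<omega>) \<partial>M)"
    proof (intro Bochner_Integration.integral_cong refl)
      fix \<omega>
      have 1: "(\<Sum>i<Suc n. (\<lambda>k\<in>{..<N}. Y (\<sigma> k) \<omega>) i) = ?S (Suc n) \<omega>"
        unfolding sumperm[OF \<sigma>, symmetric] using nN by (intro sum.cong) auto
      show "?P \<omega> * Y i \<omega> = \<Phi> (\<lambda>k\<in>{..<N}. Y (\<sigma> k) \<omega>)"
        unfolding \<Phi>_def 1 using nN by (simp add: indicator_def \<sigma>_def del: sum.lessThan_Suc)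
    qed
    also have "\<dots> = (\<integral>\<omega>. \<Phi> (\<lambda>k\<in>{..<N}. Y k \<omega>) \<partial>M)" by (rule exch[OF perm[OF \<sigma>] \<Phi>])
    also have "\<dots> = (\<integral>\<omega>. ?P \<omega> * Y 0 \<omega> \<partial>M)"
    proof (intro Bochner_Integration.integral_cong refl)
      fix \<omega>
      have 2: "(\<Sum>i<Suc n. (\<lambda>k\<in>{..<N}. Y k \<omega>) i) = ?S (Suc n) \<omega>"
        using nN by (intro sum.cong) auto
      show "\<Phi> (\<lambda>k\<in>{..<N}. Y k \<omega>) = ?P \<omega> * Y 0 \<omega>"
        unfolding \<Phi>_def 2 using nN by (simp add: indicator_def del: sum.lessThan_Suc)
    qed
    finally show ?thesis .
  qed
  have "(\<integral>\<omega>. max 0 (?S (Suc n) \<omega>) \<partial>M) = (\<integral>\<omega>. (\<Sum>i<Suc n. ?P \<omega> * Y i \<omega>) \<partial>M)"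
    by (intro Bochner_Integration.integral_cong refl) (auto simp: indicator_def sum_distrib_left[symmetric] simp del: sum.lessThan_Suc)
  also have "\<dots> = (\<Sum>i<Suc n. \<integral>\<omega>. ?P \<omega> * Y i \<omega> \<partial>M)"
    using nN by (intro Bochner_Integration.integral_sum intP int) auto
  also have "\<dots> = (\<Sum>i<Suc n. \<integral>\<omega>. ?P \<omega> * Y 0 \<omega> \<partial>M)" by (intro sum.cong first) auto
  finally have mean: "(\<integral>\<omega>. ?P \<omega> * Y 0 \<omega> \<partial>M) = (\<integral>\<omega>. max 0 (?S (Suc n) \<omega>) \<partial>M) / Suc n"
    by (simp del: sum.lessThan_Suc of_nat_Suc)
  have "(\<integral>\<omega>. ?M (Suc n) \<omega> \<partial>M) = (\<integral>\<omega>. ?P \<omega> * Y 0 \<omega> + ?P \<omega> * T \<omega> + (?M n \<omega> - ?P \<omega> * ?M n \<omega>) \<partial>M)"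
    by (intro Bochner_Integration.integral_cong refl split)
  also have "\<dots> = (\<integral>\<omega>. ?P \<omega> * Y 0 \<omega> \<partial>M) + (\<integral>\<omega>. ?P \<omega> * T \<omega> \<partial>M) + ((\<integral>\<omega>. ?M n \<omega> \<partial>M) - (\<integral>\<omega>. ?P \<omega> * ?M n \<omega> \<partial>M))"
  proof -
    have i: "integrable M (\<lambda>\<omega>. ?P \<omega> * Y 0 \<omega>)" "integrable M (\<lambda>\<omega>. ?P \<omega> * T \<omega>)"
      "integrable M (?M n)" "integrable M (\<lambda>\<omega>. ?P \<omega> * ?M n \<omega>)"
      using nN by (intro intP int intT intM; simp)+
    show ?thesis
      unfolding Bochner_Integration.integral_add[OF Bochner_Integration.integrable_add[OF i(1,2)] Bochner_Integration.integrable_diff[OF i(3,4)]]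
        Bochner_Integration.integral_add[OF i(1,2)] Bochner_Integration.integral_diff[OF i(3,4)] ..
  qed
  also have "\<dots> = (\<integral>\<omega>. ?M n \<omega> \<partial>M) + (\<integral>\<omega>. max 0 (?S (Suc n) \<omega>) \<partial>M) / Suc n"
    unfolding shift mean by simp
  also have "\<dots> = (\<Sum>k=1..Suc n. (\<integral>\<omega>. max 0 (?S k \<omega>) \<partial>M) / k)"
    using Suc by (simp del: sum.lessThan_Suc of_nat_Suc)
  finally show ?case .
qed simp

end

text \<open>A Riemann sum for the integral of \<open>x powr (a - 1)\<close> over the unit interval.
  The mean value theorem compares its terms with differences of \<open>k powr a\<close>, and these
  telescope.\<close>

lemma sum_powr_limit:
  fixes a :: real
  assumes a: "0 < a" "a \<le> 1"
  shows "(\<lambda>N. \<Sum>k=1..N. (real k / real N) powr a / real k) \<longlonglongrightarrow> 1 / a"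
proof (rule tendsto_sandwich)
  have d: "((\<lambda>x. x powr a) has_real_derivative a * x powr (a - 1)) (at x)" if "0 < x" for x
    using that by (auto intro!: derivative_eq_intros simp: powr_diff field_simps)
  have up: "a * real k powr (a - 1) \<le> real k powr a - real (k - 1) powr a" if k: "1 \<le> k" for k
  \<comment> \<open>The mean value theorem needs \<open>k - 1 > 0\<close>, since differentiability
    is available at positive points only; for \<open>k = 1\<close> the claim is
    \<open>a \<le> 1\<close>.\<close>
  proof (cases "k = 1")
    case True
    then show ?thesis using a by simp
  next
    case False
    then have k2: "0 < real (k - 1)" "real (k - 1) < real k" using k by auto
    have "\<exists>z>real (k - 1). z < real k \<and> real k powr a - real (k - 1) powr a = (real k - real (k - 1)) * (a * z powr (a - 1))"
      by (rule MVT2[OF k2(2) d]) (use k2 in linarith)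
    then obtain z where z: "z > real (k - 1)" "z < real k" "real k powr a - real (k - 1) powr a = (real k - real (k - 1)) * (a * z powr (a - 1))"
      by blast
    have "real k powr (a - 1) \<le> z powr (a - 1)" using z k2 a by (intro powr_mono2') auto
    then have "a * real k powr (a - 1) \<le> a * z powr (a - 1)" using a by (intro mult_left_mono) auto
    moreover have "real k - real (k - 1) = 1" using k by (simp add: of_nat_diff)
    ultimately show ?thesis using z(3) by simp
  qed
  have low: "real (k + 1) powr a - real k powr a \<le> a * real k powr (a - 1)" if k: "1 \<le> k" for k
  proof -
    have k2: "0 < real k" "real k < real (k + 1)" using k by auto
    have "\<exists>z>real k. z < real (k + 1) \<and> real (k + 1) powr a - real k powr a = (real (k + 1) - real k) * (a * z powr (a - 1))"
      by (rule MVT2[OF k2(2) d]) (use k2 in linarith)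
    then obtain z where z: "z > real k" "z < real (k + 1)" "real (k + 1) powr a - real k powr a = (real (k + 1) - real k) * (a * z powr (a - 1))"
      by blast
    have "z powr (a - 1) \<le> real k powr (a - 1)" using z k2 a by (intro powr_mono2') auto
    then show ?thesis using z(3) a by (simp add: mult_left_mono)
  qed
  have tele1: "(\<Sum>k=1..N. real k powr a - real (k - 1) powr a) = real N powr a" for N
    by (induction N) auto
  have tele2: "(\<Sum>k=1..N. real (k + 1) powr a - real k powr a) = real (N + 1) powr a - 1" for N
    by (induction N) auto
  have eq: "(\<Sum>k=1..N. (real k / real N) powr a / real k) = (\<Sum>k=1..N. a * real k powr (a - 1)) / (a * real N powr a)" if "0 < N" for N
    unfolding sum_divide_distrib using that a
    by (intro sum.cong refl) (auto simp: powr_divide powr_diff field_simps)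
  have U: "(\<Sum>k=1..N. (real k / real N) powr a / real k) \<le> 1 / a" if N: "0 < N" for N
  proof -
    have "(\<Sum>k=1..N. a * real k powr (a - 1)) \<le> (\<Sum>k=1..N. real k powr a - real (k - 1) powr a)"
      by (intro sum_mono up) auto
    then have "(\<Sum>k=1..N. a * real k powr (a - 1)) \<le> real N powr a" by (simp only: tele1)
    then have "(\<Sum>k=1..N. a * real k powr (a - 1)) / (a * real N powr a) \<le> real N powr a / (a * real N powr a)"
      using a by (intro divide_right_mono) auto
    also have "\<dots> = 1 / a" using N a by simp
    finally show ?thesis unfolding eq[OF N] .
  qed
  have Lo: "(1 - real N powr - a) / a \<le> (\<Sum>k=1..N. (real k / real N) powr a / real k)" if N: "0 < N" for N
  proof -
    have "(\<Sum>k=1..N. real (k + 1) powr a - real k powr a) \<le> (\<Sum>k=1..N. a * real k powr (a - 1))"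
      by (intro sum_mono low) auto
    then have "real (N + 1) powr a - 1 \<le> (\<Sum>k=1..N. a * real k powr (a - 1))" by (simp only: tele2)
    moreover have "real N powr a \<le> real (N + 1) powr a" using a by (intro powr_mono2) auto
    ultimately have "(real N powr a - 1) / (a * real N powr a) \<le> (\<Sum>k=1..N. a * real k powr (a - 1)) / (a * real N powr a)"
      using a by (intro divide_right_mono) auto
    moreover have "(1 - real N powr - a) / a = (real N powr a - 1) / (a * real N powr a)"
      using N a by (simp add: powr_minus field_simps)
    ultimately show ?thesis using eq[OF N] by simp
  qed
  show "\<forall>\<^sub>F N in sequentially. (\<Sum>k=1..N. (real k / real N) powr a / real k) \<le> 1 / a"
    using eventually_gt_at_top[of 0] by eventually_elim (rule U)
  show "\<forall>\<^sub>F N in sequentially. (1 - real N powr - a) / a \<le> (\<Sum>k=1..N. (real k / real N) powr a / real k)"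
    using eventually_gt_at_top[of 0] by eventually_elim (rule Lo)
  have "(\<lambda>N. real N powr - a) \<longlonglongrightarrow> 0"
    by (rule tendsto_neg_powr[OF _ filterlim_real_sequentially]) (use a in simp)
  then have "(\<lambda>N. (1 - real N powr - a) / a) \<longlonglongrightarrow> (1 - 0) / a" using a by (intro tendsto_intros) auto
  then show "(\<lambda>N. (1 - real N powr - a) / a) \<longlonglongrightarrow> 1 / a" by simp
qed simp

lemma (in prob_space) indep_vars_reindex:
  assumes f: "inj_on f I" and ind: "indep_vars M' X (f ` I)"
  shows "indep_vars (\<lambda>i. M' (f i)) (\<lambda>i. X (f i)) I"
  unfolding indep_vars_def2
proof
  let ?F = "\<lambda>i. {X i -` A \<inter> space M | A. A \<in> sets (M' i)}"
  show rv: "\<forall>i\<in>I. random_variable (M' (f i)) (X (f i))" using ind by (auto simp: indep_vars_def2)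
  have F: "indep_sets ?F (f ` I)" using ind by (simp add: indep_vars_def2)
  show "indep_sets (\<lambda>i. ?F (f i)) I"
  proof (rule indep_setsI)
    fix A J assume J: "J \<noteq> {}" "J \<subseteq> I" "finite J" "\<forall>j\<in>J. A j \<in> ?F (f j)"
    have inj: "inj_on f J" using f J(2) by (rule inj_on_subset)
    define A' where "A' = (\<lambda>k. A (inv_into J f k))"
    have A': "A' (f j) = A j" if "j \<in> J" for j using inj that by (simp add: A'_def)
    have "prob (\<Inter>k\<in>f ` J. A' k) = (\<Prod>k\<in>f ` J. prob (A' k))"
      using J A' by (intro indep_setsD[OF F]) auto
    then show "prob (\<Inter>j\<in>J. A j) = (\<Prod>j\<in>J. prob (A j))"
      using A' by (simp add: prod.reindex[OF inj])
  qed (use rv in \<open>auto simp: measurable_sets\<close>)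
qed

section \<open>Increments of the process on time grids\<close>

locale stable_process = prob_space M
  for M :: "'w measure" and X :: "real \<Rightarrow> 'w \<Rightarrow> real^'d" and \<alpha> :: real +
  assumes alpha: "1 < \<alpha>"
    and levy: "\<And>j. sas_levy M \<alpha> (\<lambda>t \<omega>. X t \<omega> $ j)"
    and indep_paths: "indep_vars (\<lambda>_. PiM UNIV (\<lambda>_::real. borel)) (\<lambda>j \<omega> t. X t \<omega> $ j) UNIV"
begin

lemma borel_measurable_component: "0 \<le> t \<Longrightarrow> (\<lambda>\<omega>. X t \<omega> $ j) \<in> borel_measurable M"
  using levy[of j] by (simp add: sas_levy_def)

lemma borel_measurable_process: "0 \<le> t \<Longrightarrow> X t \<in> borel_measurable M"
  using borel_measurable_component
  by (subst borel_measurable_euclidean_space) (auto simp: Basis_vec_def inner_axis)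

lemma process_0: "\<omega> \<in> space M \<Longrightarrow> X 0 \<omega> = 0"
  using levy by (simp add: sas_levy_def vec_eq_iff)

lemma char_component: "0 \<le> t \<Longrightarrow> char (distr M borel (\<lambda>\<omega>. X t \<omega> $ j)) s = complex_of_real (exp (- t * \<bar>s\<bar> powr \<alpha>))"
  using levy[of j] by (simp add: sas_levy_def)

lemma right_tendsto:
  assumes "\<omega> \<in> space M" "0 \<le> t"
  shows "((\<lambda>s. X s \<omega>) \<longlongrightarrow> X t \<omega>) (at_right t)"
  using levy assms by (intro vec_tendstoI) (auto simp: sas_levy_def continuous_within)

lemma left_limit:
  assumes "\<omega> \<in> space M" "0 < t"
  obtains l where "((\<lambda>s. X s \<omega>) \<longlongrightarrow> l) (at_left t)"
proof -
  have "\<forall>j. \<exists>l. ((\<lambda>s. X s \<omega> $ j) \<longlongrightarrow> l) (at_left t)"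
    using levy assms by (auto simp: sas_levy_def)
  then obtain l where "\<And>j. ((\<lambda>s. X s \<omega> $ j) \<longlongrightarrow> l j) (at_left t)" by metis
  then have "((\<lambda>s. X s \<omega>) \<longlongrightarrow> (\<chi> j. l j)) (at_left t)" by (intro vec_tendstoI) simp
  then show thesis by (rule that)
qed

definition incr :: "real \<Rightarrow> 'd \<Rightarrow> nat \<Rightarrow> 'w \<Rightarrow> real" where
  "incr h j k \<omega> = X (real (Suc k) * h) \<omega> $ j - X (real k * h) \<omega> $ j"

lemma sum_incr:
  "\<omega> \<in> space M \<Longrightarrow> (\<Sum>i<k. incr h j i \<omega>) = X (real k * h) \<omega> $ j"
  using sum_lessThan_telescope[of "\<lambda>i. X (real i * h) \<omega> $ j" k] by (simp add: incr_def process_0)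

lemma borel_measurable_incr: "0 \<le> h \<Longrightarrow> incr h j k \<in> borel_measurable M"
  unfolding incr_def[abs_def] by (intro borel_measurable_diff borel_measurable_component) auto

lemma char_incr:
  assumes "0 \<le> h"
  shows "char (distr M borel (incr h j k)) s = complex_of_real (exp (- h * \<bar>s\<bar> powr \<alpha>))"
proof -
  have "\<forall>s t. 0 \<le> s \<and> s \<le> t \<longrightarrow> distr M borel (\<lambda>\<omega>. X t \<omega> $ j - X s \<omega> $ j) = distr M borel (\<lambda>\<omega>. X (t - s) \<omega> $ j)"
    using levy[of j] by (simp add: sas_levy_def)
  then have "distr M borel (incr h j k) = distr M borel (\<lambda>\<omega>. X (real (Suc k) * h - real k * h) \<omega> $ j)"
    using assms unfolding incr_def[abs_def] by (auto simp: mult_right_mono)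
  also have "real (Suc k) * h - real k * h = h" by (simp add: algebra_simps)
  finally show ?thesis using char_component[OF assms] by simp
qed

lemma indep_incr:
  assumes "0 \<le> h"
  shows "indep_vars (\<lambda>_. borel) (incr h j) {..<N}"
proof -
  define ts where "ts = map (\<lambda>k. real k * h) [0..<Suc N]"
  have "sorted ts" unfolding ts_def using assms
    by (auto simp: sorted_iff_nth_mono nth_append mult_right_mono simp del: upt_Suc)
  moreover have "\<forall>t\<in>set ts. 0 \<le> t" unfolding ts_def using assms by (auto simp del: upt_Suc)
  ultimately have "indep_vars (\<lambda>_. borel) (\<lambda>i \<omega>. X (ts ! Suc i) \<omega> $ j - X (ts ! i) \<omega> $ j) {..<length ts - 1}"
    using levy[of j] unfolding sas_levy_def by blast
  moreover have "length ts - 1 = N" by (simp add: ts_def)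
  ultimately have "indep_vars (\<lambda>_. borel) (\<lambda>i \<omega>. X (ts ! Suc i) \<omega> $ j - X (ts ! i) \<omega> $ j) {..<N}" by simp
  then show ?thesis
    by (rule indep_vars_cong[THEN iffD1, rotated -1])
       (auto simp: ts_def incr_def fun_eq_iff simp del: upt_Suc)
qed

text \<open>Both arrays have independent entries with one common law, fixed by its characteristic
  function: scaling by \<open>c\<close> multiplies the time step by \<open>c powr \<alpha>\<close>.
  The statement joins exchangeability of the increments (\<open>c = 1\<close>) and self-similarity
  (identity permutation).\<close>

lemma grid_law:
  assumes h: "0 \<le> h" and c: "0 \<le> c" "c powr \<alpha> * h = h'" and \<sigma>: "\<sigma> permutes {..<N}" and N: "0 < N"
  shows "distr M (PiM UNIV (\<lambda>_. PiM {..<N} (\<lambda>_. borel))) (\<lambda>\<omega> j. \<lambda>k\<in>{..<N}. c * incr h j (\<sigma> k) \<omega>)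
       = distr M (PiM UNIV (\<lambda>_. PiM {..<N} (\<lambda>_. borel))) (\<lambda>\<omega> j. \<lambda>k\<in>{..<N}. incr h' j k \<omega>)"
proof -
  have h': "0 \<le> h'" using h c by (metis mult_nonneg_nonneg powr_ge_zero)
  \<comment> \<open>The common law is named by an arbitrary coordinate, \<open>undefined\<close>,
    and the first increment, so that both sides reduce to the same product measure.\<close>
  have gen: "distr M (PiM UNIV (\<lambda>_. PiM {..<N} (\<lambda>_. borel))) (\<lambda>\<omega> j. \<lambda>k\<in>{..<N}. c * incr h j (\<sigma> k) \<omega>)
      = PiM UNIV (\<lambda>_. PiM {..<N} (\<lambda>_. distr M borel (incr h' undefined 0)))"
    if h: "0 \<le> h" and c: "0 \<le> c" "c powr \<alpha> * h = h'" and \<sigma>: "\<sigma> permutes {..<N}" for c h \<sigma>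
  proof (rule nested_product_law[OF _ _ _ N])
    have \<sigma>N: "\<sigma> k < N" if "k < N" for k using permutes_in_image[OF \<sigma>, of k] that by simp
    show "indep_vars (\<lambda>_. PiM {..<N} (\<lambda>_. borel)) (\<lambda>j \<omega>. \<lambda>k\<in>{..<N}. c * incr h j (\<sigma> k) \<omega>) UNIV"
    proof -
      have "indep_vars (\<lambda>_. PiM {..<N} (\<lambda>_. borel))
          (\<lambda>j \<omega>. (\<lambda>f. \<lambda>k\<in>{..<N}. c * (f (real (Suc (\<sigma> k)) * h) - f (real (\<sigma> k) * h))) (\<lambda>t. X t \<omega> $ j)) UNIV"
        by (rule indep_vars_compose2[OF indep_paths]) measurable
      then show ?thesis by (simp add: incr_def)
    qed
    show "indep_vars (\<lambda>_. borel) (\<lambda>k \<omega>. c * incr h j (\<sigma> k) \<omega>) {..<N}" for j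
    proof -
      have "indep_vars (\<lambda>_. borel) (\<lambda>k. incr h j (\<sigma> k)) {..<N}"
        using indep_vars_reindex[of \<sigma> "{..<N}" "\<lambda>_. borel" "incr h j"] permutes_image[OF \<sigma>] permutes_inj_on[OF \<sigma>] indep_incr[OF h]
        by simp
      then show ?thesis by (rule indep_vars_compose2) measurable
    qed
    show "distr M borel (\<lambda>\<omega>. c * incr h j (\<sigma> k) \<omega>) = distr M borel (incr h' undefined 0)" for j k
    proof (rule distr_eqI_char)
      show "(\<lambda>\<omega>. c * incr h j (\<sigma> k) \<omega>) \<in> borel_measurable M" "incr h' undefined 0 \<in> borel_measurable M"
        using borel_measurable_incr[OF h] borel_measurable_incr[OF h'] by auto
      fix s
      have "char (distr M borel (\<lambda>\<omega>. c * incr h j (\<sigma> k) \<omega>)) s = complex_of_real (exp (- h * \<bar>c * s\<bar> powr \<alpha>))"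
        using char_distr_scale[OF prob_space_axioms borel_measurable_incr[OF h]] char_incr[OF h] by simp
      also have "- h * \<bar>c * s\<bar> powr \<alpha> = - h' * \<bar>s\<bar> powr \<alpha>"
        using c by (simp add: abs_mult powr_mult flip: c(2))
      finally show "char (distr M borel (\<lambda>\<omega>. c * incr h j (\<sigma> k) \<omega>)) s = char (distr M borel (incr h' undefined 0)) s"
        using char_incr[OF h'] by simp
    qed
  qed
  have "(\<lambda>\<omega> j. \<lambda>k\<in>{..<N}. incr h' j k \<omega>) = (\<lambda>\<omega> j. \<lambda>k\<in>{..<N}. 1 * incr h' j (id k) \<omega>)" by simp
  then show ?thesis
    using gen[OF h c \<sigma>] gen[OF h', of 1 id] by (simp add: permutes_id)
qed

lemma measurable_grid:
  assumes "0 \<le> h"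
  shows "(\<lambda>\<omega> j. \<lambda>k\<in>{..<N}. c * incr h j (\<sigma> k) \<omega>) \<in> measurable M (PiM UNIV (\<lambda>_. PiM {..<N} (\<lambda>_. borel)))"
proof -
  have "(\<lambda>\<omega>. \<lambda>j\<in>UNIV. \<lambda>k\<in>{..<N}. c * incr h j (\<sigma> k) \<omega>) \<in> measurable M (PiM UNIV (\<lambda>_. PiM {..<N} (\<lambda>_. borel)))"
    by (rule measurable_restrict, rule measurable_restrict,
        rule borel_measurable_times[OF borel_measurable_const borel_measurable_incr[OF assms]])
  moreover have "(\<lambda>\<omega>. \<lambda>j\<in>UNIV. \<lambda>k\<in>{..<N}. c * incr h j (\<sigma> k) \<omega>) = (\<lambda>\<omega> j. \<lambda>k\<in>{..<N}. c * incr h j (\<sigma> k) \<omega>)"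
    by (auto simp: fun_eq_iff)
  ultimately show ?thesis by (simp only:)
qed

definition alpha_norm :: "real^'d \<Rightarrow> real" where
  "alpha_norm u = (\<Sum>j\<in>UNIV. \<bar>u $ j\<bar> powr \<alpha>) powr (1 / \<alpha>)"

lemma char_inner_process:
  assumes t: "0 \<le> t"
  shows "char (distr M borel (\<lambda>\<omega>. u \<bullet> X t \<omega>)) s = complex_of_real (exp (- (t * (\<Sum>j\<in>UNIV. \<bar>u $ j\<bar> powr \<alpha>)) * \<bar>s\<bar> powr \<alpha>))"
proof -
  have "indep_vars (\<lambda>_. borel) (\<lambda>j \<omega>. (\<lambda>f. u $ j * f t) (\<lambda>t. X t \<omega> $ j)) UNIV"
    by (rule indep_vars_compose2[OF indep_paths]) measurable
  then have "char (distr M borel (\<lambda>\<omega>. \<Sum>j\<in>UNIV. u $ j * X t \<omega> $ j)) s = (\<Prod>j\<in>UNIV. char (distr M borel (\<lambda>\<omega>. u $ j * X t \<omega> $ j)) s)"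
    by (intro char_distr_sum) simp
  also have "\<dots> = (\<Prod>j\<in>UNIV. complex_of_real (exp (- t * \<bar>u $ j * s\<bar> powr \<alpha>)))"
    using t by (intro prod.cong refl)
      (simp add: char_distr_scale[OF prob_space_axioms borel_measurable_component] char_component)
  also have "\<dots> = complex_of_real (exp (\<Sum>j\<in>UNIV. - t * \<bar>u $ j * s\<bar> powr \<alpha>))"
    by (simp add: exp_sum)
  also have "(\<Sum>j\<in>UNIV. - t * \<bar>u $ j * s\<bar> powr \<alpha>) = - (t * (\<Sum>j\<in>UNIV. \<bar>u $ j\<bar> powr \<alpha>)) * \<bar>s\<bar> powr \<alpha>"
    by (simp add: sum_distrib_left sum_distrib_right abs_mult powr_mult sum_negf mult.assoc)
  finally show ?thesis by (simp add: inner_vec_def)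
qed

text \<open>Any coordinate would do; \<open>undefined\<close> picks one, and
  \<open>mean_abs_eq\<close> removes the dependence.\<close>

definition mean_abs :: real where
  "mean_abs = expectation (\<lambda>\<omega>. \<bar>X 1 \<omega> $ undefined\<bar>)"

lemma mean_abs_eq: "expectation (\<lambda>\<omega>. \<bar>X 1 \<omega> $ j\<bar>) = mean_abs"
proof -
  have "distr M borel (\<lambda>\<omega>. X 1 \<omega> $ j) = distr M borel (\<lambda>\<omega>. X 1 \<omega> $ undefined)"
    by (intro distr_eqI_char) (auto simp: char_component borel_measurable_component)
  then show ?thesis unfolding mean_abs_def
    by (intro expectation_cong_distr(1)[where f = abs]) (auto simp: borel_measurable_component)
qed

lemma expectation_inner_positive:
  assumes t: "0 \<le> t"
  shows "integrable M (\<lambda>\<omega>. u \<bullet> X t \<omega>)"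
    "expectation (\<lambda>\<omega>. max 0 (u \<bullet> X t \<omega>)) = t powr (1 / \<alpha>) * alpha_norm u * mean_abs / 2"
proof -
  let ?v = "t * (\<Sum>j\<in>UNIV. \<bar>u $ j\<bar> powr \<alpha>)"
  have m: "(\<lambda>\<omega>. u \<bullet> X t \<omega>) \<in> borel_measurable M"
    using borel_measurable_process[OF t] by (intro borel_measurable_inner) auto
  have v: "0 \<le> ?v" using t by (intro mult_nonneg_nonneg sum_nonneg) auto
  have Y: "char (distr M borel (\<lambda>\<omega>. X 1 \<omega> $ undefined)) s = complex_of_real (exp (- (\<bar>s\<bar> powr \<alpha>)))" for s
    using char_component[of 1] by simp
  note * = stable_positive_part[OF borel_measurable_component[of 1 undefined] m alpha v Y char_inner_process[OF t]]
  show "integrable M (\<lambda>\<omega>. u \<bullet> X t \<omega>)" by (rule *(1)) simp_all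
  have "?v powr (1 / \<alpha>) = t powr (1 / \<alpha>) * alpha_norm u"
    unfolding alpha_norm_def by (rule powr_mult)
  then show "expectation (\<lambda>\<omega>. max 0 (u \<bullet> X t \<omega>)) = t powr (1 / \<alpha>) * alpha_norm u * mean_abs / 2"
    using *(2) by (simp add: mean_abs_def)
qed

text \<open>The increments of \<open>u \<bullet> X\<close> along an equidistant grid are
  exchangeable by \<open>grid_law\<close>. Spitzer's identity therefore reduces the maximum to
  positive parts of \<open>u \<bullet> X\<close> at single times, whose means are known from the
  stable law.\<close>

lemma expectation_grid_max:
  assumes N: "0 < N"
  shows "integrable M (\<lambda>\<omega>. MAX k\<in>{..N}. u \<bullet> X (real k / N) \<omega>)"
    "expectation (\<lambda>\<omega>. MAX k\<in>{..N}. u \<bullet> X (real k / N) \<omega>)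
      = alpha_norm u * mean_abs / 2 * (\<Sum>k=1..N. (real k / real N) powr (1 / \<alpha>) / real k)"
proof -
  define h where "h = 1 / real N"
  have h: "0 \<le> h" by (simp add: h_def)
  define Y where "Y = (\<lambda>k \<omega>. \<Sum>j\<in>UNIV. u $ j * incr h j k \<omega>)"
  have Yinner: "Y k = (\<lambda>\<omega>. u \<bullet> X (real (Suc k) * h) \<omega> - u \<bullet> X (real k * h) \<omega>)" for k
    unfolding Y_def incr_def inner_vec_def by (auto simp: fun_eq_iff sum_subtractf right_diff_distrib)
  have int: "integrable M (Y k)" for k
    unfolding Yinner using h by (intro Bochner_Integration.integrable_diff expectation_inner_positive) auto
  have S: "(\<Sum>i<k. Y i \<omega>) = u \<bullet> X (real k / N) \<omega>" if "\<omega> \<in> space M" for k \<omega>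
    using sum_lessThan_telescope[of "\<lambda>i. u \<bullet> X (real i * h) \<omega>" k] process_0[OF that] unfolding Yinner
    by (simp add: h_def)
  have exch: "(\<integral>\<omega>. \<Phi> (\<lambda>k\<in>{..<N}. Y (\<sigma> k) \<omega>) \<partial>M) = (\<integral>\<omega>. \<Phi> (\<lambda>k\<in>{..<N}. Y k \<omega>) \<partial>M)"
    if \<sigma>: "\<sigma> permutes {..<N}" and \<Phi>: "\<Phi> \<in> borel_measurable (PiM {..<N} (\<lambda>_. borel))"
    for \<sigma> and \<Phi> :: "(nat \<Rightarrow> real) \<Rightarrow> real"
  proof -
    let ?P = "PiM UNIV (\<lambda>_::'d. PiM {..<N} (\<lambda>_. borel :: real measure))"
    define \<Psi> where "\<Psi> = (\<lambda>z::'d \<Rightarrow> nat \<Rightarrow> real. \<Phi> (\<lambda>k\<in>{..<N}. \<Sum>j\<in>UNIV. u $ j * z j k))"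
    have \<Psi>: "\<Psi> \<in> borel_measurable ?P"
    proof -
      have "(\<lambda>z. z j k) \<in> borel_measurable ?P" if "k < N" for j k
        using that by (intro measurable_compose[OF measurable_component_singleton[of j] measurable_component_singleton[of k]]) auto
      then show ?thesis unfolding \<Psi>_def
        by (intro measurable_compose[OF _ \<Phi>] measurable_restrict borel_measurable_sum borel_measurable_times borel_measurable_const) auto
    qed
    have "(\<integral>\<omega>. \<Phi> (\<lambda>k\<in>{..<N}. Y (\<tau> k) \<omega>) \<partial>M) = (\<integral>z. \<Psi> z \<partial>distr M ?P (\<lambda>\<omega> j. \<lambda>k\<in>{..<N}. 1 * incr h j (\<tau> k) \<omega>))" for \<tau>
      by (subst integral_distr[OF measurable_grid[OF h] \<Psi>])
         (auto simp: \<Psi>_def Y_def intro!: Bochner_Integration.integral_cong arg_cong[of _ _ \<Phi>])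
    from this[of \<sigma>] this[of id] show ?thesis
      using grid_law[OF h, of 1 h \<sigma> N] grid_law[OF h, of 1 h id N] \<sigma> N by (simp add: permutes_id)
  qed
  have "integrable M (\<lambda>\<omega>. MAX k\<in>{..n}. u \<bullet> X (real k / N) \<omega>)" for n
  proof (induction n)
    case 0
    then show ?case using expectation_inner_positive(1)[of 0] by simp
  next
    case (Suc n)
    have "(\<lambda>\<omega>. MAX k\<in>{..Suc n}. u \<bullet> X (real k / N) \<omega>) = (\<lambda>\<omega>. max (u \<bullet> X (real (Suc n) / N) \<omega>) (MAX k\<in>{..n}. u \<bullet> X (real k / N) \<omega>))"
      unfolding atMost_Suc by (subst image_insert, subst Max_insert) auto
    then show ?case using Suc expectation_inner_positive(1)[of "real (Suc n) / N"] by (simp del: of_nat_Suc)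
  qed
  then show "integrable M (\<lambda>\<omega>. MAX k\<in>{..N}. u \<bullet> X (real k / N) \<omega>)" .
  have "expectation (\<lambda>\<omega>. MAX k\<in>{..N}. u \<bullet> X (real k / N) \<omega>) = (\<integral>\<omega>. (MAX k\<in>{..N}. \<Sum>i<k. Y i \<omega>) \<partial>M)"
    by (intro Bochner_Integration.integral_cong refl) (simp add: S)
  also have "\<dots> = (\<Sum>k=1..N. (\<integral>\<omega>. max 0 (\<Sum>i<k. Y i \<omega>) \<partial>M) / k)"
    by (rule spitzer_exchangeable[OF int exch order_refl])
  also have "\<dots> = (\<Sum>k=1..N. (real k / real N) powr (1 / \<alpha>) * alpha_norm u * mean_abs / 2 / k)"
  proof (intro sum.cong refl arg_cong[of _ _ "\<lambda>x. x / _"])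
    fix k
    have "(\<integral>\<omega>. max 0 (\<Sum>i<k. Y i \<omega>) \<partial>M) = expectation (\<lambda>\<omega>. max 0 (u \<bullet> X (real k / N) \<omega>))"
      by (intro Bochner_Integration.integral_cong refl) (simp add: S)
    then show "(\<integral>\<omega>. max 0 (\<Sum>i<k. Y i \<omega>) \<partial>M) = (real k / real N) powr (1 / \<alpha>) * alpha_norm u * mean_abs / 2"
      using expectation_inner_positive(2)[of "real k / N" u] by simp
  qed
  also have "\<dots> = alpha_norm u * mean_abs / 2 * (\<Sum>k=1..N. (real k / real N) powr (1 / \<alpha>) / real k)"
    unfolding sum_distrib_left by (intro sum.cong) (auto simp: mult_ac)
  finally show "expectation (\<lambda>\<omega>. MAX k\<in>{..N}. u \<bullet> X (real k / N) \<omega>)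
      = alpha_norm u * mean_abs / 2 * (\<Sum>k=1..N. (real k / real N) powr (1 / \<alpha>) / real k)" .
qed

end

section \<open>The range of a stable process\<close>

definition dyadic_grid :: "nat \<Rightarrow> real set" where
  "dyadic_grid n = (\<lambda>k. real k / 2 ^ n) ` {..2 ^ n}"

lemma finite_dyadic_grid: "finite (dyadic_grid n)" and zero_in_dyadic_grid: "0 \<in> dyadic_grid n" and one_in_dyadic_grid: "1 \<in> dyadic_grid n"
  unfolding dyadic_grid_def by (auto intro!: image_eqI[of _ _ "0::nat"] image_eqI[of _ _ "2 ^ n :: nat"])

lemma dyadic_grid_unit: "d \<in> dyadic_grid n \<Longrightarrow> 0 \<le> d \<and> d \<le> 1"
proof -
  assume "d \<in> dyadic_grid n"
  then obtain k where k: "k \<le> 2 ^ n" "d = real k / 2 ^ n" by (auto simp: dyadic_grid_def)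
  have "real k \<le> real (2 ^ n)" using k(1) by (simp only: of_nat_le_iff)
  then show ?thesis using k(2) by simp
qed

lemma incseq_dyadic_grid: "incseq dyadic_grid"
proof (rule incseq_SucI, rule subsetI)
  fix n d assume "d \<in> dyadic_grid n"
  then obtain k where k: "k \<le> 2 ^ n" "d = real k / 2 ^ n" by (auto simp: dyadic_grid_def)
  then have "d = real (2 * k) / 2 ^ Suc n" "2 * k \<le> 2 ^ Suc n" by auto
  then show "d \<in> dyadic_grid (Suc n)" unfolding dyadic_grid_def by blast
qed

lemma countable_UN_dyadic_grid: "countable (\<Union>n. dyadic_grid n)"
  by (intro countable_UN) (auto intro: countable_finite finite_dyadic_grid)

lemma dyadic_between:
  assumes "0 \<le> x" "x < y" "y \<le> 1"
  obtains n d where "d \<in> dyadic_grid n" "x < d" "d < y"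
proof -
  obtain n where n: "(1 / 2) ^ n < y - x" using real_arch_pow_inv[of "y - x" "1 / 2"] assms by auto
  define k where "k = nat \<lfloor>2 ^ n * x\<rfloor> + 1"
  have k: "real k - 1 \<le> 2 ^ n * x" "2 ^ n * x < real k"
    unfolding k_def using assms by (auto simp: floor_le_iff) linarith
  have xd: "x < real k / 2 ^ n" using k by (simp add: pos_less_divide_eq mult.commute)
  have "real k / 2 ^ n \<le> x + (1 / 2) ^ n"
    using k by (simp add: pos_divide_le_eq algebra_simps power_divide)
  then have dy: "real k / 2 ^ n < y" using n by simp
  then have "real k / 2 ^ n < 1" using assms(3) by (rule less_le_trans)
  then have "real k < real (2 ^ n)" by (simp add: pos_divide_less_eq)
  then have "k \<le> 2 ^ n" by (simp only: of_nat_less_iff less_imp_le)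
  then show thesis using xd dy that[of "real k / 2 ^ n" n] by (auto simp: dyadic_grid_def)
qed

lemma right_continuous_dyadic:
  fixes f :: "real \<Rightarrow> 'b::topological_space"
  assumes rc: "\<And>s. 0 \<le> s \<Longrightarrow> (f \<longlongrightarrow> f s) (at_right s)" and t: "0 < t" and s: "0 \<le> s" "s \<le> t"
    and U: "open U" "f s \<in> U"
  obtains n d where "d \<in> dyadic_grid n" "f (t * d) \<in> U"
proof (cases "s = t")
  case True
  then show thesis using that[OF one_in_dyadic_grid[of 0]] U by simp
next
  case False
  then have "s < t" using s by simp
  have "\<forall>\<^sub>F r in at_right s. f r \<in> U" using topological_tendstoD[OF rc[OF s(1)] U] .
  then obtain b where b: "s < b" "\<And>r. s < r \<Longrightarrow> r < b \<Longrightarrow> f r \<in> U"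
    by (auto simp: eventually_at_right_field)
  have "s / t < min b t / t" using b \<open>s < t\<close> t by (intro divide_strict_right_mono) auto
  then obtain n d where d: "d \<in> dyadic_grid n" "s / t < d" "d < min b t / t"
    by (rule dyadic_between[rotated]) (use s t in \<open>auto simp: divide_le_eq\<close>)
  have "s < t * d" "t * d < b" using d t by (auto simp: field_simps)
  then show thesis using that d(1) b(2) by blast
qed

text \<open>Around each time the path is bounded to the right by right continuity and to the left by
  the left limit; compactness of the interval selects finitely many such neighbourhoods.\<close>

lemma bounded_cadlag_image:
  fixes f :: "real \<Rightarrow> 'b::real_normed_vector"
  assumes rc: "\<And>s. 0 \<le> s \<Longrightarrow> (f \<longlongrightarrow> f s) (at_right s)"
    and ll: "\<And>s. 0 < s \<Longrightarrow> \<exists>l. (f \<longlongrightarrow> l) (at_left s)"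
  shows "bounded (f ` {0..t})"
proof -
  have loc: "\<exists>U. open U \<and> s \<in> U \<and> bounded (f ` (U \<inter> {0..}))" if s: "s \<in> {0..t}" for s
  proof -
    have "\<forall>\<^sub>F r in at_right s. f r \<in> ball (f s) 1"
      using s by (intro topological_tendstoD[OF rc]) auto
    then obtain b where b: "s < b" "\<And>r. s < r \<Longrightarrow> r < b \<Longrightarrow> f r \<in> ball (f s) 1"
      by (auto simp: eventually_at_right_field)
    obtain a B where a: "a < s" "bounded B" "\<And>r. a < r \<Longrightarrow> r < s \<Longrightarrow> 0 \<le> r \<Longrightarrow> f r \<in> B"
    proof (cases "s = 0")
      case True
      \<comment> \<open>No nonnegative times precede 0, so the empty set bounds the path
        there.\<close>
      then show thesis using that[of "-1" "{}"] by auto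
    next
      case False
      then obtain l where "(f \<longlongrightarrow> l) (at_left s)" using ll s by force
      then have "\<forall>\<^sub>F r in at_left s. f r \<in> ball l 1" by (rule topological_tendstoD) auto
      then obtain a where "a < s" "\<And>r. a < r \<Longrightarrow> r < s \<Longrightarrow> f r \<in> ball l 1"
        by (auto simp: eventually_at_left_field)
      then show thesis using that[of a "ball l 1"] by auto
    qed
    have "f ` ({a<..<b} \<inter> {0..}) \<subseteq> B \<union> {f s} \<union> ball (f s) 1"
    proof (rule image_subsetI)
      fix r assume r: "r \<in> {a<..<b} \<inter> {0..}"
      then show "f r \<in> B \<union> {f s} \<union> ball (f s) 1"
        using a(3)[of r] b(2)[of r] by (cases r s rule: linorder_cases) auto
    qed
    then have "bounded (f ` ({a<..<b} \<inter> {0..}))" by (rule bounded_subset[rotated]) (simp add: a(2))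
    then show ?thesis using a(1) b(1) by (intro exI[of _ "{a<..<b}"]) auto
  qed
  then obtain U where U: "\<And>s. s \<in> {0..t} \<Longrightarrow> open (U s) \<and> s \<in> U s \<and> bounded (f ` (U s \<inter> {0..}))" by metis
  obtain D where D: "D \<subseteq> {0..t}" "finite D" "{0..t} \<subseteq> (\<Union>s\<in>D. U s)"
    by (rule compactE_image[OF compact_Icc, of "{0..t}" U]) (use U in blast)+
  have "f ` {0..t} \<subseteq> (\<Union>s\<in>D. f ` (U s \<inter> {0..}))" using D(3) by fastforce
  moreover have "bounded (\<Union>s\<in>D. f ` (U s \<inter> {0..}))" using D U by (intro bounded_UN) auto
  ultimately show ?thesis by (rule bounded_subset[rotated])
qed

context stable_process
begin

lemma bounded_path: "\<omega> \<in> space M \<Longrightarrow> bounded ((\<lambda>s. X s \<omega>) ` {0..t})"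
  using right_tendsto left_limit by (intro bounded_cadlag_image) blast+

text \<open>Countability makes suprema and infima over the path measurable. Indexing times as
  \<open>t * d\<close> with fixed \<open>d\<close> makes grids for different \<open>t\<close>
  correspond entry by entry, as the comparison of laws requires.\<close>

definition skeleton :: "real \<Rightarrow> 'w \<Rightarrow> (real^'d) set" where
  "skeleton t \<omega> = (\<lambda>d. X (t * d) \<omega>) ` (\<Union>n. dyadic_grid n)"

lemma zero_in_skeleton: "\<omega> \<in> space M \<Longrightarrow> 0 \<in> skeleton t \<omega>"
  using zero_in_dyadic_grid unfolding skeleton_def
  by (auto simp: process_0 intro!: image_eqI[of _ _ 0])

lemma skeleton_subset: "0 \<le> t \<Longrightarrow> skeleton t \<omega> \<subseteq> (\<lambda>s. X s \<omega>) ` {0..t}"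
  using dyadic_grid_unit unfolding skeleton_def by (auto simp: mult_left_le)

text \<open>Right continuity approximates each value from later dyadic times; only the endpoint has
  none left, and it is itself in the skeleton because 1 is a grid point.\<close>

lemma closure_skeleton:
  assumes "\<omega> \<in> space M" "0 < t"
  shows "closure (skeleton t \<omega>) = range_set X t \<omega>"
  unfolding range_set_def
proof (rule antisym)
  show "closure (skeleton t \<omega>) \<subseteq> closure ((\<lambda>s. X s \<omega>) ` {0..t})"
    using assms by (intro closure_mono skeleton_subset) simp
  show "closure ((\<lambda>s. X s \<omega>) ` {0..t}) \<subseteq> closure (skeleton t \<omega>)"
  proof (intro closure_minimal closed_closure image_subsetI)
    fix s assume s: "s \<in> {0..t}"
    show "X s \<omega> \<in> closure (skeleton t \<omega>)"
      unfolding closure_iff_nhds_not_empty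
    proof (intro allI impI)
      fix A V assume V: "V \<subseteq> A" "open V" "X s \<omega> \<in> V"
      obtain n d where "d \<in> dyadic_grid n" "X (t * d) \<omega> \<in> V"
        by (rule right_continuous_dyadic[OF right_tendsto[OF assms(1)] assms(2) _ _ V(2,3)]) (use s in auto)
      then have "X (t * d) \<omega> \<in> skeleton t \<omega> \<inter> A" using V(1) unfolding skeleton_def by blast
      then show "skeleton t \<omega> \<inter> A \<noteq> {}" by blast
    qed
  qed
qed

lemma bounded_skeleton: "\<omega> \<in> space M \<Longrightarrow> 0 \<le> t \<Longrightarrow> bounded (skeleton t \<omega>)"
  using bounded_path skeleton_subset bounded_subset by metis

lemma bdd_above_inner_skeleton:
  assumes "\<omega> \<in> space M" "0 \<le> t"
  shows "bdd_above ((\<lambda>v. u \<bullet> v) ` skeleton t \<omega>)"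
proof -
  obtain b where b: "\<And>v. v \<in> skeleton t \<omega> \<Longrightarrow> norm v \<le> b"
    using bounded_skeleton[OF assms] by (auto simp: bounded_iff)
  show ?thesis
  proof (rule bdd_aboveI2)
    fix v assume "v \<in> skeleton t \<omega>"
    then have "norm u * norm v \<le> norm u * b" using b by (intro mult_left_mono) auto
    then show "u \<bullet> v \<le> norm u * b" using norm_cauchy_schwarz[of u v] by simp
  qed
qed

text \<open>Maxima over refining grids increase to the supremum. Their means are
  \<open>alpha_norm u * mean_abs / 2\<close> times a Riemann sum tending to \<open>\<alpha>\<close>,
  which produces the constant \<open>c_\<alpha>\<close>.\<close>

lemma nn_integral_sup_skeleton:
  "(\<integral>\<^sup>+\<omega>. ennreal (SUP v\<in>skeleton 1 \<omega>. u \<bullet> v) \<partial>M) = ennreal (\<alpha> / 2 * mean_abs * alpha_norm u)"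
proof -
  define m where "m = (\<lambda>n \<omega>. MAX k\<in>{..2 ^ n}. u \<bullet> X (real k / 2 ^ n) \<omega>)"
  have m_eq: "m n \<omega> = Max ((\<lambda>d. u \<bullet> X d \<omega>) ` dyadic_grid n)" for n \<omega>
    unfolding m_def dyadic_grid_def by (simp add: image_image)
  have int: "integrable M (m n)" for n
    using expectation_grid_max(1)[of "2 ^ n" u] by (simp add: m_def)
  have [measurable]: "m n \<in> borel_measurable M" for n using int by auto
  have m_nonneg: "0 \<le> m n \<omega>" if "\<omega> \<in> space M" for n \<omega>
  proof -
    have "u \<bullet> X 0 \<omega> \<le> m n \<omega>" unfolding m_eq
      by (intro Max_ge finite_imageI finite_dyadic_grid imageI zero_in_dyadic_grid)
    then show ?thesis using that by (simp add: process_0)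
  qed
  have sup: "ennreal (SUP v\<in>skeleton 1 \<omega>. u \<bullet> v) = (SUP n. ennreal (m n \<omega>))" if \<omega>: "\<omega> \<in> space M" for \<omega>
  proof (rule antisym)
    have bdd: "bdd_above ((\<lambda>v. u \<bullet> v) ` skeleton 1 \<omega>)" by (rule bdd_above_inner_skeleton[OF \<omega>]) simp
    have le: "m n \<omega> \<le> (SUP v\<in>skeleton 1 \<omega>. u \<bullet> v)" for n
    proof -
      have "m n \<omega> \<in> (\<lambda>d. u \<bullet> X d \<omega>) ` dyadic_grid n"
        unfolding m_eq using zero_in_dyadic_grid by (intro Max_in finite_imageI finite_dyadic_grid) auto
      then obtain d where d: "d \<in> dyadic_grid n" "m n \<omega> = u \<bullet> X (1 * d) \<omega>" by auto
      show ?thesis unfolding d(2) by (rule cSUP_upper[OF _ bdd]) (use d(1) in \<open>auto simp: skeleton_def\<close>)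
    qed
    then show "(SUP n. ennreal (m n \<omega>)) \<le> ennreal (SUP v\<in>skeleton 1 \<omega>. u \<bullet> v)"
      by (intro SUP_least ennreal_leI)
    show "ennreal (SUP v\<in>skeleton 1 \<omega>. u \<bullet> v) \<le> (SUP n. ennreal (m n \<omega>))"
    proof (cases "(SUP n. ennreal (m n \<omega>)) = \<infinity>")
      case False
      then obtain y where y: "0 \<le> y" "(SUP n. ennreal (m n \<omega>)) = ennreal y"
        by (metis ennreal_cases infinity_ennreal_def)
      have "(SUP v\<in>skeleton 1 \<omega>. u \<bullet> v) \<le> y"
      proof (rule cSUP_least)
        show "skeleton 1 \<omega> \<noteq> {}" using zero_in_skeleton[OF \<omega>] by auto
        fix v assume "v \<in> skeleton 1 \<omega>"
        then obtain n d where d: "d \<in> dyadic_grid n" "v = X d \<omega>" by (auto simp: skeleton_def)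
        have "u \<bullet> v \<le> m n \<omega>" unfolding m_eq d(2)
          by (intro Max_ge finite_imageI finite_dyadic_grid imageI d(1))
        moreover have "ennreal (m n \<omega>) \<le> ennreal y" unfolding y(2)[symmetric] by (rule SUP_upper) simp
        ultimately show "u \<bullet> v \<le> y" using y(1) by (simp add: ennreal_le_iff)
      qed
      then show ?thesis unfolding y(2) by (rule ennreal_leI)
    next
      case True
      show ?thesis unfolding True by simp
    qed
  qed
  have m_mono: "m n \<omega> \<le> m (Suc n) \<omega>" for n \<omega>
    unfolding m_eq using incseq_SucD[OF incseq_dyadic_grid, of n] zero_in_dyadic_grid
    by (intro Max_mono image_mono finite_imageI finite_dyadic_grid) auto
  have "(\<integral>\<^sup>+\<omega>. ennreal (SUP v\<in>skeleton 1 \<omega>. u \<bullet> v) \<partial>M) = (\<integral>\<^sup>+\<omega>. (SUP n. ennreal (m n \<omega>)) \<partial>M)"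
    by (intro nn_integral_cong sup)
  also have "\<dots> = (SUP n. \<integral>\<^sup>+\<omega>. ennreal (m n \<omega>) \<partial>M)"
    by (intro nn_integral_monotone_convergence_SUP incseq_SucI le_funI ennreal_leI m_mono) measurable
  also have "(\<lambda>n. \<integral>\<^sup>+\<omega>. ennreal (m n \<omega>) \<partial>M) = (\<lambda>n. ennreal (expectation (m n)))"
    by (intro ext nn_integral_eq_integral int AE_I2 m_nonneg)
  also have "(SUP n. ennreal (expectation (m n))) = ennreal (\<alpha> / 2 * mean_abs * alpha_norm u)"
  proof (rule LIMSEQ_unique[OF LIMSEQ_SUP])
    show "incseq (\<lambda>n. ennreal (expectation (m n)))"
      by (intro incseq_SucI ennreal_leI integral_mono int m_mono)
    have "filterlim (\<lambda>n. 2 ^ n :: nat) at_top sequentially"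
      by (intro filterlim_subseq strict_monoI_Suc) simp
    then have "(\<lambda>n. \<Sum>k=1..2 ^ n. (real k / real (2 ^ n)) powr (1 / \<alpha>) / real k) \<longlonglongrightarrow> 1 / (1 / \<alpha>)"
      using alpha by (intro filterlim_compose[OF sum_powr_limit[of "1 / \<alpha>"]]) auto
    then have "(\<lambda>n. alpha_norm u * mean_abs / 2 * (\<Sum>k=1..2 ^ n. (real k / real (2 ^ n)) powr (1 / \<alpha>) / real k)) \<longlonglongrightarrow> alpha_norm u * mean_abs / 2 * (1 / (1 / \<alpha>))"
      by (rule tendsto_mult_left)
    moreover have "(\<lambda>n. expectation (m n)) = (\<lambda>n. alpha_norm u * mean_abs / 2 * (\<Sum>k=1..2 ^ n. (real k / real (2 ^ n)) powr (1 / \<alpha>) / real k))"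
      using expectation_grid_max(2)[of "2 ^ n" u for n] by (simp add: m_def fun_eq_iff)
    moreover have "alpha_norm u * mean_abs / 2 * (1 / (1 / \<alpha>)) = \<alpha> / 2 * mean_abs * alpha_norm u" by simp
    ultimately have "(\<lambda>n. expectation (m n)) \<longlonglongrightarrow> \<alpha> / 2 * mean_abs * alpha_norm u" by (simp only:)
    then show "(\<lambda>n. ennreal (expectation (m n))) \<longlonglongrightarrow> ennreal (\<alpha> / 2 * mean_abs * alpha_norm u)"
      by (rule tendsto_ennrealI)
  qed
  finally show ?thesis .
qed

end

section \<open>Expected shell volumes and self-similarity\<close>

locale stable_gauge = stable_process M X \<alpha> + gauge_function p L m
  for M :: "'w measure" and X :: "real \<Rightarrow> 'w \<Rightarrow> real^'d" and \<alpha> :: real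
    and p :: "real^'d \<Rightarrow> real" and L m :: real
begin

text \<open>The strict inequality is an open condition on the path value, so dyadic times suffice.
  In this form the sublevel set visibly grows with \<open>t\<close>, although the skeletons for
  different \<open>t\<close> are not nested.\<close>

lemma infconv_skeleton_less_iff:
  assumes "\<omega> \<in> space M" "0 < t"
  shows "infconv p (skeleton t \<omega>) x < r \<longleftrightarrow> (\<exists>s\<in>{0..t}. p (x - X s \<omega>) < r)"
proof -
  have ne: "skeleton t \<omega> \<noteq> {}" using zero_in_skeleton[OF assms(1)] by auto
  show ?thesis
    unfolding infconv_less_iff[OF ne]
  proof
    assume "\<exists>s\<in>skeleton t \<omega>. p (x - s) < r"
    then show "\<exists>s\<in>{0..t}. p (x - X s \<omega>) < r" using skeleton_subset[of t \<omega>] assms(2) by auto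
  next
    assume "\<exists>s\<in>{0..t}. p (x - X s \<omega>) < r"
    then obtain s where s: "s \<in> {0..t}" "p (x - X s \<omega>) < r" by blast
    have U: "open {v. p (x - v) < r}"
      by (intro open_Collect_less continuous_on_compose2[OF continuous_on_gauge[of UNIV]] continuous_intros) auto
    obtain n d where "d \<in> dyadic_grid n" "X (t * d) \<omega> \<in> {v. p (x - v) < r}"
      by (rule right_continuous_dyadic[OF right_tendsto[OF assms(1)] assms(2) _ _ U]) (use s in auto)
    then show "\<exists>s\<in>skeleton t \<omega>. p (x - s) < r" unfolding skeleton_def by blast
  qed
qed

lemma borel_measurable_infconv_skeleton:
  assumes "0 \<le> t"
  shows "(\<lambda>z. infconv p ((\<lambda>v. e *\<^sub>R v) ` skeleton t (fst z)) (snd z)) \<in> borel_measurable (M \<Otimes>\<^sub>M lborel)"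
proof -
  have "(\<lambda>z. INF d\<in>(\<Union>n. dyadic_grid n). p (snd z - e *\<^sub>R X (t * d) (fst z))) \<in> borel_measurable (M \<Otimes>\<^sub>M lborel)"
  proof (rule borel_measurable_cINF[OF countable_UN_dyadic_grid])
    fix d assume "d \<in> (\<Union>n. dyadic_grid n)"
    then have "0 \<le> t * d" using dyadic_grid_unit assms by auto
    note [measurable] = borel_measurable_process[OF this]
    show "(\<lambda>z. p (snd z - e *\<^sub>R X (t * d) (fst z))) \<in> borel_measurable (M \<Otimes>\<^sub>M lborel)" by measurable
  qed (auto intro!: bdd_belowI2[of _ 0] gauge_nonneg)
  then show ?thesis by (simp add: infconv_def skeleton_def image_image)
qed

text \<open>The shell volume as a functional of the increments alone, so that its mean depends only
  on their law.\<close>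

definition walk_shell :: "nat \<Rightarrow> ('d \<Rightarrow> nat \<Rightarrow> real) \<Rightarrow> ennreal" where
  "walk_shell N z = emeasure lborel {x. (\<exists>k\<in>{..N}. p (x - (\<chi> j. \<Sum>i<k. z j i)) < 1) \<and> 1 \<le> p x}"

lemma borel_measurable_walk_shell:
  "walk_shell N \<in> borel_measurable (PiM UNIV (\<lambda>_. PiM {..<N} (\<lambda>_. borel)))"
  unfolding walk_shell_def[abs_def]
proof (rule lborel.measurable_emeasure)
  let ?P = "PiM UNIV (\<lambda>_::'d. PiM {..<N} (\<lambda>_. borel :: real measure))"
  have comp: "(\<lambda>z. z j i) \<in> borel_measurable ?P" if "i < N" for j i
    using that by (intro measurable_compose[OF measurable_component_singleton[of j] measurable_component_singleton[of i]]) auto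
  have chi: "(\<lambda>z. \<chi> j. \<Sum>i<k. z j i) \<in> borel_measurable ?P" if "k \<le> N" for k
  proof -
    have "(\<lambda>z. (\<chi> j. \<Sum>i<k. z j i) \<bullet> b) \<in> borel_measurable ?P" if "b \<in> Basis" for b :: "real^'d"
    proof -
      obtain j where "b = axis j 1" using \<open>b \<in> Basis\<close> by (auto simp: Basis_vec_def)
      moreover have "(\<lambda>z. \<Sum>i<k. z j i) \<in> borel_measurable ?P" using \<open>k \<le> N\<close> by (intro borel_measurable_sum comp) auto
      ultimately show ?thesis by (simp add: inner_axis)
    qed
    then show ?thesis by (subst borel_measurable_euclidean_space) blast
  qed
  have [measurable]: "Measurable.pred (?P \<Otimes>\<^sub>M lborel) (\<lambda>y. p (snd y - (\<chi> j. \<Sum>i<k. fst y j i)) < 1)" if "k \<in> {..N}" for k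
  proof -
    have "k \<le> N" using that by simp
    then have [measurable]: "(\<lambda>y. \<chi> j. \<Sum>i<k. fst y j i) \<in> borel_measurable (?P \<Otimes>\<^sub>M lborel)"
      by (intro measurable_compose[OF measurable_fst chi])
    show ?thesis by measurable
  qed
  have "Measurable.pred (?P \<Otimes>\<^sub>M lborel) (\<lambda>y. (\<exists>k\<in>{..N}. p (snd y - (\<chi> j. \<Sum>i<k. fst y j i)) < 1) \<and> 1 \<le> p (snd y))"
    by measurable
  then show "{y \<in> space (?P \<Otimes>\<^sub>M lborel). snd y \<in> {x. (\<exists>k\<in>{..N}. p (x - (\<chi> j. \<Sum>i<k. fst y j i)) < 1) \<and> 1 \<le> p x}} \<in> sets (?P \<Otimes>\<^sub>M lborel)"
    by (simp add: pred_def)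
qed simp

text \<open>Monotone convergence along refining grids expresses the mean shell volume through laws
  of finite arrays, for which self-similarity is an equality of measures.\<close>

lemma expected_shell_eq_SUP_grid:
  assumes t: "0 \<le> t"
  shows "(\<integral>\<^sup>+\<omega>. emeasure lborel {x. infconv p ((\<lambda>v. c *\<^sub>R v) ` skeleton t \<omega>) x < 1 \<and> 1 \<le> p x} \<partial>M)
    = (SUP n. \<integral>\<^sup>+z. walk_shell (2 ^ n) z \<partial>distr M (PiM UNIV (\<lambda>_. PiM {..<2 ^ n} (\<lambda>_. borel)))
         (\<lambda>\<omega> j. \<lambda>k\<in>{..<2 ^ n}. c * incr (t / 2 ^ n) j k \<omega>))"
proof -
  define G where "G = (\<lambda>n \<omega> j. \<lambda>k\<in>{..<2 ^ n :: nat}. c * incr (t / 2 ^ n) j k \<omega>)"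
  define A where "A = (\<lambda>n \<omega>. {x. (\<exists>d\<in>dyadic_grid n. p (x - c *\<^sub>R X (t * d) \<omega>) < 1) \<and> 1 \<le> p x})"
  have G: "G n \<in> measurable M (PiM UNIV (\<lambda>_. PiM {..<2 ^ n} (\<lambda>_. borel)))" for n
    unfolding G_def using t by (intro measurable_grid[where \<sigma> = "\<lambda>k. k"]) simp
  have A: "emeasure lborel (A n \<omega>) = walk_shell (2 ^ n) (G n \<omega>)" if "\<omega> \<in> space M" for n \<omega>
  proof -
    have "(\<chi> j. \<Sum>i<k. G n \<omega> j i) = c *\<^sub>R X (t * (real k / 2 ^ n)) \<omega>" if "k \<le> 2 ^ n" for k
    proof -
      have "(\<Sum>i<k. G n \<omega> j i) = (\<Sum>i<k. c * incr (t / 2 ^ n) j i \<omega>)" for j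
        using that unfolding G_def by (intro sum.cong) auto
      then show ?thesis
        using sum_incr[OF \<open>\<omega> \<in> space M\<close>, of "t / 2 ^ n" _ k]
        by (simp add: vec_eq_iff sum_distrib_left[symmetric] mult.commute)
    qed
    then show ?thesis unfolding A_def walk_shell_def dyadic_grid_def by (auto intro!: arg_cong[of _ _ "emeasure lborel"])
  qed
  have A_meas: "A n \<omega> \<in> sets lborel" for n \<omega>
  proof -
    have "A n \<omega> = (\<Union>d\<in>dyadic_grid n. {x. p (x - c *\<^sub>R X (t * d) \<omega>) < 1}) \<inter> {x. 1 \<le> p x}"
      by (auto simp: A_def)
    moreover have "{x. p (x - v) < 1} \<in> sets lborel" for v by measurable
    moreover have "{x. 1 \<le> p x} \<in> sets lborel" by measurable
    ultimately show ?thesis by (auto intro!: sets.Int sets.finite_UN finite_dyadic_grid)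
  qed
  have inc: "incseq (\<lambda>n. A n \<omega>)" for \<omega>
    using incseqD[OF incseq_dyadic_grid] unfolding A_def by (intro incseq_SucI) (blast dest: subsetD[OF incseq_SucD[OF incseq_dyadic_grid]])
  have un: "{x. infconv p ((\<lambda>v. c *\<^sub>R v) ` skeleton t \<omega>) x < 1 \<and> 1 \<le> p x} = (\<Union>n. A n \<omega>)" for \<omega>
  proof -
    have "(\<lambda>v. c *\<^sub>R v) ` skeleton t \<omega> \<noteq> {}" using zero_in_dyadic_grid unfolding skeleton_def by auto
    then show ?thesis unfolding A_def by (auto simp: infconv_less_iff skeleton_def)
  qed
  have "(\<integral>\<^sup>+\<omega>. emeasure lborel {x. infconv p ((\<lambda>v. c *\<^sub>R v) ` skeleton t \<omega>) x < 1 \<and> 1 \<le> p x} \<partial>M)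
      = (\<integral>\<^sup>+\<omega>. (SUP n. walk_shell (2 ^ n) (G n \<omega>)) \<partial>M)"
  proof (intro nn_integral_cong)
    fix \<omega> assume \<omega>: "\<omega> \<in> space M"
    have "emeasure lborel (\<Union>n. A n \<omega>) = (SUP n. emeasure lborel (A n \<omega>))"
      using A_meas inc by (intro SUP_emeasure_incseq[symmetric]) auto
    then show "emeasure lborel {x. infconv p ((\<lambda>v. c *\<^sub>R v) ` skeleton t \<omega>) x < 1 \<and> 1 \<le> p x} = (SUP n. walk_shell (2 ^ n) (G n \<omega>))"
      by (simp add: un A[OF \<omega>])
  qed
  also have "\<dots> = (SUP n. \<integral>\<^sup>+\<omega>. walk_shell (2 ^ n) (G n \<omega>) \<partial>M)"
  proof (rule nn_integral_monotone_convergence_SUP_AE)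
    show "AE \<omega> in M. walk_shell (2 ^ n) (G n \<omega>) \<le> walk_shell (2 ^ Suc n) (G (Suc n) \<omega>)" for n
    proof (rule AE_I2)
      fix \<omega> assume \<omega>: "\<omega> \<in> space M"
      show "walk_shell (2 ^ n) (G n \<omega>) \<le> walk_shell (2 ^ Suc n) (G (Suc n) \<omega>)"
        unfolding A[OF \<omega>, symmetric] using incseq_SucD[OF inc] A_meas by (intro emeasure_mono)
    qed
    show "(\<lambda>\<omega>. walk_shell (2 ^ n) (G n \<omega>)) \<in> borel_measurable M" for n
      by (rule measurable_compose[OF G borel_measurable_walk_shell])
  qed
  also have "\<dots> = (SUP n. \<integral>\<^sup>+z. walk_shell (2 ^ n) z \<partial>distr M (PiM UNIV (\<lambda>_. PiM {..<2 ^ n} (\<lambda>_. borel))) (G n))"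
    by (simp add: nn_integral_distr[OF G] borel_measurable_walk_shell)
  finally show ?thesis by (simp add: G_def)
qed

definition shell :: "real \<Rightarrow> ennreal" where
  "shell e = (\<integral>\<^sup>+\<omega>. emeasure lborel {x. infconv p ((\<lambda>v. e *\<^sub>R v) ` skeleton 1 \<omega>) x < 1 \<and> 1 \<le> p x} \<partial>M)"

lemma shell_scaling:
  assumes e: "0 < e"
  shows "(\<integral>\<^sup>+\<omega>. emeasure lborel {x. infconv p (skeleton (e powr \<alpha>) \<omega>) x < 1 \<and> 1 \<le> p x} \<partial>M) = shell e"
proof -
  have "distr M (PiM UNIV (\<lambda>_. PiM {..<2 ^ n} (\<lambda>_. borel))) (\<lambda>\<omega> j. \<lambda>k\<in>{..<2 ^ n}. e * incr (1 / 2 ^ n) j k \<omega>)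
      = distr M (PiM UNIV (\<lambda>_. PiM {..<2 ^ n} (\<lambda>_. borel))) (\<lambda>\<omega> j. \<lambda>k\<in>{..<2 ^ n}. incr (e powr \<alpha> / 2 ^ n) j k \<omega>)" for n :: nat
    using grid_law[of "1 / 2 ^ n" e "e powr \<alpha> / 2 ^ n" id "2 ^ n"] e by (simp add: permutes_id)
  then show ?thesis
    using expected_shell_eq_SUP_grid[of "e powr \<alpha>" 1] expected_shell_eq_SUP_grid[of 1 e]
    by (simp add: shell_def image_def)
qed

text \<open>Scaling a path does not enlarge its range pathwise. After rewriting both sides by
  self-similarity, the comparison is between ranges up to times
  \<open>x powr \<alpha> \<le> y powr \<alpha>\<close>, which holds for each path.\<close>

lemma shell_mono:
  assumes "0 < x" "x \<le> y"
  shows "shell x \<le> shell y"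
  unfolding shell_scaling[OF assms(1), symmetric] shell_scaling[OF less_le_trans[OF assms], symmetric]
proof (intro nn_integral_mono emeasure_mono)
  fix \<omega> assume \<omega>: "\<omega> \<in> space M"
  have pos: "0 < x powr \<alpha>" "0 < y powr \<alpha>" using assms by auto
  have le: "x powr \<alpha> \<le> y powr \<alpha>" using assms alpha by (intro powr_mono2) auto
  show "{z. infconv p (skeleton (x powr \<alpha>) \<omega>) z < 1 \<and> 1 \<le> p z} \<subseteq> {z. infconv p (skeleton (y powr \<alpha>) \<omega>) z < 1 \<and> 1 \<le> p z}"
    unfolding infconv_skeleton_less_iff[OF \<omega> pos(1)] infconv_skeleton_less_iff[OF \<omega> pos(2)] using le by auto
  have ne: "skeleton (y powr \<alpha>) \<omega> \<noteq> {}" using zero_in_skeleton[OF \<omega>] by auto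
  note [measurable] = borel_measurable_infconv[OF ne]
  show "{z. infconv p (skeleton (y powr \<alpha>) \<omega>) z < 1 \<and> 1 \<le> p z} \<in> sets lborel" by measurable
qed

end

section \<open>Integrable domination by coordinate suprema\<close>

context stable_gauge
begin

definition path_sup :: "'d \<Rightarrow> 'w \<Rightarrow> real" where
  "path_sup j \<omega> = (SUP d\<in>(\<Union>n. dyadic_grid n). \<bar>X d \<omega> $ j\<bar>)"

lemma bdd_above_path_sup:
  assumes "\<omega> \<in> space M"
  shows "bdd_above ((\<lambda>d. \<bar>X d \<omega> $ j\<bar>) ` (\<Union>n. dyadic_grid n))"
proof -
  obtain b where b: "\<And>s. s \<in> {0..1} \<Longrightarrow> norm (X s \<omega>) \<le> b"
    using bounded_path[OF assms, of 1] unfolding bounded_iff by blast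
  show ?thesis
  proof (rule bdd_aboveI2)
    fix d assume "d \<in> (\<Union>n. dyadic_grid n)"
    then have "norm (X d \<omega>) \<le> b" using dyadic_grid_unit by (intro b) auto
    then show "\<bar>X d \<omega> $ j\<bar> \<le> b" using component_le_norm_cart[of "X d \<omega>" j] by simp
  qed
qed

lemma abs_le_path_sup:
  "\<omega> \<in> space M \<Longrightarrow> d \<in> dyadic_grid n \<Longrightarrow> \<bar>X d \<omega> $ j\<bar> \<le> path_sup j \<omega>"
  unfolding path_sup_def by (rule cSUP_upper[OF _ bdd_above_path_sup]) auto

lemma path_sup_nonneg: "\<omega> \<in> space M \<Longrightarrow> 0 \<le> path_sup j \<omega>"
  using abs_le_path_sup[OF _ zero_in_dyadic_grid] abs_ge_zero order_trans by blast

lemma ennreal_path_sup: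
  assumes \<omega>: "\<omega> \<in> space M"
  shows "ennreal (path_sup j \<omega>) = (SUP d\<in>(\<Union>n. dyadic_grid n). ennreal \<bar>X d \<omega> $ j\<bar>)"
proof (rule antisym)
  show "(SUP d\<in>(\<Union>n. dyadic_grid n). ennreal \<bar>X d \<omega> $ j\<bar>) \<le> ennreal (path_sup j \<omega>)"
    using abs_le_path_sup[OF \<omega>] by (intro SUP_least ennreal_leI) auto
  show "ennreal (path_sup j \<omega>) \<le> (SUP d\<in>(\<Union>n. dyadic_grid n). ennreal \<bar>X d \<omega> $ j\<bar>)"
  proof (cases "(SUP d\<in>(\<Union>n. dyadic_grid n). ennreal \<bar>X d \<omega> $ j\<bar>) = \<infinity>")
    case True
    show ?thesis unfolding True by simp
  next
    case False
    then obtain y where y: "0 \<le> y" "(SUP d\<in>(\<Union>n. dyadic_grid n). ennreal \<bar>X d \<omega> $ j\<bar>) = ennreal y"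
      by (metis ennreal_cases infinity_ennreal_def)
    have "path_sup j \<omega> \<le> y"
      unfolding path_sup_def
    proof (rule cSUP_least)
      show "(\<Union>n. dyadic_grid n) \<noteq> {}" using zero_in_dyadic_grid by auto
      fix d assume "d \<in> (\<Union>n. dyadic_grid n)"
      then have "ennreal \<bar>X d \<omega> $ j\<bar> \<le> ennreal y" unfolding y(2)[symmetric] by (rule SUP_upper)
      then show "\<bar>X d \<omega> $ j\<bar> \<le> y" using y(1) by (simp add: ennreal_le_iff)
    qed
    then show ?thesis unfolding y(2) by (rule ennreal_leI)
  qed
qed

text \<open>The absolute value is at most the supremum of the coordinate plus that of its negative;
  both are nonnegative because the path starts at 0, and both have finite mean by Spitzer's
  identity.\<close>

lemma nn_integral_path_sup: "(\<integral>\<^sup>+\<omega>. ennreal (path_sup j \<omega>) \<partial>M) < \<infinity>"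
proof -
  let ?u = "axis j 1 :: real^'d"
  define s where "s = (\<lambda>u \<omega>. SUP v\<in>skeleton 1 \<omega>. u \<bullet> v)"
  have le: "ennreal (path_sup j \<omega>) \<le> ennreal (s ?u \<omega>) + ennreal (s (- ?u) \<omega>)" if \<omega>: "\<omega> \<in> space M" for \<omega>
  proof -
    have s0: "u \<bullet> v \<le> s u \<omega>" if "v \<in> skeleton 1 \<omega>" for u v
      unfolding s_def using that by (rule cSUP_upper[OF _ bdd_above_inner_skeleton[OF \<omega>]]) simp
    have s_nonneg: "0 \<le> s u \<omega>" for u using s0[OF zero_in_skeleton[OF \<omega>], of u] by simp
    have "path_sup j \<omega> \<le> s ?u \<omega> + s (- ?u) \<omega>"
      unfolding path_sup_def
    proof (rule cSUP_least)
      show "(\<Union>n. dyadic_grid n) \<noteq> {}" using zero_in_dyadic_grid by auto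
      fix d assume "d \<in> (\<Union>n. dyadic_grid n)"
      then have "X d \<omega> \<in> skeleton 1 \<omega>" by (auto simp: skeleton_def)
      from s0[OF this, of ?u] s0[OF this, of "- ?u"] s_nonneg[of ?u] s_nonneg[of "- ?u"]
      show "\<bar>X d \<omega> $ j\<bar> \<le> s ?u \<omega> + s (- ?u) \<omega>" by (simp add: inner_axis')
    qed
    then show ?thesis using s_nonneg by (simp add: ennreal_leI flip: ennreal_plus)
  qed
  have m: "(\<lambda>\<omega>. ennreal (s u \<omega>)) \<in> borel_measurable M" for u
  proof -
    have "(\<lambda>\<omega>. SUP d\<in>(\<Union>n. dyadic_grid n). u \<bullet> X d \<omega>) \<in> borel_measurable M"
    proof (rule borel_measurable_cSUP[OF countable_UN_dyadic_grid])
      fix d assume "d \<in> (\<Union>n. dyadic_grid n)"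
      then have "0 \<le> d" using dyadic_grid_unit by auto
      then show "(\<lambda>\<omega>. u \<bullet> X d \<omega>) \<in> borel_measurable M" using borel_measurable_process by (intro borel_measurable_inner) auto
    next
      fix \<omega> assume "\<omega> \<in> space M"
      from bdd_above_inner_skeleton[OF this, of 1 u] show "bdd_above ((\<lambda>d. u \<bullet> X d \<omega>) ` (\<Union>n. dyadic_grid n))"
        by (simp add: skeleton_def image_image)
    qed
    then show ?thesis unfolding s_def skeleton_def by (simp add: image_image)
  qed
  have "(\<integral>\<^sup>+\<omega>. ennreal (path_sup j \<omega>) \<partial>M) \<le> (\<integral>\<^sup>+\<omega>. ennreal (s ?u \<omega>) + ennreal (s (- ?u) \<omega>) \<partial>M)"
    by (intro nn_integral_mono le)
  also have "\<dots> = (\<integral>\<^sup>+\<omega>. ennreal (s ?u \<omega>) \<partial>M) + (\<integral>\<^sup>+\<omega>. ennreal (s (- ?u) \<omega>) \<partial>M)"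
    by (rule nn_integral_add) (rule m)+
  also have "\<dots> < \<infinity>" unfolding s_def nn_integral_sup_skeleton by simp
  finally show ?thesis .
qed

text \<open>Only first moments of the suprema are used: they belong to independent coordinate paths,
  so the mean of the product is the product of the means.\<close>

lemma nn_integral_prod_path_sup:
  assumes c: "0 \<le> c"
  shows "(\<lambda>\<omega>. ennreal (\<Prod>j\<in>UNIV. 2 * c + 2 * path_sup j \<omega>)) \<in> borel_measurable M"
    "(\<integral>\<^sup>+\<omega>. ennreal (\<Prod>j\<in>UNIV. 2 * c + 2 * path_sup j \<omega>) \<partial>M) < \<infinity>"
proof -
  \<comment> \<open>A functional of the whole coordinate path with values in \<open>ennreal\<close>:
    there the countable supremum is measurable on all functions, bounded or not, as composition with
    the independent paths requires.\<close>
  define W where "W = (\<lambda>f::real \<Rightarrow> real. ennreal (2 * c) + 2 * (SUP d\<in>(\<Union>n. dyadic_grid n). ennreal \<bar>f d\<bar>))"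
  have W: "W \<in> borel_measurable (PiM UNIV (\<lambda>_. borel))"
  proof -
    have "(\<lambda>f. SUP d\<in>(\<Union>n. dyadic_grid n). ennreal \<bar>f d\<bar>) \<in> borel_measurable (PiM UNIV (\<lambda>_::real. borel))"
      by (intro borel_measurable_SUP countable_UN_dyadic_grid) measurable
    then show ?thesis unfolding W_def by measurable
  qed
  have ind: "indep_vars (\<lambda>_. borel) (\<lambda>j \<omega>. W (\<lambda>t. X t \<omega> $ j)) UNIV"
    by (rule indep_vars_compose2[OF indep_paths]) (rule W)
  then have Wm: "(\<lambda>\<omega>. W (\<lambda>t. X t \<omega> $ j)) \<in> borel_measurable M" for j by (auto simp: indep_vars_def)
  have Weq: "W (\<lambda>t. X t \<omega> $ j) = ennreal (2 * c + 2 * path_sup j \<omega>)" if "\<omega> \<in> space M" for \<omega> j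
    unfolding W_def ennreal_path_sup[OF that, symmetric] using c path_sup_nonneg[OF that]
    by (simp add: ennreal_plus ennreal_mult)
  have eq: "ennreal (\<Prod>j\<in>UNIV. 2 * c + 2 * path_sup j \<omega>) = (\<Prod>j\<in>UNIV. W (\<lambda>t. X t \<omega> $ j))" if "\<omega> \<in> space M" for \<omega>
    unfolding Weq[OF that] using c path_sup_nonneg[OF that] by (intro prod_ennreal[symmetric]) auto
  have "(\<lambda>\<omega>. \<Prod>j\<in>UNIV. W (\<lambda>t. X t \<omega> $ j)) \<in> borel_measurable M" using Wm by (intro borel_measurable_prod_ennreal)
  then show "(\<lambda>\<omega>. ennreal (\<Prod>j\<in>UNIV. 2 * c + 2 * path_sup j \<omega>)) \<in> borel_measurable M"
    by (subst measurable_cong[OF eq])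
  have "(\<integral>\<^sup>+\<omega>. ennreal (\<Prod>j\<in>UNIV. 2 * c + 2 * path_sup j \<omega>) \<partial>M) = (\<integral>\<^sup>+\<omega>. (\<Prod>j\<in>UNIV. W (\<lambda>t. X t \<omega> $ j)) \<partial>M)"
    by (intro nn_integral_cong eq)
  also have "\<dots> = (\<Prod>j\<in>UNIV. \<integral>\<^sup>+\<omega>. W (\<lambda>t. X t \<omega> $ j) \<partial>M)"
    by (rule indep_vars_nn_integral[OF finite ind]) simp
  also have "\<dots> < \<infinity>"
  proof -
    have "(\<integral>\<^sup>+\<omega>. W (\<lambda>t. X t \<omega> $ j) \<partial>M) < \<infinity>" for j
    proof -
      have m: "(\<lambda>\<omega>. ennreal (path_sup j \<omega>)) \<in> borel_measurable M"
      proof (subst measurable_cong[OF ennreal_path_sup])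
        show "(\<lambda>\<omega>. SUP d\<in>(\<Union>n. dyadic_grid n). ennreal \<bar>X d \<omega> $ j\<bar>) \<in> borel_measurable M"
        proof (intro borel_measurable_SUP countable_UN_dyadic_grid)
          fix d assume "d \<in> (\<Union>n. dyadic_grid n)"
          then have "0 \<le> d" using dyadic_grid_unit by auto
          note [measurable] = borel_measurable_component[OF this]
          show "(\<lambda>\<omega>. ennreal \<bar>X d \<omega> $ j\<bar>) \<in> borel_measurable M" by measurable
        qed
      qed
      have "(\<integral>\<^sup>+\<omega>. W (\<lambda>t. X t \<omega> $ j) \<partial>M) = (\<integral>\<^sup>+\<omega>. ennreal (2 * c) + 2 * ennreal (path_sup j \<omega>) \<partial>M)"
        by (intro nn_integral_cong) (simp add: W_def ennreal_path_sup)
      also have "\<dots> = ennreal (2 * c) + 2 * (\<integral>\<^sup>+\<omega>. ennreal (path_sup j \<omega>) \<partial>M)"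
        using m emeasure_space_1 by (subst nn_integral_add) (auto simp: nn_integral_cmult)
      also have "\<dots> < \<infinity>" using nn_integral_path_sup[of j] by (simp add: ennreal_mult_less_top)
      finally show ?thesis .
    qed
    then have "(\<integral>\<^sup>+\<omega>. W (\<lambda>t. X t \<omega> $ j) \<partial>M) \<noteq> top" for j by (simp add: less_top)
    then show ?thesis by (simp add: less_top[symmetric] ennreal_prod_eq_top)
  qed
  finally show "(\<integral>\<^sup>+\<omega>. ennreal (\<Prod>j\<in>UNIV. 2 * c + 2 * path_sup j \<omega>) \<partial>M) < \<infinity>" .
qed

lemma skeleton_subset_cbox:
  assumes "\<omega> \<in> space M"
  shows "skeleton 1 \<omega> \<subseteq> cbox (- (\<chi> j. path_sup j \<omega>)) (\<chi> j. path_sup j \<omega>)"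
proof
  fix v assume "v \<in> skeleton 1 \<omega>"
  then obtain n d where "d \<in> dyadic_grid n" "v = X d \<omega>" by (auto simp: skeleton_def)
  then have "\<bar>v $ j\<bar> \<le> path_sup j \<omega>" for j using abs_le_path_sup[OF assms] by simp
  then show "v \<in> cbox (- (\<chi> j. path_sup j \<omega>)) (\<chi> j. path_sup j \<omega>)"
    by (auto simp: mem_box_cart abs_le_iff) (metis minus_le_iff)
qed

lemma prod_Basis_cart:
  fixes f :: "real \<Rightarrow> real"
  shows "(\<Prod>i\<in>Basis. f ((\<chi> j. g j) \<bullet> (i :: real^'d))) = (\<Prod>j\<in>UNIV. f (g j))"
  by (simp add: Basis_vec_def UNION_singleton_eq_range prod.reindex inj_on_def axis_eq_axis inner_axis)

end

section \<open>The slope of the expected shell volume\<close>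

context stable_gauge
begin

lemma borel_measurable_dsup_skeleton:
  "(\<lambda>z. dsup (skeleton 1 (fst z)) (snd z)) \<in> borel_measurable (M \<Otimes>\<^sub>M lborel)"
proof (rule borel_measurable_LIMSEQ_real)
  define t where "t = (\<lambda>k. 1 / real (Suc k))"
  have "t \<longlonglongrightarrow> 0" unfolding t_def by (rule LIMSEQ_Suc[OF lim_1_over_n])
  then have tr: "filterlim t (at_right 0) sequentially"
    by (auto simp: filterlim_at t_def intro!: always_eventually)
  fix z :: "'w \<times> (real, 'd) vec" assume "z \<in> space (M \<Otimes>\<^sub>M lborel)"
  then have z: "fst z \<in> space M" by (auto simp: space_pair_measure)
  obtain R where R: "\<And>v. v \<in> skeleton 1 (fst z) \<Longrightarrow> norm v \<le> R"
    using bounded_skeleton[OF z, of 1] unfolding bounded_iff by auto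
  show "(\<lambda>k. (p (snd z) - infconv p ((\<lambda>v. t k *\<^sub>R v) ` skeleton 1 (fst z)) (snd z)) / t k) \<longlonglongrightarrow> dsup (skeleton 1 (fst z)) (snd z)"
    by (rule filterlim_compose[OF infconv_quotient_tendsto_dsup[OF R zero_in_skeleton[OF z]] tr])
next
  fix k
  note [measurable] = borel_measurable_infconv_skeleton[of 1, simplified]
  show "(\<lambda>z. (p (snd z) - infconv p ((\<lambda>v. (1 / real (Suc k)) *\<^sub>R v) ` skeleton 1 (fst z)) (snd z)) / (1 / real (Suc k))) \<in> borel_measurable (M \<Otimes>\<^sub>M lborel)"
    by measurable
qed

lemma expected_clamp_integral_limit:
  assumes \<delta>: "0 < \<delta>" and e: "\<And>k. 0 < e k" "\<And>k. e k \<le> 1" "e \<longlonglongrightarrow> 0"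
  shows "(\<lambda>k. \<integral>\<^sup>+\<omega>. \<integral>\<^sup>+x. ennreal ((clamp_real 1 (1 + \<delta>) (p x) - clamp_real 1 (1 + \<delta>) (infconv p ((\<lambda>v. e k *\<^sub>R v) ` skeleton 1 \<omega>) x)) / e k) \<partial>lborel \<partial>M)
    \<longlonglongrightarrow> (\<integral>\<^sup>+\<omega>. \<integral>\<^sup>+x. ennreal (dsup (skeleton 1 \<omega>) x) * indicator {x. 1 < p x \<and> p x < 1 + \<delta>} x \<partial>lborel \<partial>M)"
proof (rule nn_integral_dominated_convergence)
  let ?c = "(1 + \<delta>) / m"
  let ?C = "\<delta> * (2 * DIM(real^'d))"
  let ?w = "\<lambda>\<omega>. ennreal ?C * ennreal (\<Prod>j\<in>UNIV. 2 * ?c + 2 * path_sup j \<omega>)"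
  have c: "0 \<le> ?c" using \<delta> m_pos by simp
  have pm: "(\<lambda>z. p (snd z)) \<in> borel_measurable (M \<Otimes>\<^sub>M lborel)" by measurable
  note [measurable] = borel_measurable_infconv_skeleton[of 1, simplified] borel_measurable_dsup_skeleton pm
  show "(\<lambda>\<omega>. \<integral>\<^sup>+x. ennreal ((clamp_real 1 (1 + \<delta>) (p x) - clamp_real 1 (1 + \<delta>) (infconv p ((\<lambda>v. e k *\<^sub>R v) ` skeleton 1 \<omega>) x)) / e k) \<partial>lborel) \<in> borel_measurable M" for k
  proof -
    have "(\<lambda>z. ennreal ((clamp_real 1 (1 + \<delta>) (p (snd z)) - clamp_real 1 (1 + \<delta>) (infconv p ((\<lambda>v. e k *\<^sub>R v) ` skeleton 1 (fst z)) (snd z))) / e k)) \<in> borel_measurable (M \<Otimes>\<^sub>M lborel)"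
      by measurable
    from lborel.borel_measurable_nn_integral_fst[OF this] show ?thesis by simp
  qed
  show "(\<lambda>\<omega>. \<integral>\<^sup>+x. ennreal (dsup (skeleton 1 \<omega>) x) * indicator {x. 1 < p x \<and> p x < 1 + \<delta>} x \<partial>lborel) \<in> borel_measurable M"
  proof -
    have "(\<lambda>z. ennreal (dsup (skeleton 1 (fst z)) (snd z)) * indicator {x. 1 < p x \<and> p x < 1 + \<delta>} (snd z)) \<in> borel_measurable (M \<Otimes>\<^sub>M lborel)"
      by measurable
    from lborel.borel_measurable_nn_integral_fst[OF this] show ?thesis by simp
  qed
  show "?w \<in> borel_measurable M"
    by (intro borel_measurable_times_ennreal borel_measurable_const nn_integral_prod_path_sup(1) c)
  show "(\<integral>\<^sup>+\<omega>. ?w \<omega> \<partial>M) < \<infinity>"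
    using nn_integral_prod_path_sup[OF c] by (subst nn_integral_cmult) (auto simp: ennreal_mult_less_top)
  show "AE \<omega> in M. (\<integral>\<^sup>+x. ennreal ((clamp_real 1 (1 + \<delta>) (p x) - clamp_real 1 (1 + \<delta>) (infconv p ((\<lambda>v. e k *\<^sub>R v) ` skeleton 1 \<omega>) x)) / e k) \<partial>lborel) \<le> ?w \<omega>" for k
  proof (rule AE_I2)
    fix \<omega> assume \<omega>: "\<omega> \<in> space M"
    have "(\<integral>\<^sup>+x. ennreal ((clamp_real 1 (1 + \<delta>) (p x) - clamp_real 1 (1 + \<delta>) (infconv p ((\<lambda>v. e k *\<^sub>R v) ` skeleton 1 \<omega>) x)) / e k) \<partial>lborel)
        \<le> ennreal ((1 + \<delta> - 1) * (2 * DIM(real^'d) * (\<Prod>i\<in>Basis. 2 * ?c + 2 * ((\<chi> j. path_sup j \<omega>) \<bullet> i))))"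
      by (rule clamp_integral_bound[OF zero_in_skeleton[OF \<omega>] skeleton_subset_cbox[OF \<omega>] e(1,2)]) (use \<delta> m_pos in auto)
    also have "(1 + \<delta> - 1) * (2 * DIM(real^'d) * (\<Prod>i\<in>Basis. 2 * ?c + 2 * ((\<chi> j. path_sup j \<omega>) \<bullet> i)))
        = ?C * (\<Prod>j\<in>UNIV. 2 * ?c + 2 * path_sup j \<omega>)"
      using prod_Basis_cart[of "\<lambda>y. 2 * ?c + 2 * y" "\<lambda>j. path_sup j \<omega>"] by (simp add: mult.assoc)
    also have "ennreal (?C * (\<Prod>j\<in>UNIV. 2 * ?c + 2 * path_sup j \<omega>)) = ?w \<omega>"
      using \<delta> by (intro ennreal_mult') simp
    finally show "(\<integral>\<^sup>+x. ennreal ((clamp_real 1 (1 + \<delta>) (p x) - clamp_real 1 (1 + \<delta>) (infconv p ((\<lambda>v. e k *\<^sub>R v) ` skeleton 1 \<omega>) x)) / e k) \<partial>lborel) \<le> ?w \<omega>" .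
  qed
  show "AE \<omega> in M. (\<lambda>k. \<integral>\<^sup>+x. ennreal ((clamp_real 1 (1 + \<delta>) (p x) - clamp_real 1 (1 + \<delta>) (infconv p ((\<lambda>v. e k *\<^sub>R v) ` skeleton 1 \<omega>) x)) / e k) \<partial>lborel)
      \<longlonglongrightarrow> (\<integral>\<^sup>+x. ennreal (dsup (skeleton 1 \<omega>) x) * indicator {x. 1 < p x \<and> p x < 1 + \<delta>} x \<partial>lborel)"
  proof (rule AE_I2)
    fix \<omega> assume \<omega>: "\<omega> \<in> space M"
    obtain R where R: "\<And>v. v \<in> skeleton 1 \<omega> \<Longrightarrow> norm v \<le> R"
      using bounded_skeleton[OF \<omega>, of 1] unfolding bounded_iff by auto
    show "(\<lambda>k. \<integral>\<^sup>+x. ennreal ((clamp_real 1 (1 + \<delta>) (p x) - clamp_real 1 (1 + \<delta>) (infconv p ((\<lambda>v. e k *\<^sub>R v) ` skeleton 1 \<omega>) x)) / e k) \<partial>lborel)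
      \<longlonglongrightarrow> (\<integral>\<^sup>+x. ennreal (dsup (skeleton 1 \<omega>) x) * indicator {x. 1 < p x \<and> p x < 1 + \<delta>} x \<partial>lborel)"
      using \<delta> by (intro clamp_integral_limit[OF R zero_in_skeleton[OF \<omega>] _ _ e]) auto
  qed
qed

text \<open>At almost every point \<open>p\<close> has a gradient \<open>g\<close>, and
  \<open>dsup\<close> of any set is its support function there. For the skeleton its mean is a
  constant times \<open>alpha_norm g\<close>, which is the support function of \<open>K\<close> at
  \<open>g\<close>; after Fubini the random range is traded for a multiple of
  \<open>K\<close>.\<close>

lemma expected_dsup_integral:
  assumes K: "\<And>g. (SUP k\<in>K. g \<bullet> k) = alpha_norm g"
    "\<And>k. k \<in> K \<Longrightarrow> norm k \<le> R" "0 \<in> K" and W: "W \<in> sets borel"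
  shows "(\<integral>\<^sup>+\<omega>. \<integral>\<^sup>+x. ennreal (dsup (skeleton 1 \<omega>) x) * indicator W x \<partial>lborel \<partial>M)
    = ennreal (\<alpha> / 2 * mean_abs) * (\<integral>\<^sup>+x. ennreal (dsup K x) * indicator W x \<partial>lborel)"
proof -
  interpret pair_sigma_finite M lborel by unfold_locales
  note [measurable] = borel_measurable_dsup_skeleton W borel_measurable_dsup[OF K(2,3)]
  have \<kappa>: "0 \<le> \<alpha> / 2 * mean_abs" using alpha by (auto simp: mean_abs_def)
  have "(\<integral>\<^sup>+\<omega>. \<integral>\<^sup>+x. ennreal (dsup (skeleton 1 \<omega>) x) * indicator W x \<partial>lborel \<partial>M)
      = (\<integral>\<^sup>+x. \<integral>\<^sup>+\<omega>. ennreal (dsup (skeleton 1 \<omega>) x) * indicator W x \<partial>M \<partial>lborel)"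
  proof (rule Fubini'[symmetric])
    have "(\<lambda>z. ennreal (dsup (skeleton 1 (fst z)) (snd z)) * indicator W (snd z)) \<in> borel_measurable (M \<Otimes>\<^sub>M lborel)"
      by measurable
    then show "(\<lambda>(\<omega>, x). ennreal (dsup (skeleton 1 \<omega>) x) * indicator W x) \<in> borel_measurable (M \<Otimes>\<^sub>M lborel)"
      by (simp add: case_prod_beta')
  qed
  also have "\<dots> = (\<integral>\<^sup>+x. ennreal (\<alpha> / 2 * mean_abs) * (ennreal (dsup K x) * indicator W x) \<partial>lborel)"
  proof (rule nn_integral_cong_AE, rule AE_mp[OF AE_dderiv_linear], intro AE_I2 impI)
    fix x :: "real^'d" assume "\<exists>g. \<forall>h. dderiv x h = g \<bullet> h"
    then obtain g where g: "\<And>h. dderiv x h = g \<bullet> h" by blast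
    have dsup: "dsup S x = (SUP s\<in>S. g \<bullet> s)" for S unfolding dsup_def g by simp
    have "(\<lambda>\<omega>. ennreal (dsup (skeleton 1 \<omega>) x)) \<in> borel_measurable M"
    proof -
      have "(\<lambda>\<omega>. (\<lambda>z. dsup (skeleton 1 (fst z)) (snd z)) (\<omega>, x)) \<in> borel_measurable M"
        by (rule measurable_compose[OF _ borel_measurable_dsup_skeleton]) simp
      then show ?thesis by simp
    qed
    then have "(\<integral>\<^sup>+\<omega>. ennreal (dsup (skeleton 1 \<omega>) x) * indicator W x \<partial>M) = (\<integral>\<^sup>+\<omega>. ennreal (dsup (skeleton 1 \<omega>) x) \<partial>M) * indicator W x"
      by (rule nn_integral_multc)
    also have "(\<integral>\<^sup>+\<omega>. ennreal (dsup (skeleton 1 \<omega>) x) \<partial>M) = ennreal (\<alpha> / 2 * mean_abs * alpha_norm g)"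
      unfolding dsup by (rule nn_integral_sup_skeleton)
    also have "\<dots> = ennreal (\<alpha> / 2 * mean_abs) * ennreal (dsup K x)"
      unfolding dsup K using \<kappa> by (rule ennreal_mult')
    finally show "(\<integral>\<^sup>+\<omega>. ennreal (dsup (skeleton 1 \<omega>) x) * indicator W x \<partial>M) = ennreal (\<alpha> / 2 * mean_abs) * (ennreal (dsup K x) * indicator W x)"
      by (simp add: mult.assoc)
  qed
  also have "\<dots> = ennreal (\<alpha> / 2 * mean_abs) * (\<integral>\<^sup>+x. ennreal (dsup K x) * indicator W x \<partial>lborel)"
    by (rule nn_integral_cmult) measurable
  finally show ?thesis .
qed

text \<open>Shells are taken in the product of probability space and Euclidean space, so that one
  application of the layer-cake formula averages over paths as well.\<close>

lemma emeasure_pair_shell: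
  assumes r: "0 < r"
  shows "emeasure (M \<Otimes>\<^sub>M lborel) {z \<in> space (M \<Otimes>\<^sub>M lborel). infconv p ((\<lambda>v. e *\<^sub>R v) ` skeleton 1 (fst z)) (snd z) < r \<and> r \<le> p (snd z)}
       = ennreal (r ^ CARD('d)) * shell (e / r)"
proof -
  have pm: "(\<lambda>z. p (snd z)) \<in> borel_measurable (M \<Otimes>\<^sub>M lborel)" by measurable
  note [measurable] = borel_measurable_infconv_skeleton[of 1, simplified] pm
  let ?A = "\<lambda>e r. {z \<in> space (M \<Otimes>\<^sub>M lborel). infconv p ((\<lambda>v. e *\<^sub>R v) ` skeleton 1 (fst z)) (snd z) < r \<and> r \<le> p (snd z)}"
  have A: "?A e r \<in> sets (M \<Otimes>\<^sub>M lborel)" for e r by measurable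
  have pre: "Pair \<omega> -` ?A e r = {x. infconv p ((\<lambda>v. e *\<^sub>R v) ` skeleton 1 \<omega>) x < r \<and> r \<le> p x}" if "\<omega> \<in> space M" for \<omega> e r
    using that by (auto simp: space_pair_measure)
  have m: "(\<lambda>\<omega>. emeasure lborel {x. infconv p ((\<lambda>v. e *\<^sub>R v) ` skeleton 1 \<omega>) x < r \<and> r \<le> p x}) \<in> borel_measurable M" for e r
    using lborel.measurable_emeasure_Pair[OF A[of e r]] by (subst (asm) measurable_cong[OF arg_cong[OF pre]])
  have "emeasure (M \<Otimes>\<^sub>M lborel) (?A e r) = (\<integral>\<^sup>+\<omega>. emeasure lborel (Pair \<omega> -` ?A e r) \<partial>M)"
    by (rule lborel.emeasure_pair_measure_alt[OF A])
  also have "\<dots> = (\<integral>\<^sup>+\<omega>. ennreal (r ^ CARD('d)) * emeasure lborel {x. infconv p ((\<lambda>v. (e / r) *\<^sub>R v) ` skeleton 1 \<omega>) x < 1 \<and> 1 \<le> p x} \<partial>M)"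
  proof (intro nn_integral_cong)
    fix \<omega> assume \<omega>: "\<omega> \<in> space M"
    have "skeleton 1 \<omega> \<noteq> {}" using zero_in_skeleton[OF \<omega>] by auto
    from emeasure_infconv_shell_scale[OF this r, of e]
    show "emeasure lborel (Pair \<omega> -` ?A e r) = ennreal (r ^ CARD('d)) * emeasure lborel {x. infconv p ((\<lambda>v. (e / r) *\<^sub>R v) ` skeleton 1 \<omega>) x < 1 \<and> 1 \<le> p x}"
      by (simp only: pre[OF \<omega>]) simp
  qed
  also have "\<dots> = ennreal (r ^ CARD('d)) * shell (e / r)"
    unfolding shell_def by (rule nn_integral_cmult[OF m])
  finally show ?thesis .
qed

lemma shell_finite:
  assumes e: "0 < e" "e \<le> 1"
  shows "shell e < \<infinity>"
proof -
  let ?c = "1 / m"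
  let ?C = "2 * e * DIM(real^'d)"
  have c: "0 \<le> ?c" using m_pos by simp
  have "shell e \<le> (\<integral>\<^sup>+\<omega>. ennreal ?C * ennreal (\<Prod>j\<in>UNIV. 2 * ?c + 2 * path_sup j \<omega>) \<partial>M)"
    unfolding shell_def
  proof (intro nn_integral_mono)
    fix \<omega> assume \<omega>: "\<omega> \<in> space M"
    have "emeasure lborel {x. infconv p ((\<lambda>v. e *\<^sub>R v) ` skeleton 1 \<omega>) x < 1 \<and> 1 \<le> p x}
        \<le> ennreal (?C * (\<Prod>i\<in>Basis. 2 * ?c + 2 * ((\<chi> j. path_sup j \<omega>) \<bullet> i)))"
      by (rule infconv_shell_bound[OF zero_in_skeleton[OF \<omega>] skeleton_subset_cbox[OF \<omega>] e]) (use m_pos in auto)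
    also have "(\<Prod>i\<in>Basis. 2 * ?c + 2 * ((\<chi> j. path_sup j \<omega>) \<bullet> i)) = (\<Prod>j\<in>UNIV. 2 * ?c + 2 * path_sup j \<omega>)"
      by (rule prod_Basis_cart)
    also have "ennreal (?C * (\<Prod>j\<in>UNIV. 2 * ?c + 2 * path_sup j \<omega>)) = ennreal ?C * ennreal (\<Prod>j\<in>UNIV. 2 * ?c + 2 * path_sup j \<omega>)"
      using e by (intro ennreal_mult') simp
    finally show "emeasure lborel {x. infconv p ((\<lambda>v. e *\<^sub>R v) ` skeleton 1 \<omega>) x < 1 \<and> 1 \<le> p x}
        \<le> ennreal ?C * ennreal (\<Prod>j\<in>UNIV. 2 * ?c + 2 * path_sup j \<omega>)" .
  qed
  also have "\<dots> < \<infinity>"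
    using nn_integral_prod_path_sup[OF c] by (subst nn_integral_cmult) (auto simp: ennreal_mult_less_top)
  finally show ?thesis .
qed

text \<open>The truncated integrals \<open>J\<close> equal the window averages \<open>I\<close>
  divided by \<open>e\<close>, and they converge to \<open>\<kappa>\<close> times the window
  integral \<open>Q\<close> of \<open>K\<close>. As \<open>Q\<close> is squeezed by the slope
  \<open>D\<close> of \<open>K\<close>, the Tauberian step yields
  \<open>\<kappa> * D\<close>.\<close>

lemma shell_slope:
  assumes K: "\<And>g. (SUP k\<in>K. g \<bullet> k) = alpha_norm g" "compact K" "convex K" "0 \<in> K" and D0: "0 \<le> D"
    and D: "((\<lambda>e. (measure lborel (minkowski {x. p x \<le> 1} ((\<lambda>v. e *\<^sub>R v) ` K)) - measure lborel {x. p x \<le> 1}) / e) \<longlongrightarrow> D) (at_right 0)"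
  shows "((\<lambda>e. enn2real (shell e) / e) \<longlongrightarrow> \<alpha> / 2 * mean_abs * D) (at_right 0)"
proof -
  interpret pair_sigma_finite M lborel by unfold_locales
  define \<kappa> where "\<kappa> = \<alpha> / 2 * mean_abs"
  have \<kappa>: "0 \<le> \<kappa>" using alpha by (auto simp: \<kappa>_def mean_abs_def)
  define I where "I = (\<lambda>\<delta> e. \<integral>\<^sup>+r. emeasure (M \<Otimes>\<^sub>M lborel) {z \<in> space (M \<Otimes>\<^sub>M lborel). infconv p ((\<lambda>v. e *\<^sub>R v) ` skeleton 1 (fst z)) (snd z) < r \<and> r \<le> p (snd z)} * indicator {1..1 + \<delta>} r \<partial>lborel)"
  define J where "J = (\<lambda>\<delta> e. \<integral>\<^sup>+\<omega>. \<integral>\<^sup>+x. ennreal ((clamp_real 1 (1 + \<delta>) (p x) - clamp_real 1 (1 + \<delta>) (infconv p ((\<lambda>v. e *\<^sub>R v) ` skeleton 1 \<omega>) x)) / e) \<partial>lborel \<partial>M)"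
  define Q where "Q = (\<lambda>\<delta>. \<integral>\<^sup>+x. ennreal (dsup K x) * indicator {x. 1 < p x \<and> p x < 1 + \<delta>} x \<partial>lborel)"
  have I_low: "ennreal \<delta> * shell (e / (1 + \<delta>)) \<le> I \<delta> e"
    and I_up: "I \<delta> e \<le> ennreal (\<delta> * (1 + \<delta>) ^ CARD('d)) * shell e" if "0 < \<delta>" "0 < e" for \<delta> e
    unfolding I_def
    by (rule window_average_bounds[where F = shell and n = "CARD('d)"];
        (use that in \<open>auto intro!: emeasure_pair_shell shell_mono\<close>)?)+
  have I_fin: "I \<delta> e < \<infinity>" if "0 < \<delta>" "0 < e" "e \<le> 1" for \<delta> e
    using I_up[OF that(1,2)] shell_finite[OF that(2,3)] by (auto simp: ennreal_mult_less_top intro: le_less_trans)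
  have pm: "(\<lambda>z. p (snd z)) \<in> borel_measurable (M \<Otimes>\<^sub>M lborel)" by measurable
  have JI: "J \<delta> e = ennreal (1 / e) * I \<delta> e" if "0 < \<delta>" "0 < e" for \<delta> e
  proof -
    note m [measurable] = borel_measurable_infconv_skeleton[of 1 e, simplified] pm
    \<comment> \<open>Off the space of \<open>M\<close> nothing is known about the paths; replacing
      the inf-convolution by \<open>p\<close> there makes the inequality \<open>?q \<le> p\<close>
      hold everywhere, as the layer-cake formula demands.\<close>
    let ?q = "\<lambda>z. if fst z \<in> space M then infconv p ((\<lambda>v. e *\<^sub>R v) ` skeleton 1 (fst z)) (snd z) else p (snd z)"
    let ?f = "\<lambda>z. ennreal ((clamp_real 1 (1 + \<delta>) (p (snd z)) - clamp_real 1 (1 + \<delta>) (?q z)) / e)"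
    have q: "?q \<in> borel_measurable (M \<Otimes>\<^sub>M lborel)"
      using m(1) by (subst measurable_cong[where g = "\<lambda>z. infconv p ((\<lambda>v. e *\<^sub>R v) ` skeleton 1 (fst z)) (snd z)"]) (auto simp: space_pair_measure)
    have le: "?q z \<le> p (snd z)" for z
    proof (cases "fst z \<in> space M")
      case True
      then have "0 \<in> (\<lambda>v. e *\<^sub>R v) ` skeleton 1 (fst z)" using zero_in_skeleton[OF True, of 1] by force
      from infconv_le_gauge[OF this] show ?thesis using True by simp
    qed simp
    have "?f \<in> borel_measurable (M \<Otimes>\<^sub>M lborel)" using q pm by measurable
    from lborel.nn_integral_fst[OF this]
    have "(\<integral>\<^sup>+\<omega>. \<integral>\<^sup>+x. ?f (\<omega>, x) \<partial>lborel \<partial>M) = (\<integral>\<^sup>+z. ?f z \<partial>(M \<Otimes>\<^sub>M lborel))" .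
    moreover have "J \<delta> e = (\<integral>\<^sup>+\<omega>. \<integral>\<^sup>+x. ?f (\<omega>, x) \<partial>lborel \<partial>M)"
      unfolding J_def by (intro nn_integral_cong) simp
    moreover have "(\<integral>\<^sup>+z. ?f z \<partial>(M \<Otimes>\<^sub>M lborel)) = ennreal (1 / e) * (\<integral>\<^sup>+r. emeasure (M \<Otimes>\<^sub>M lborel) {z \<in> space (M \<Otimes>\<^sub>M lborel). ?q z < r \<and> r \<le> p (snd z)} * indicator {1..1 + \<delta>} r \<partial>lborel)"
      using that le by (intro nn_integral_clamp_layers_divide sigma_finite_measure_axioms q pm) auto
    moreover have "{z \<in> space (M \<Otimes>\<^sub>M lborel). ?q z < r \<and> r \<le> p (snd z)}
        = {z \<in> space (M \<Otimes>\<^sub>M lborel). infconv p ((\<lambda>v. e *\<^sub>R v) ` skeleton 1 (fst z)) (snd z) < r \<and> r \<le> p (snd z)}" for r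
      by (auto simp: space_pair_measure)
    ultimately show ?thesis unfolding I_def by simp
  qed
  obtain R where R: "\<And>k. k \<in> K \<Longrightarrow> norm k \<le> R" using compact_imp_bounded[OF K(2)] unfolding bounded_iff by blast
  have W: "{x. 1 < p x \<and> p x < 1 + \<delta>} \<in> sets borel" for \<delta> by measurable
  have Jlim: "(\<lambda>k. J \<delta> (e k)) \<longlonglongrightarrow> ennreal \<kappa> * Q \<delta>"
    if "0 < \<delta>" "\<And>k. 0 < e k" "\<And>k. e k \<le> 1" "e \<longlonglongrightarrow> 0" for \<delta> e
    using expected_clamp_integral_limit[OF that] expected_dsup_integral[OF K(1) R K(4) W]
    unfolding J_def Q_def \<kappa>_def by simp
  note Qb = window_integral_bounds[OF K(2-4) _ D]
  have Qfin: "Q \<delta> < \<infinity>" if "0 < \<delta>" for \<delta>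
    using Qb(2)[OF that] unfolding Q_def by (rule le_less_trans) simp
  have Qreal: "Q \<delta> = ennreal (enn2real (Q \<delta>))" if "0 < \<delta>" for \<delta> using Qfin[OF that] by simp
  show ?thesis
  proof (fold \<kappa>_def, rule slope_limit_of_window_averages[where A = "\<lambda>\<delta> e. enn2real (I \<delta> e)" and Q = "\<lambda>\<delta>. \<kappa> * enn2real (Q \<delta>)" and n = "CARD('d)"])
    fix \<delta> e :: real assume \<delta>: "0 < \<delta>" and e: "0 < e" "e \<le> 1"
    have "enn2real (ennreal \<delta> * shell (e / (1 + \<delta>))) \<le> enn2real (I \<delta> e)"
      using I_low[OF \<delta> e(1)] I_fin[OF \<delta> e] by (intro enn2real_mono) auto
    then show "\<delta> * enn2real (shell (e / (1 + \<delta>))) \<le> enn2real (I \<delta> e)" using \<delta> by (simp add: enn2real_mult)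
    have "enn2real (I \<delta> e) \<le> enn2real (ennreal (\<delta> * (1 + \<delta>) ^ CARD('d)) * shell e)"
      using I_up[OF \<delta> e(1)] shell_finite[OF e] by (intro enn2real_mono) (auto simp: ennreal_mult_less_top)
    then show "enn2real (I \<delta> e) \<le> \<delta> * (1 + \<delta>) ^ CARD('d) * enn2real (shell e)" using \<delta> by (simp add: enn2real_mult)
  next
    fix \<delta> :: real assume \<delta>: "0 < \<delta>"
    show "((\<lambda>e. enn2real (I \<delta> e) / e) \<longlongrightarrow> \<kappa> * enn2real (Q \<delta>)) (at_right 0)"
      unfolding tendsto_at_iff_sequentially
    proof (intro allI impI)
      fix e :: "nat \<Rightarrow> real" assume e: "\<forall>i. e i \<in> {0<..} - {0}" "e \<longlonglongrightarrow> 0"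
      \<comment> \<open>The bounds hold for scales at most 1, which an arbitrary null sequence
        reaches only eventually.\<close>
      define e' where "e' = (\<lambda>k. min 1 (e k))"
      have e': "0 < e' k" "e' k \<le> 1" for k using e(1) by (auto simp: e'_def)
      have "e' \<longlonglongrightarrow> min 1 0" unfolding e'_def by (intro tendsto_min tendsto_const e(2))
      then have e'0: "e' \<longlonglongrightarrow> 0" by simp
      have "(\<lambda>k. J \<delta> (e' k)) \<longlonglongrightarrow> ennreal (\<kappa> * enn2real (Q \<delta>))"
        using Jlim[OF \<delta> e' e'0] \<kappa> by (subst ennreal_mult') (simp_all add: Qreal[OF \<delta>, symmetric])
      then have "(\<lambda>k. enn2real (J \<delta> (e' k))) \<longlonglongrightarrow> \<kappa> * enn2real (Q \<delta>)"
        using \<kappa> by (intro tendsto_enn2real) auto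
      moreover have "\<forall>\<^sub>F k in sequentially. e k < 1" using e(2) by (rule order_tendstoD) simp
      then have "\<forall>\<^sub>F k in sequentially. enn2real (J \<delta> (e' k)) = ((\<lambda>e. enn2real (I \<delta> e) / e) \<circ> e) k"
      proof eventually_elim
        case (elim k)
        then have "e' k = e k" by (simp add: e'_def)
        then show ?case using JI[OF \<delta>, of "e k"] e'(1)[of k] by (simp add: enn2real_mult)
      qed
      ultimately show "((\<lambda>e. enn2real (I \<delta> e) / e) \<circ> e) \<longlonglongrightarrow> \<kappa> * enn2real (Q \<delta>)"
        by (rule Lim_transform_eventually)
    qed
    have "\<delta> * D / (1 + \<delta>) \<le> enn2real (Q \<delta>)"
    proof -
      have "ennreal (\<delta> * D / (1 + \<delta>)) \<le> ennreal (enn2real (Q \<delta>))"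
        unfolding Qreal[OF \<delta>, symmetric] using Qb(1)[OF \<delta>] unfolding Q_def .
      then show ?thesis by (simp only: ennreal_le_iff[OF enn2real_nonneg])
    qed
    from mult_left_mono[OF this \<kappa>] show "\<delta> * (\<kappa> * D) / (1 + \<delta>) \<le> \<kappa> * enn2real (Q \<delta>)" by (simp add: mult_ac)
    have "enn2real (Q \<delta>) \<le> \<delta> * (1 + \<delta>) ^ CARD('d) * D"
    proof -
      have "Q \<delta> \<le> ennreal (\<delta> * (1 + \<delta>) ^ CARD('d) * D)" using Qb(2)[OF \<delta>] by (simp add: Q_def)
      then show ?thesis using D0 \<delta> by (intro enn2real_leI) auto
    qed
    from mult_left_mono[OF this \<kappa>] show "\<kappa> * enn2real (Q \<delta>) \<le> \<delta> * (1 + \<delta>) ^ CARD('d) * (\<kappa> * D)" by (simp add: mult_ac)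
  qed
qed

end

section \<open>Duality of \<open>lp_ball\<close> and the dual norm\<close>

lemma lp_ball_iff:
  "0 < b \<Longrightarrow> u \<in> lp_ball b \<longleftrightarrow> (\<Sum>i\<in>UNIV. \<bar>u $ i\<bar> powr b) \<le> 1"
proof -
  assume b: "0 < b"
  have T: "0 \<le> (\<Sum>i\<in>UNIV. \<bar>u $ i\<bar> powr b)" by (intro sum_nonneg) auto
  have "T powr (1 / b) \<le> 1 \<longleftrightarrow> T \<le> 1" if T: "0 \<le> T" for T :: real
  proof
    assume "T powr (1 / b) \<le> 1"
    then have "(T powr (1 / b)) powr b \<le> 1 powr b" using b by (intro powr_mono2) auto
    then show "T \<le> 1" using b T by (simp add: powr_powr)
  next
    assume "T \<le> 1"
    then have "T powr (1 / b) \<le> 1 powr (1 / b)" using b T by (intro powr_mono2) auto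
    then show "T powr (1 / b) \<le> 1" by simp
  qed
  from this[OF T] show ?thesis by (simp add: lp_ball_def)
qed

context
  fixes a b :: real
  assumes conj: "1 < a" "1 < b" "1 / a + 1 / b = 1"
begin

lemma conjugate_exponents: "(a - 1) * b = a" "(b - 1) * a = b"
  using conj by (simp_all add: field_simps)

text \<open>Hoelder's inequality: normalise \<open>g\<close> by its norm \<open>N\<close> and apply
  Young's inequality coordinatewise; \<open>N = 0\<close> means \<open>g = 0\<close>.\<close>

lemma inner_lp_ball_le:
  fixes u g :: "real^'d"
  assumes u: "u \<in> lp_ball b"
  shows "g \<bullet> u \<le> (\<Sum>j\<in>UNIV. \<bar>g $ j\<bar> powr a) powr (1 / a)"
proof -
  define N where "N = (\<Sum>j\<in>UNIV. \<bar>g $ j\<bar> powr a) powr (1 / a)"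
  have S0: "0 \<le> (\<Sum>j\<in>UNIV. \<bar>g $ j\<bar> powr a)" by (intro sum_nonneg) auto
  have Na: "N powr a = (\<Sum>j\<in>UNIV. \<bar>g $ j\<bar> powr a)" using conj S0 by (simp add: N_def powr_powr)
  have T: "(\<Sum>i\<in>UNIV. \<bar>u $ i\<bar> powr b) \<le> 1" using u conj by (simp add: lp_ball_iff)
  show ?thesis
  proof (cases "N = 0")
    case True
    then have "(\<Sum>j\<in>UNIV. \<bar>g $ j\<bar> powr a) = 0" using Na by simp
    then have "g $ j = 0" for j by (subst (asm) sum_nonneg_eq_0_iff) auto
    then have "g = 0" by (simp add: vec_eq_iff)
    then show ?thesis by simp
  next
    case False
    then have N: "0 < N" by (simp add: N_def less_le)
    have "(g \<bullet> u) / N = (\<Sum>i\<in>UNIV. (g $ i / N) * u $ i)"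
      by (simp add: inner_vec_def sum_divide_distrib)
    also have "\<dots> \<le> (\<Sum>i\<in>UNIV. (\<bar>g $ i\<bar> / N) powr a / a + \<bar>u $ i\<bar> powr b / b)"
    proof (rule sum_mono)
      fix i
      have "(g $ i / N) * u $ i \<le> \<bar>(g $ i / N) * u $ i\<bar>" by (rule abs_ge_self)
      also have "\<dots> = (\<bar>g $ i\<bar> / N) * \<bar>u $ i\<bar>" using N by (simp add: abs_mult)
      also have "\<dots> \<le> (\<bar>g $ i\<bar> / N) powr a / a + \<bar>u $ i\<bar> powr b / b"
        using conj N by (intro Youngs_inequality) auto
      finally show "(g $ i / N) * u $ i \<le> (\<bar>g $ i\<bar> / N) powr a / a + \<bar>u $ i\<bar> powr b / b" .
    qed
    also have "\<dots> = (\<Sum>i\<in>UNIV. \<bar>g $ i\<bar> powr a) / N powr a / a + (\<Sum>i\<in>UNIV. \<bar>u $ i\<bar> powr b) / b"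
      using N by (simp add: sum.distrib sum_divide_distrib powr_divide)
    also have "\<dots> \<le> 1 / a + 1 / b"
      using T conj N by (intro add_mono divide_right_mono) (auto simp: Na[symmetric])
    finally have "(g \<bullet> u) / N \<le> 1" using conj by simp
    then show ?thesis using N by (simp add: N_def[symmetric])
  qed
qed

text \<open>Written as an intersection of half-spaces, the ball is seen to be convex and closed. For
  the converse inclusion the test vector is the signed power \<open>b - 1\<close> of
  \<open>u\<close>; it gives \<open>T \<le> T powr (1 / a)\<close> for \<open>T\<close> the sum of
  \<open>b\<close>-th powers, which forces \<open>T \<le> 1\<close>.\<close>

lemma lp_ball_dual:
  "lp_ball b = {u :: real^'d. \<forall>g. g \<bullet> u \<le> (\<Sum>j\<in>UNIV. \<bar>g $ j\<bar> powr a) powr (1 / a)}"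
proof (intro equalityI subsetI)
  fix u :: "real^'d" assume u: "u \<in> {u. \<forall>g. g \<bullet> u \<le> (\<Sum>j\<in>UNIV. \<bar>g $ j\<bar> powr a) powr (1 / a)}"
  define T where "T = (\<Sum>i\<in>UNIV. \<bar>u $ i\<bar> powr b)"
  define g :: "real^'d" where "g = (\<chi> i. sgn (u $ i) * \<bar>u $ i\<bar> powr (b - 1))"
  have "\<bar>g $ i\<bar> powr a = \<bar>u $ i\<bar> powr b" for i
    using conj conjugate_exponents by (cases "u $ i = 0") (auto simp: g_def abs_mult powr_powr)
  moreover have "g $ i * u $ i = \<bar>u $ i\<bar> powr b" for i
  proof (cases "u $ i = 0")
    case False
    have "g $ i * u $ i = (u $ i * sgn (u $ i)) * \<bar>u $ i\<bar> powr (b - 1)" by (simp add: g_def)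
    also have "\<dots> = \<bar>u $ i\<bar> powr 1 * \<bar>u $ i\<bar> powr (b - 1)" by (simp flip: abs_sgn)
    also have "\<dots> = \<bar>u $ i\<bar> powr b" by (simp only: powr_add[symmetric]) simp
    finally show ?thesis .
  qed (simp add: g_def)
  then have "g \<bullet> u = T" by (simp add: inner_vec_def T_def)
  ultimately have "T \<le> T powr (1 / a)" using u by (auto simp: T_def dest: spec[of _ g])
  then have "T \<le> 1" using powr_less_mono[of "1 / a" 1 T] conj by (cases "1 < T") auto
  then show "u \<in> lp_ball b" using conj by (simp add: lp_ball_iff T_def)
qed (use inner_lp_ball_le in blast)

lemma convex_lp_ball: "convex (lp_ball b :: (real^'d) set)"
  unfolding lp_ball_dual Collect_all_eq by (intro convex_INT convex_halfspace_le ballI)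

lemma compact_lp_ball: "compact (lp_ball b :: (real^'d) set)"
proof -
  have "closed (lp_ball b :: (real^'d) set)"
    unfolding lp_ball_dual Collect_all_eq by (intro closed_INT closed_halfspace_le ballI)
  moreover have "norm u \<le> real CARD('d)" if "u \<in> lp_ball b" for u :: "real^'d"
  proof -
    have "\<bar>u $ i\<bar> \<le> 1" for i
    proof -
      have "\<bar>u $ i\<bar> powr b \<le> (\<Sum>i\<in>UNIV. \<bar>u $ i\<bar> powr b)" by (intro member_le_sum) auto
      also have "\<dots> \<le> 1" using that conj by (simp add: lp_ball_iff)
      finally have "(\<bar>u $ i\<bar> powr b) powr (1 / b) \<le> 1 powr (1 / b)" using conj by (intro powr_mono2) auto
      then show ?thesis using conj by (simp add: powr_powr)
    qed
    then have "(\<Sum>i\<in>UNIV. \<bar>u $ i\<bar>) \<le> (\<Sum>i\<in>(UNIV :: 'd set). 1)" by (intro sum_mono)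
    then show ?thesis using norm_le_l1_cart[of u] by simp
  qed
  ultimately show ?thesis by (auto simp: compact_eq_bounded_closed bounded_iff)
qed

lemma zero_in_interior_lp_ball: "0 \<in> interior (lp_ball b :: (real^'d) set)"
proof -
  have "ball 0 (1 / real CARD('d)) \<subseteq> (lp_ball b :: (real^'d) set)"
  proof
    fix u :: "real^'d" assume "u \<in> ball 0 (1 / real CARD('d))"
    then have nu: "norm u \<le> 1 / real CARD('d)" by simp
    have "\<bar>u $ i\<bar> powr b \<le> 1 / real CARD('d)" for i
    proof -
      have 1: "\<bar>u $ i\<bar> \<le> 1 / real CARD('d)" using component_le_norm_cart[of u i] nu by simp
      also have "\<dots> \<le> 1" by (simp add: divide_le_eq)
      finally have "\<bar>u $ i\<bar> powr b \<le> \<bar>u $ i\<bar> powr 1" using conj by (intro powr_mono') auto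
      then show ?thesis using 1 by simp
    qed
    then have "(\<Sum>i\<in>UNIV. \<bar>u $ i\<bar> powr b) \<le> (\<Sum>i\<in>(UNIV :: 'd set). 1 / real CARD('d))" by (intro sum_mono)
    then show "u \<in> lp_ball b" using conj by (simp add: lp_ball_iff)
  qed
  then have "ball 0 (1 / real CARD('d)) \<subseteq> interior (lp_ball b :: (real^'d) set)"
    by (rule interior_maximal) (rule open_ball)
  moreover have "(0 :: real^'d) \<in> ball 0 (1 / real CARD('d))" by simp
  ultimately show ?thesis by blast
qed

lemma SUP_inner_lp_ball:
  fixes g :: "real^'d"
  shows "(SUP u\<in>lp_ball b. g \<bullet> u) = (\<Sum>j\<in>UNIV. \<bar>g $ j\<bar> powr a) powr (1 / a)"
proof -
  define N where "N = (\<Sum>j\<in>UNIV. \<bar>g $ j\<bar> powr a) powr (1 / a)"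
  have S0: "0 \<le> (\<Sum>j\<in>UNIV. \<bar>g $ j\<bar> powr a)" by (intro sum_nonneg) auto
  have Na: "N powr a = (\<Sum>j\<in>UNIV. \<bar>g $ j\<bar> powr a)" using conj S0 by (simp add: N_def powr_powr)
  have "\<exists>u\<in>lp_ball b. g \<bullet> u = N"
  proof (cases "N = 0")
    case True
    then have "(\<Sum>j\<in>UNIV. \<bar>g $ j\<bar> powr a) = 0" using Na by simp
    then have "g $ j = 0" for j by (subst (asm) sum_nonneg_eq_0_iff) auto
    then have "g = 0" by (simp add: vec_eq_iff)
    then show ?thesis using True zero_in_interior_lp_ball interior_subset by (intro bexI[of _ 0]) auto
  next
    case False
    then have N: "0 < N" by (simp add: N_def less_le)
    \<comment> \<open>The equality case of Hoelder's inequality: the exponent \<open>a - 1\<close>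
      makes the \<open>b\<close>-th power of \<open>u\<close> equal to the \<open>a\<close>-th power
      of the normalised \<open>g\<close>.\<close>
    define u :: "real^'d" where "u = (\<chi> i. sgn (g $ i) * (\<bar>g $ i\<bar> / N) powr (a - 1))"
    have "\<bar>u $ i\<bar> powr b = (\<bar>g $ i\<bar> / N) powr a" for i
      using conj conjugate_exponents N by (cases "g $ i = 0") (auto simp: u_def abs_mult powr_powr)
    then have "(\<Sum>i\<in>UNIV. \<bar>u $ i\<bar> powr b) = (\<Sum>j\<in>UNIV. \<bar>g $ j\<bar> powr a) / N powr a"
      using N by (simp add: powr_divide sum_divide_distrib)
    then have "u \<in> lp_ball b" using N conj by (simp add: lp_ball_iff Na[symmetric])
    moreover have "g $ i * u $ i = N * (\<bar>g $ i\<bar> / N) powr a" for i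
    proof (cases "g $ i = 0")
      case False
      have "g $ i * u $ i = (g $ i * sgn (g $ i)) * (\<bar>g $ i\<bar> / N) powr (a - 1)" by (simp add: u_def)
      also have "\<dots> = N * ((\<bar>g $ i\<bar> / N) powr 1 * (\<bar>g $ i\<bar> / N) powr (a - 1))"
        using N by (simp flip: abs_sgn)
      also have "(\<bar>g $ i\<bar> / N) powr 1 * (\<bar>g $ i\<bar> / N) powr (a - 1) = (\<bar>g $ i\<bar> / N) powr a"
        by (simp only: powr_add[symmetric]) simp
      finally show ?thesis .
    qed (simp add: u_def)
    then have "g \<bullet> u = N * ((\<Sum>j\<in>UNIV. \<bar>g $ j\<bar> powr a) / N powr a)"
      using N by (simp add: inner_vec_def powr_divide sum_divide_distrib sum_distrib_left)
    then have "g \<bullet> u = N" using N by (simp add: Na[symmetric])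
    ultimately show ?thesis by blast
  qed
  then obtain u where u: "u \<in> lp_ball b" "g \<bullet> u = N" by blast
  have "(SUP u\<in>lp_ball b. g \<bullet> u) = N"
  proof (rule cSup_eq_maximum)
    show "N \<in> (\<lambda>u. g \<bullet> u) ` lp_ball b" using u by force
  qed (auto simp: N_def intro: inner_lp_ball_le)
  then show ?thesis by (simp add: N_def)
qed

end

section \<open>From shells to the expected volume of the enlarged body\<close>

context stable_gauge
begin

lemma shell_scaling_general:
  assumes c: "0 < c" and t: "0 < t"
  shows "(\<integral>\<^sup>+\<omega>. emeasure lborel {x. infconv p ((\<lambda>v. c *\<^sub>R v) ` skeleton t \<omega>) x < 1 \<and> 1 \<le> p x} \<partial>M) = shell (c * t powr (1 / \<alpha>))"
proof -
  define e where "e = c * t powr (1 / \<alpha>)"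
  have e: "0 < e" using c t by (simp add: e_def)
  have ea: "e powr \<alpha> = c powr \<alpha> * t" using c t alpha by (simp add: e_def powr_mult powr_powr)
  have "distr M (PiM UNIV (\<lambda>_. PiM {..<2 ^ n} (\<lambda>_. borel))) (\<lambda>\<omega> j. \<lambda>k\<in>{..<2 ^ n}. c * incr (t / 2 ^ n) j k \<omega>)
      = distr M (PiM UNIV (\<lambda>_. PiM {..<2 ^ n} (\<lambda>_. borel))) (\<lambda>\<omega> j. \<lambda>k\<in>{..<2 ^ n}. incr (e powr \<alpha> / 2 ^ n) j k \<omega>)" for n :: nat
    using grid_law[of "t / 2 ^ n" c "e powr \<alpha> / 2 ^ n" id "2 ^ n"] c t ea by (simp add: permutes_id)
  then show ?thesis
    using expected_shell_eq_SUP_grid[of "e powr \<alpha>" 1] expected_shell_eq_SUP_grid[of t c] shell_scaling[OF e] t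
    unfolding e_def[symmetric] by (simp add: image_def)
qed

text \<open>On the compact closure of the skeleton the infimum is attained; conversely, a point of
  the closure is replaced by a skeleton point at arbitrarily small cost, by the Lipschitz
  bound.\<close>

lemma minkowski_range_set:
  assumes \<omega>: "\<omega> \<in> space M" and t: "0 < t"
  shows "minkowski (range_set X t \<omega>) {x. p x \<le> 1} = {x. infconv p (skeleton t \<omega>) x \<le> 1}"
proof (intro equalityI subsetI)
  let ?S = "skeleton t \<omega>"
  have cl: "range_set X t \<omega> = closure ?S" using closure_skeleton[OF assms] by simp
  have ne: "?S \<noteq> {}" using zero_in_skeleton[OF \<omega>] by auto
  {
    fix x assume "x \<in> minkowski (range_set X t \<omega>) {x. p x \<le> 1}"
    then obtain s y where s: "s \<in> closure ?S" "p y \<le> 1" "x = s + y" by (auto simp: minkowski_def cl)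
    have "infconv p ?S x \<le> 1"
    proof (rule field_le_epsilon)
      fix \<epsilon> :: real assume \<epsilon>: "0 < \<epsilon>"
      then obtain s' where s': "s' \<in> ?S" "dist s' s < \<epsilon> / L"
        using s(1) L_pos by (auto simp: closure_approachable dest: spec[of _ "\<epsilon> / L"])
      have "infconv p ?S x \<le> p (x - s')" by (rule infconv_le[OF s'(1)])
      also have "\<dots> \<le> p (x - s) + L * norm (s - s')" using gauge_lipschitz[of "x - s'" "x - s"] by simp
      also have "\<dots> \<le> 1 + \<epsilon>" using s s' L_pos by (auto simp: dist_norm norm_minus_commute field_simps intro: add_mono)
      finally show "infconv p ?S x \<le> 1 + \<epsilon>" .
    qed
    then show "x \<in> {x. infconv p ?S x \<le> 1}" by simp
  next
    fix x assume x: "x \<in> {x. infconv p ?S x \<le> 1}"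
    have "compact (closure ?S)" using bounded_skeleton[OF \<omega>, of t] t by (simp add: compact_closure)
    moreover have "continuous_on (closure ?S) (\<lambda>s. p (x - s))"
      by (intro continuous_on_compose2[OF continuous_on_gauge[of UNIV]] continuous_intros) auto
    ultimately obtain s where s: "s \<in> closure ?S" "\<And>s'. s' \<in> closure ?S \<Longrightarrow> p (x - s) \<le> p (x - s')"
      using continuous_attains_inf[of "closure ?S" "\<lambda>s. p (x - s)"] ne by auto
    have "p (x - s) \<le> infconv p ?S x"
      unfolding infconv_def using ne s(2) closure_subset by (intro cINF_greatest) auto
    then have "p (x - s) \<le> 1" using x by simp
    moreover have "x = s + (x - s)" by simp
    ultimately show "x \<in> minkowski (range_set X t \<omega>) {x. p x \<le> 1}"
      unfolding minkowski_def cl using s(1) by blast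
  }
qed

lemma borel_measurable_infconv_volume:
  assumes "0 \<le> t"
  shows "(\<lambda>\<omega>. emeasure lborel {x. infconv p (skeleton t \<omega>) x \<le> r}) \<in> borel_measurable M"
proof -
  note [measurable] = borel_measurable_infconv_skeleton[OF assms, of 1, simplified]
  let ?A = "{z \<in> space (M \<Otimes>\<^sub>M lborel). infconv p (skeleton t (fst z)) (snd z) \<le> r}"
  have A: "?A \<in> sets (M \<Otimes>\<^sub>M lborel)" by measurable
  have "Pair \<omega> -` ?A = {x. infconv p (skeleton t \<omega>) x \<le> r}" if "\<omega> \<in> space M" for \<omega>
    using that by (auto simp: space_pair_measure)
  then show ?thesis
    using lborel.measurable_emeasure_Pair[OF A] by (subst (asm) measurable_cong) auto
qed

lemma nn_integral_infconv_less:
  assumes t: "0 < t" and r: "0 < r"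
  shows "(\<integral>\<^sup>+\<omega>. emeasure lborel {x. infconv p (skeleton t \<omega>) x < r} \<partial>M)
    = ennreal (r ^ CARD('d)) * (shell (t powr (1 / \<alpha>) / r) + emeasure lborel {x. p x \<le> 1})"
proof -
  have split: "emeasure lborel {x. infconv p (skeleton t \<omega>) x < r}
      = ennreal (r ^ CARD('d)) * emeasure lborel {x. infconv p ((\<lambda>v. (1 / r) *\<^sub>R v) ` skeleton t \<omega>) x < 1 \<and> 1 \<le> p x}
        + ennreal (r ^ CARD('d)) * emeasure lborel {x. p x \<le> 1}" if \<omega>: "\<omega> \<in> space M" for \<omega>
  proof -
    have ne: "skeleton t \<omega> \<noteq> {}" using zero_in_skeleton[OF \<omega>] by auto
    note [measurable] = borel_measurable_infconv[OF ne]
    have "{x. infconv p (skeleton t \<omega>) x < r} = {x. infconv p (skeleton t \<omega>) x < r \<and> r \<le> p x} \<union> {x. p x < r}"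
      using infconv_le_gauge[OF zero_in_skeleton[OF \<omega>]] by (auto intro: le_less_trans)
    moreover have "emeasure lborel ({x. infconv p (skeleton t \<omega>) x < r \<and> r \<le> p x} \<union> {x. p x < r})
        = emeasure lborel {x. infconv p (skeleton t \<omega>) x < r \<and> r \<le> p x} + emeasure lborel {x. p x < r}"
      by (rule plus_emeasure[symmetric]) (measurable, auto)
    moreover have "emeasure lborel {x. infconv p (skeleton t \<omega>) x < r \<and> r \<le> p x}
        = ennreal (r ^ CARD('d)) * emeasure lborel {x. infconv p ((\<lambda>v. (1 / r) *\<^sub>R v) ` skeleton t \<omega>) x < 1 \<and> 1 \<le> p x}"
      using emeasure_infconv_shell_scale[OF ne r, of 1] by simp
    moreover have "emeasure lborel {x. p x < r} = ennreal (r ^ CARD('d)) * emeasure lborel {x. p x \<le> 1}"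
    proof -
      have "{x. p x \<le> r} = (\<lambda>x. r *\<^sub>R x) ` {x. p x \<le> 1}"
      proof (intro equalityI subsetI)
        fix x assume "x \<in> {x. p x \<le> r}"
        then have "p ((1 / r) *\<^sub>R x) \<le> 1" using r by (simp add: gauge_scaleR)
        moreover have "x = r *\<^sub>R ((1 / r) *\<^sub>R x)" using r by simp
        ultimately show "x \<in> (\<lambda>x. r *\<^sub>R x) ` {x. p x \<le> 1}" by blast
      qed (use r in \<open>auto simp: gauge_scaleR mult_left_le\<close>)
      then show ?thesis
        using emeasure_gauge_less[OF r] emeasure_lborel_scaleR_image[OF r borel_compact[OF compact_gauge_le[of 1]]] by simp
    qed
    ultimately show ?thesis by simp
  qed
  have m: "(\<lambda>\<omega>. emeasure lborel {x. infconv p ((\<lambda>v. (1 / r) *\<^sub>R v) ` skeleton t \<omega>) x < 1 \<and> 1 \<le> p x}) \<in> borel_measurable M"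
  proof -
    have pm: "(\<lambda>z. p (snd z)) \<in> borel_measurable (M \<Otimes>\<^sub>M lborel)" by measurable
    note [measurable] = borel_measurable_infconv_skeleton[OF less_imp_le[OF t], of "1 / r"] pm
    let ?A = "{z \<in> space (M \<Otimes>\<^sub>M lborel). infconv p ((\<lambda>v. (1 / r) *\<^sub>R v) ` skeleton t (fst z)) (snd z) < 1 \<and> 1 \<le> p (snd z)}"
    have A: "?A \<in> sets (M \<Otimes>\<^sub>M lborel)" by measurable
    have "Pair \<omega> -` ?A = {x. infconv p ((\<lambda>v. (1 / r) *\<^sub>R v) ` skeleton t \<omega>) x < 1 \<and> 1 \<le> p x}" if "\<omega> \<in> space M" for \<omega>
      using that by (auto simp: space_pair_measure)
    then show ?thesis using lborel.measurable_emeasure_Pair[OF A] by (subst (asm) measurable_cong) auto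
  qed
  have "(\<integral>\<^sup>+\<omega>. emeasure lborel {x. infconv p (skeleton t \<omega>) x < r} \<partial>M)
      = (\<integral>\<^sup>+\<omega>. ennreal (r ^ CARD('d)) * emeasure lborel {x. infconv p ((\<lambda>v. (1 / r) *\<^sub>R v) ` skeleton t \<omega>) x < 1 \<and> 1 \<le> p x}
        + ennreal (r ^ CARD('d)) * emeasure lborel {x. p x \<le> 1} \<partial>M)"
    by (intro nn_integral_cong split)
  also have "\<dots> = ennreal (r ^ CARD('d)) * shell (1 / r * t powr (1 / \<alpha>)) + ennreal (r ^ CARD('d)) * emeasure lborel {x. p x \<le> 1}"
    using m emeasure_space_1 shell_scaling_general[of "1 / r" t] r t
    by (subst nn_integral_add) (auto simp: nn_integral_cmult)
  finally show ?thesis by (simp add: distrib_left)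
qed

lemma expectation_volume:
  assumes t: "0 < t" "t \<le> 1"
  shows "expectation (\<lambda>\<omega>. measure lborel (minkowski (range_set X t \<omega>) {x. p x \<le> 1}))
       = enn2real (shell (t powr (1 / \<alpha>))) + measure lborel {x. p x \<le> 1}"
proof -
  define e where "e = t powr (1 / \<alpha>)"
  have e: "0 < e" "e \<le> 1" using t alpha powr_mono2[of "1 / \<alpha>" t 1] by (auto simp: e_def)
  define \<tau> where "\<tau> = enn2real (shell e) + measure lborel {x. p x \<le> 1}"
  have \<tau>: "shell e + emeasure lborel {x. p x \<le> 1} = ennreal \<tau>" "0 \<le> \<tau>"
    unfolding \<tau>_def using shell_finite[OF e] emeasure_lborel_compact_finite[OF compact_gauge_le[of 1]]
    by (auto simp: ennreal_plus emeasure_eq_ennreal_measure less_top)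
  let ?H = "\<integral>\<^sup>+\<omega>. emeasure lborel {x. infconv p (skeleton t \<omega>) x \<le> 1} \<partial>M"
  have set_m: "{x. infconv p (skeleton t \<omega>) x < r} \<in> sets lborel" "{x. infconv p (skeleton t \<omega>) x \<le> r} \<in> sets lborel"
    if "\<omega> \<in> space M" for \<omega> r
  proof -
    have ne: "skeleton t \<omega> \<noteq> {}" using zero_in_skeleton[OF that] by auto
    note [measurable] = borel_measurable_infconv[OF ne]
    show "{x. infconv p (skeleton t \<omega>) x < r} \<in> sets lborel" "{x. infconv p (skeleton t \<omega>) x \<le> r} \<in> sets lborel"
      by measurable
  qed
  have "ennreal \<tau> = (\<integral>\<^sup>+\<omega>. emeasure lborel {x. infconv p (skeleton t \<omega>) x < 1} \<partial>M)"
    using nn_integral_infconv_less[OF t(1), of 1] by (simp add: e_def[symmetric] \<tau>)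
  also have "\<dots> \<le> ?H"
    using set_m by (intro nn_integral_mono emeasure_mono) auto
  finally have low: "ennreal \<tau> \<le> ?H" .
  have up: "?H \<le> ennreal ((1 + \<eta>) ^ CARD('d) * \<tau>)" if \<eta>: "0 < \<eta>" for \<eta>
  proof -
    have "?H \<le> (\<integral>\<^sup>+\<omega>. emeasure lborel {x. infconv p (skeleton t \<omega>) x < 1 + \<eta>} \<partial>M)"
      using set_m \<eta> by (intro nn_integral_mono emeasure_mono) auto
    also have "\<dots> = ennreal ((1 + \<eta>) ^ CARD('d)) * (shell (e / (1 + \<eta>)) + emeasure lborel {x. p x \<le> 1})"
      unfolding e_def using \<eta> by (intro nn_integral_infconv_less t) simp
    also have "\<dots> \<le> ennreal ((1 + \<eta>) ^ CARD('d)) * (shell e + emeasure lborel {x. p x \<le> 1})"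
      using e \<eta> by (intro mult_left_mono add_right_mono shell_mono) (auto simp: divide_le_eq)
    also have "\<dots> = ennreal ((1 + \<eta>) ^ CARD('d) * \<tau>)"
      unfolding \<tau>(1) using \<eta> by (intro ennreal_mult'[symmetric]) simp
    finally show ?thesis .
  qed
  have "((\<lambda>\<eta>. ennreal ((1 + \<eta>) ^ CARD('d) * \<tau>)) \<longlongrightarrow> ennreal ((1 + 0) ^ CARD('d) * \<tau>)) (at_right 0)"
    by (intro tendsto_ennrealI tendsto_intros)
  then have "?H \<le> ennreal ((1 + 0) ^ CARD('d) * \<tau>)"
    by (rule tendsto_lowerbound) (use up in \<open>auto simp: eventually_at_filter\<close>)
  then have H: "?H = ennreal \<tau>" using low by simp
  have "expectation (\<lambda>\<omega>. measure lborel (minkowski (range_set X t \<omega>) {x. p x \<le> 1}))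
      = expectation (\<lambda>\<omega>. enn2real (emeasure lborel {x. infconv p (skeleton t \<omega>) x \<le> 1}))"
    by (intro Bochner_Integration.integral_cong refl) (simp add: minkowski_range_set t measure_def)
  also have "\<dots> = enn2real (\<integral>\<^sup>+\<omega>. ennreal (enn2real (emeasure lborel {x. infconv p (skeleton t \<omega>) x \<le> 1})) \<partial>M)"
    using borel_measurable_infconv_volume[of t 1] t by (intro integral_eq_nn_integral) auto
  also have "(\<integral>\<^sup>+\<omega>. ennreal (enn2real (emeasure lborel {x. infconv p (skeleton t \<omega>) x \<le> 1})) \<partial>M) = ?H"
  proof (intro nn_integral_cong)
    fix \<omega> assume \<omega>: "\<omega> \<in> space M"
    have "compact (range_set X t \<omega>)"
      unfolding closure_skeleton[OF \<omega> t(1), symmetric] using bounded_skeleton[OF \<omega>, of t] t by (simp add: compact_closure)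
    then have "compact {x. infconv p (skeleton t \<omega>) x \<le> 1}"
      unfolding minkowski_range_set[OF \<omega> t(1), symmetric] by (intro compact_minkowski compact_gauge_le)
    from emeasure_lborel_compact_finite[OF this]
    show "ennreal (enn2real (emeasure lborel {x. infconv p (skeleton t \<omega>) x \<le> 1})) = emeasure lborel {x. infconv p (skeleton t \<omega>) x \<le> 1}"
      by (simp add: less_top)
  qed
  finally show ?thesis unfolding H enn2real_ennreal[OF \<tau>(2)] by (simp only: \<tau>_def e_def)
qed

end

theorem theorem2:
  fixes M :: "'w measure" and X :: "real \<Rightarrow> 'w \<Rightarrow> real^'d"
    and \<alpha> \<alpha>' :: real and B :: "(real^'d) set" and j0 :: 'd
  assumes "prob_space M"
    and "1 < \<alpha>" and "\<alpha> \<le> 2"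
    and "1 / \<alpha> + 1 / \<alpha>' = 1"
    and "\<And>j. sas_levy M \<alpha> (\<lambda>t \<omega>. X t \<omega> $ j)"
    and "prob_space.indep_vars M (\<lambda>_. Pi\<^sub>M UNIV (\<lambda>_::real. borel))
           (\<lambda>j \<omega>. (\<lambda>t. X t \<omega> $ j)) UNIV"
    and "convex_body B" and "interior B \<noteq> {}"
  shows "((\<lambda>t. t powr (- 1 / \<alpha>) *
            (prob_space.expectation M (\<lambda>\<omega>. measure lborel (minkowski (range_set X t \<omega>) B))
             - measure lborel B))
         \<longlongrightarrow> real CARD('d) * (\<alpha> / 2 * prob_space.expectation M (\<lambda>\<omega>. \<bar>X 1 \<omega> $ j0\<bar>))
             * mixed_volume (replicate (CARD('d) - 1) B @ [lp_ball \<alpha>'])) (at_right 0)"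
proof -
  have "1 / \<alpha>' = 1 - 1 / \<alpha>" using assms(4) by simp
  moreover have "0 < 1 - 1 / \<alpha>" "1 - 1 / \<alpha> < 1" using assms(2) by auto
  ultimately have \<alpha>': "1 < \<alpha>'" by (metis divide_less_eq_1_pos one_less_inverse_iff inverse_eq_divide zero_less_divide_1_iff inverse_inverse_eq)
  note conj = assms(2) \<alpha>' assms(4)
  obtain b where b: "b \<in> interior B" using assms(8) by blast
  \<comment> \<open>The translation puts 0 in the interior, as the gauge requires, and changes none
    of the volumes involved.\<close>
  define A where "A = (\<lambda>x. - b + x) ` B"
  have B: "compact B" "convex B" "B \<noteq> {}" using assms(7) by (auto simp: convex_body_def)
  have A: "compact A" "convex A"
    unfolding A_def by (intro compact_translation convex_translation B)+
  have A0: "0 \<in> interior A"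
    unfolding A_def interior_translation using b by (intro image_eqI[of _ _ b]) auto
  obtain p L m where p: "gauge_function p L m" "A = {x. p x \<le> 1}"
    using convex_body_gauge[OF A A0] by blast
  interpret stable_gauge M X \<alpha> p L m
    using assms p(1) by (intro stable_gauge.intro stable_process.intro stable_process_axioms.intro) auto
  let ?K = "lp_ball \<alpha>' :: (real^'d) set"
  define D where "D = real CARD('d) * mixed_volume (replicate (CARD('d) - 1) A @ [?K])"
  note K = compact_lp_ball[OF conj, where 'd = 'd] convex_lp_ball[OF conj, where 'd = 'd] zero_in_interior_lp_ball[OF conj, where 'd = 'd]
  have K0: "0 \<in> ?K" using K(3) interior_subset by blast
  have D: "((\<lambda>e. (measure lborel (minkowski A ((\<lambda>v. e *\<^sub>R v) ` ?K)) - measure lborel A) / e) \<longlongrightarrow> D) (at_right 0)"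
    unfolding D_def by (rule minkowski_derivative_at_0[OF A A0 K])
  have D0: "0 \<le> D"
  proof (rule tendsto_lowerbound[OF D])
    have "measure lborel A \<le> measure lborel (minkowski A ((\<lambda>v. e *\<^sub>R v) ` ?K))" for e
    proof (intro measure_lborel_mono_compact compact_minkowski compact_scaling A K)
      show "A \<subseteq> minkowski A ((\<lambda>v. e *\<^sub>R v) ` ?K)" using K0 by (force simp: minkowski_def)
    qed
    then show "\<forall>\<^sub>F e in at_right 0. 0 \<le> (measure lborel (minkowski A ((\<lambda>v. e *\<^sub>R v) ` ?K)) - measure lborel A) / e"
      by (auto simp: eventually_at_filter)
  qed simp
  have "(SUP k\<in>?K. g \<bullet> k) = alpha_norm g" for g
    unfolding alpha_norm_def by (rule SUP_inner_lp_ball[OF conj])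
  then have slope: "((\<lambda>e. enn2real (shell e) / e) \<longlongrightarrow> \<alpha> / 2 * mean_abs * D) (at_right 0)"
    by (rule shell_slope[OF _ K(1,2) K0 D0]) (use D in \<open>simp add: p(2)\<close>)
  \<comment> \<open>Substitution \<open>e = t powr (1 / \<alpha>)\<close>: the divisor
    \<open>e\<close> of the slope becomes the normalising factor of the statement.\<close>
  have "((\<lambda>t::real. t powr (1 / \<alpha>)) \<longlongrightarrow> 0 powr (1 / \<alpha>)) (at_right 0)"
    using alpha by (intro tendsto_powr' tendsto_intros) (auto simp: eventually_at_filter)
  then have "filterlim (\<lambda>t::real. t powr (1 / \<alpha>)) (at_right 0) (at_right 0)"
    by (auto simp: filterlim_at eventually_at_filter)
  note lim = filterlim_compose[OF slope this]
  have eq: "enn2real (shell (t powr (1 / \<alpha>))) / t powr (1 / \<alpha>)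
      = t powr (- 1 / \<alpha>) * (expectation (\<lambda>\<omega>. measure lborel (minkowski (range_set X t \<omega>) B)) - measure lborel B)"
    if t: "0 < t" "t \<le> 1" for t
  proof -
    have BA: "B = (\<lambda>x. b + x) ` A" unfolding A_def by (simp add: image_image)
    have "measure lborel (minkowski (range_set X t \<omega>) B) = measure lborel (minkowski (range_set X t \<omega>) {x. p x \<le> 1})"
      if "\<omega> \<in> space M" for \<omega>
    proof -
      have "compact (range_set X t \<omega>)"
        unfolding closure_skeleton[OF that t(1), symmetric] using bounded_skeleton[OF that, of t] t by (simp add: compact_closure)
      then show ?thesis
        unfolding BA minkowski_translation p(2)[symmetric]
        by (intro measure_lborel_translation borel_compact compact_minkowski A)
    qed
    then have "expectation (\<lambda>\<omega>. measure lborel (minkowski (range_set X t \<omega>) B))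
        = expectation (\<lambda>\<omega>. measure lborel (minkowski (range_set X t \<omega>) {x. p x \<le> 1}))"
      by (intro Bochner_Integration.integral_cong) auto
    moreover have "measure lborel B = measure lborel {x. p x \<le> 1}"
      unfolding BA p(2)[symmetric] by (intro measure_lborel_translation borel_compact A)
    ultimately show ?thesis
      using expectation_volume[OF t] t by (simp add: powr_minus field_simps)
  qed
  have ev: "\<forall>\<^sub>F t in at_right 0. enn2real (shell (t powr (1 / \<alpha>))) / t powr (1 / \<alpha>)
      = t powr (- 1 / \<alpha>) * (expectation (\<lambda>\<omega>. measure lborel (minkowski (range_set X t \<omega>) B)) - measure lborel B)"
    using eq by (auto simp: eventually_at_right_field intro!: exI[of _ 1])
  have "mixed_volume (replicate (CARD('d) - 1) A @ [?K]) = mixed_volume (replicate (CARD('d) - 1) B @ [?K])"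
    unfolding A_def by (rule mixed_volume_replicate_translation[OF B K(1)])
  then have const: "\<alpha> / 2 * mean_abs * D = real CARD('d) * (\<alpha> / 2 * expectation (\<lambda>\<omega>. \<bar>X 1 \<omega> $ j0\<bar>))
             * mixed_volume (replicate (CARD('d) - 1) B @ [?K])"
    by (simp add: D_def mean_abs_eq)
  from Lim_transform_eventually[OF lim ev] show ?thesis unfolding const .
qed


end
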